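(* For any $\epsilon > 0$, the fixed-base joint replenishment problem can be approximated within factor $\frac{1}{\sqrt{2}\ln 2} + \epsilon$ of optimal; that is, there is an algorithm that, given the instance and the base $\Delta > 0$, computes a feasible policy whose long-run average cost is at most $\left(\frac{1}{\sqrt{2}\ln 2} + \epsilon\right)$ times the optimal cost of a feasible policy. The running time of this algorithm is $O(2^{O(1/\epsilon^2)} \cdot n^{O(1)})$.
   Context: Joint replenishment problem: there are $n$ commodities; commodity $i \in [n]$ has ordering cost $K_i > 0$ and holding-cost parameter $H_i > 0$, and there is a joint ordering cost $K_0 > 0$. A replenishment policy is a vector $T = (T_1,\ldots,T_n)$ of positive reals, where commodity $i$ is ordered at times $0, T_i, 2T_i, \ldots$. The marginal cost of commodity $i$ is $C_i(T_i) = \frac{K_i}{T_i} + H_i T_i$. For $\Delta' \geq 0$, let $N(T,\Delta') = \left| \bigcup_{i\in[n]} \{0, T_i, 2T_i, \ldots, \lfloor \Delta'/T_i \rfloor T_i\} \right|$, and $J(T) = K_0 \cdot \lim_{\Delta'\to\infty} \frac{N(T,\Delta')}{\Delta'}$. The long-run average cost is $F(T) = J(T) + \sum_{i\in[n]} C_i(T_i)$. In the fixed-base version, a base $\Delta > 0$ is given, and a policy is feasible only if every $T_i$ is a positive integer multiple of $\Delta$; the goal is to minimize $F$ over feasible policies. *)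

theory Defs
  imports Complex_Main
begin

section \<open>The joint replenishment problem\<close>

text \<open>
  An instance with \<open>n\<close> commodities is given by \<open>K, H :: nat \<Rightarrow> real\<close>: the joint ordering cost is
  \<open>K 0\<close>, and commodity \<open>i \<in> {1..n}\<close> has ordering cost \<open>K i\<close> and holding-cost parameter \<open>H i\<close>.
  Policies are functions \<open>T :: nat \<Rightarrow> real\<close> of which only the values on \<open>{1..n}\<close> matter.
\<close>

definition jrp_instance :: "nat \<Rightarrow> (nat \<Rightarrow> real) \<Rightarrow> (nat \<Rightarrow> real) \<Rightarrow> bool" where
  "jrp_instance n K H \<longleftrightarrow> n \<ge> 1 \<and> K 0 > 0 \<and> (\<forall>i\<in>{1..n}. K i > 0 \<and> H i > 0)"

definition marginal_cost :: "(nat \<Rightarrow> real) \<Rightarrow> (nat \<Rightarrow> real) \<Rightarrow> nat \<Rightarrow> real \<Rightarrow> real" where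
  "marginal_cost K H i t = K i / t + H i * t"

definition num_orders :: "nat \<Rightarrow> (nat \<Rightarrow> real) \<Rightarrow> real \<Rightarrow> nat" where
  "num_orders n T D = card (\<Union>i\<in>{1..n}. (\<lambda>k. real k * T i) ` {0..nat \<lfloor>D / T i\<rfloor>})"

definition joint_cost :: "nat \<Rightarrow> (nat \<Rightarrow> real) \<Rightarrow> (nat \<Rightarrow> real) \<Rightarrow> real" where
  "joint_cost n K T = K 0 * Lim at_top (\<lambda>D. real (num_orders n T D) / D)"

definition avg_cost :: "nat \<Rightarrow> (nat \<Rightarrow> real) \<Rightarrow> (nat \<Rightarrow> real) \<Rightarrow> (nat \<Rightarrow> real) \<Rightarrow> real" where
  "avg_cost n K H T = joint_cost n K T + (\<Sum>i\<in>{1..n}. marginal_cost K H i (T i))"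

definition feasible :: "nat \<Rightarrow> real \<Rightarrow> (nat \<Rightarrow> real) \<Rightarrow> bool" where
  "feasible n \<Delta> T \<longleftrightarrow> (\<forall>i\<in>{1..n}. \<exists>k::nat. k \<ge> 1 \<and> T i = real k * \<Delta>)"

definition opt_cost :: "nat \<Rightarrow> (nat \<Rightarrow> real) \<Rightarrow> (nat \<Rightarrow> real) \<Rightarrow> real \<Rightarrow> real" where
  "opt_cost n K H \<Delta> = Inf (avg_cost n K H ` {T. feasible n \<Delta> T})"


section \<open>Real random-access machine\<close>

text \<open>
  Unit-cost real RAM, programmed in a structured imperative language. A state consists of registers
  and of an indirectly addressable memory, both holding reals. Besides the arithmetic operations,
  comparison and memory access, the machine has the primitives \<open>Sqrt\<close> and \<open>Floor\<close>: already for one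
  commodity, a near-optimal policy is an integer multiple of \<open>\<Delta>\<close> close to \<open>sqrt ((K 0 + K 1) / H 1)\<close>,
  and the number of steps must not depend on the magnitude of the data. The only constants in
  programs are integers.

  Partial operations are totalised as in HOL: \<open>x / 0 = 0\<close> and \<open>sqrt (- x) = - sqrt x\<close>.
  Addresses are rounded down, negative ones to cell 0.
\<close>

type_synonym state = "(nat \<Rightarrow> real) \<times> (nat \<Rightarrow> real)"

datatype aexp =
    Const int
  | Reg nat
  | Mem aexp
  | Add aexp aexp
  | Sub aexp aexp
  | Mul aexp aexp
  | Div aexp aexp
  | Sqrt aexp
  | Floor aexp

fun aval :: "aexp \<Rightarrow> state \<Rightarrow> real" where
  "aval (Const c) s = of_int c"
| "aval (Reg r) s = fst s r"
| "aval (Mem a) s = snd s (nat \<lfloor>aval a s\<rfloor>)"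
| "aval (Add a b) s = aval a s + aval b s"
| "aval (Sub a b) s = aval a s - aval b s"
| "aval (Mul a b) s = aval a s * aval b s"
| "aval (Div a b) s = aval a s / aval b s"
| "aval (Sqrt a) s = sqrt (aval a s)"
| "aval (Floor a) s = of_int \<lfloor>aval a s\<rfloor>"

fun acost :: "aexp \<Rightarrow> nat" where
  "acost (Const c) = 1"
| "acost (Reg r) = 1"
| "acost (Mem a) = acost a + 1"
| "acost (Add a b) = acost a + acost b + 1"
| "acost (Sub a b) = acost a + acost b + 1"
| "acost (Mul a b) = acost a + acost b + 1"
| "acost (Div a b) = acost a + acost b + 1"
| "acost (Sqrt a) = acost a + 1"
| "acost (Floor a) = acost a + 1"

text \<open>\<open>SetReg r a\<close> is \<open>reg[r] := a\<close>; \<open>SetMem a b\<close> is \<open>mem[a] := b\<close>; the tests are \<open>a < b\<close>.\<close>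

datatype com =
    Skip
  | SetReg nat aexp
  | SetMem aexp aexp
  | Seq com com
  | IfLess aexp aexp com com
  | WhileLess aexp aexp com

text \<open>\<open>exec p s t s'\<close>: started in \<open>s\<close>, the program \<open>p\<close> halts in \<open>s'\<close> after \<open>t\<close> steps.\<close>

inductive exec :: "com \<Rightarrow> state \<Rightarrow> nat \<Rightarrow> state \<Rightarrow> bool" where
  exec_Skip: "exec Skip s 1 s"
| exec_SetReg: "exec (SetReg r a) s (acost a + 1) ((fst s)(r := aval a s), snd s)"
| exec_SetMem: "exec (SetMem a b) s (acost a + acost b + 1)
    (fst s, (snd s)(nat \<lfloor>aval a s\<rfloor> := aval b s))"
| exec_Seq: "exec p s t s' \<Longrightarrow> exec q s' t' s'' \<Longrightarrow> exec (Seq p q) s (t + t') s''"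
| exec_IfTrue: "aval a s < aval b s \<Longrightarrow> exec p s t s' \<Longrightarrow>
    exec (IfLess a b p q) s (acost a + acost b + 1 + t) s'"
| exec_IfFalse: "\<not> aval a s < aval b s \<Longrightarrow> exec q s t s' \<Longrightarrow>
    exec (IfLess a b p q) s (acost a + acost b + 1 + t) s'"
| exec_WhileTrue: "aval a s < aval b s \<Longrightarrow> exec p s t s' \<Longrightarrow>
    exec (WhileLess a b p) s' t' s'' \<Longrightarrow>
    exec (WhileLess a b p) s (acost a + acost b + 1 + t + t') s''"
| exec_WhileFalse: "\<not> aval a s < aval b s \<Longrightarrow>
    exec (WhileLess a b p) s (acost a + acost b + 1) s"

inductive_cases exec_SkipE: "exec Skip s t s'"
inductive_cases exec_SetRegE: "exec (SetReg r a) s t s'"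
inductive_cases exec_SetMemE: "exec (SetMem a b) s t s'"
inductive_cases exec_SeqE: "exec (Seq p q) s t s'"
inductive_cases exec_IfE: "exec (IfLess a b p q) s t s'"
inductive_cases exec_WhileE: "exec (WhileLess a b p) s t s'"

lemma exec_deterministic:
  "exec p s t s' \<Longrightarrow> exec p s u s'' \<Longrightarrow> u = t \<and> s'' = s'"
proof (induction arbitrary: u s'' rule: exec.induct)
  case (exec_Skip s)
  from exec_Skip.prems show ?case by (rule exec_SkipE) simp
next
  case (exec_SetReg r a s)
  from exec_SetReg.prems show ?case by (rule exec_SetRegE) simp
next
  case (exec_SetMem a b s)
  from exec_SetMem.prems show ?case by (rule exec_SetMemE) simp
next
  case (exec_Seq p s t s1 q t' s2)
  from exec_Seq.prems show ?case
    by (rule exec_SeqE) (metis exec_Seq.IH)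
next
  case (exec_IfTrue a s b p t s' q)
  from exec_IfTrue.prems show ?case
    by (rule exec_IfE) (use exec_IfTrue.hyps(1) in \<open>auto dest!: exec_IfTrue.IH\<close>)
next
  case (exec_IfFalse a s b q t s' p)
  from exec_IfFalse.prems show ?case
    by (rule exec_IfE) (use exec_IfFalse.hyps(1) in \<open>auto dest!: exec_IfFalse.IH\<close>)
next
  case (exec_WhileTrue a s b p t s1 t' s2)
  from exec_WhileTrue.prems show ?case
  proof (rule exec_WhileE)
    fix v s3 w
    assume u: "u = Suc (acost a + acost b + v + w)"
      and v: "exec p s v s3" and w: "exec (WhileLess a b p) s3 w s''"
    from exec_WhileTrue.IH(1)[OF v] have "v = t" "s3 = s1" by auto
    with exec_WhileTrue.IH(2) w have "w = t'" "s'' = s2" by auto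
    with \<open>v = t\<close> u show ?case by simp
  next
    assume "\<not> aval a s < aval b s"
    with exec_WhileTrue.hyps(1) show ?case by simp
  qed
next
  case (exec_WhileFalse a s b p)
  from exec_WhileFalse.prems show ?case
    by (rule exec_WhileE) (use exec_WhileFalse.hyps in auto)
qed

text \<open>
  Input: registers 0, 1, 2 hold \<open>n\<close>, \<open>\<epsilon>\<close>, \<open>\<Delta>\<close>; memory cells \<open>0, ..., n\<close> hold \<open>K 0, ..., K n\<close> and
  cells \<open>n + 1, ..., 2 * n\<close> hold \<open>H 1, ..., H n\<close>; everything else is zero.
  Output: cell \<open>i\<close> of the final memory holds \<open>T i\<close>, for \<open>i \<in> {1..n}\<close>.
\<close>

definition input_state ::
  "real \<Rightarrow> nat \<Rightarrow> (nat \<Rightarrow> real) \<Rightarrow> (nat \<Rightarrow> real) \<Rightarrow> real \<Rightarrow> state" where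
  "input_state \<epsilon> n K H \<Delta> =
    ((\<lambda>r. if r = 0 then real n else if r = 1 then \<epsilon> else if r = 2 then \<Delta> else 0),
     (\<lambda>j. if j \<le> n then K j else if j \<le> 2 * n then H (j - n) else 0))"

definition output_policy :: "state \<Rightarrow> nat \<Rightarrow> real" where
  "output_policy s = snd s"

end

theory Submission
  imports Defs "HOL-Analysis.Analysis" "HOL-Library.Nat_Bijection"
begin

text \<open>
  Let \<open>r\<close> be about \<open>11 / \<epsilon>\<close>. A candidate policy consists of a set \<open>S\<close> of integers up to \<open>8 * r\<^sup>2\<close> and a
  base \<open>m\<close>: every commodity takes the cheapest interval among \<open>s * \<Delta>\<close> for \<open>s \<in> S\<close> and the multiples of
  \<open>m * \<Delta>\<close>, and the joint orders have density at most that of the multiples of \<open>S\<close>, plus \<open>1 / m\<close>. The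
  density of the multiples of \<open>S\<close> is estimated by counting up to \<open>W\<close>; by inclusion-exclusion the error
  of the count is at most \<open>2 ^ card S\<close>, whatever the period is.

  Compare with a feasible \<open>T\<close>. If its least interval is at most \<open>r * \<Delta>\<close>, its joint cost is at least
  \<open>K 0 / (r * \<Delta>)\<close>. So adding all multiples of \<open>r\<^sup>2 * \<Delta>\<close> to the joint orders is cheap, and these
  approximate every interval above \<open>8 * r\<^sup>2 * \<Delta>\<close> well; for \<open>S\<close> take the remaining intervals of \<open>T\<close>.
  Otherwise all intervals are so long that rounding to multiples of \<open>\<Delta>\<close> is harmless. Then relax the
  joint cost to \<open>K 0 / x\<close>, where \<open>x\<close> bounds all intervals from below; the optimal \<open>x\<close> is one of \<open>2 * n + 1\<close>
  explicit values, and rounding all intervals to powers of two times a common base loses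
  \<open>1 / (sqrt 2 * ln 2)\<close> on average over the base. Powers of two are not needed by the algorithm: it takes
  the best multiple of the base, in a number of steps that does not depend on the size of the data.
\<close>

section \<open>The density of a set of multiples\<close>

text \<open>The joint cost couples the commodities: it is \<open>K 0 / \<Delta>\<close> times the
  density of a union of progressions. Fixing \<open>S\<close> and \<open>m\<close> removes the
  coupling, since the bound on the joint cost then holds for every choice among the allowed
  intervals and each commodity is optimised alone. The numbers balance as follows. An interval of at
  most \<open>r\<close> units forces an order density of at least \<open>1 / r\<close>, so extra
  orders of density \<open>1 / r\<^sup>2\<close> are a fraction \<open>1 / r\<close> of it. The
  factor 8 keeps the loss of rounding to multiples of \<open>r\<^sup>2\<close> at
  \<open>289 / 288\<close>, below \<open>1 / (sqrt 2 * ln 2)\<close>; the averaging loss arises only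
  when all intervals are long. Enumerating the subsets of \<open>{1..8 * r\<^sup>2}\<close> makes
  the time exponential in \<open>1 / \<epsilon>\<^sup>2\<close>. Neither argument covers the other
  case: long intervals have no bound in terms of \<open>r\<close> and cannot be enumerated, while
  with short ones rounding a base to a multiple of \<open>\<Delta>\<close> may cost a constant
  factor. One list of candidates serves both, with \<open>S\<close> empty in the long case.\<close>

definition mult_count :: "nat set \<Rightarrow> nat \<Rightarrow> nat" where
  "mult_count S N = card {k \<in> {1..N}. \<exists>s\<in>S. s dvd k}"

lemma
  fixes N q :: nat
  shows real_div_le: "real (N div q) \<le> real N / real q"
    and real_div_ge: "real N / real q - 1 \<le> real (N div q)"
proof -
  have "real (N div q) = of_int \<lfloor>real N / real q\<rfloor>" by (simp add: floor_divide_of_nat_eq)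
  then show "real (N div q) \<le> real N / real q" "real N / real q - 1 \<le> real (N div q)" by linarith+
qed

lemma card_multiples: 
  assumes "q > 0" shows "card {k \<in> {1..N}. q dvd k} = N div (q::nat)"
proof -
  have "{k \<in> {1..N}. q dvd k} = (\<lambda>i. q * i) ` {1..N div q}"
  proof (intro set_eqI iffI)
    fix k assume "k \<in> {k \<in> {1..N}. q dvd k}"
    then obtain i where "k = q * i" "1 \<le> k" "k \<le> N" by auto
    moreover from this have "i \<le> N div q" using assms
      by (simp add: less_eq_div_iff_mult_less_eq mult.commute)
    moreover have "1 \<le> i" using calculation by (cases i) auto
    ultimately show "k \<in> (\<lambda>i. q * i) ` {1..N div q}" by auto
  next
    fix k assume "k \<in> (\<lambda>i. q * i) ` {1..N div q}"
    then show "k \<in> {k \<in> {1..N}. q dvd k}" using assms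
      by (auto simp: less_eq_div_iff_mult_less_eq mult.commute Suc_le_eq)
  qed
  then show ?thesis using assms by (simp add: card_image inj_on_def)
qed

text \<open>Sieving by a further \<open>s\<close> removes from the multiples of \<open>q\<close>
  exactly those of \<open>lcm q s\<close>. So two counts for the same \<open>S\<close> are
  subtracted and their errors add: the error doubles with each element. The claim ranges over all
  \<open>q\<close> because the induction replaces \<open>q\<close> by \<open>lcm q s\<close>; the
  error bound does not depend on \<open>q\<close>.\<close>

lemma sieve_density:
  fixes S :: "nat set"
  assumes "finite S" "0 \<notin> S" "q > 0"
  shows "\<exists>\<delta>. \<forall>N. \<bar>real (card {k \<in> {1..N}. q dvd k \<and> (\<forall>s\<in>S. \<not> s dvd k)}) - \<delta> * real N\<bar> \<le> 2 ^ card S"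
  using assms
proof (induction S arbitrary: q rule: finite_induct)
  case empty
  have "\<bar>real (N div q) - 1 / real q * real N\<bar> \<le> 1" for N
  proof -
    have "real N / real q - 1 \<le> real (N div q)" "real (N div q) \<le> real N / real q"
      using real_div_ge[of N q] real_div_le[of N q] by auto
    then show ?thesis by (simp add: abs_le_iff)
  qed
  then have "\<forall>N. \<bar>real (card {k \<in> {1..N}. q dvd k \<and> (\<forall>s\<in>{}. \<not> s dvd k)}) - 1 / real q * real N\<bar> \<le> 2 ^ card {}"
    using card_multiples[OF empty.prems(2)] by simp
  then show ?case by blast
next
  case (insert s S)
  let ?A = "\<lambda>q N. {k \<in> {1..N}. q dvd k \<and> (\<forall>s\<in>S. \<not> s dvd k)}"
  from insert have s: "s > 0" "0 \<notin> S" by auto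
  obtain d1 where d1: "\<And>N. \<bar>real (card (?A q N)) - d1 * real N\<bar> \<le> 2 ^ card S"
    using insert.IH[of q] s insert.prems by blast
  obtain d2 where d2: "\<And>N. \<bar>real (card (?A (lcm q s) N)) - d2 * real N\<bar> \<le> 2 ^ card S"
    using insert.IH[of "lcm q s"] s insert.prems by (auto simp: lcm_pos_nat)
  have "\<bar>real (card {k \<in> {1..N}. q dvd k \<and> (\<forall>t\<in>insert s S. \<not> t dvd k)}) - (d1 - d2) * real N\<bar>
      \<le> 2 ^ card (insert s S)" for N
  proof -
    have sub: "?A (lcm q s) N \<subseteq> ?A q N" by auto
    have "{k \<in> {1..N}. q dvd k \<and> (\<forall>t\<in>insert s S. \<not> t dvd k)} = ?A q N - ?A (lcm q s) N"
      by (auto simp: lcm_least_iff)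
    then have "real (card {k \<in> {1..N}. q dvd k \<and> (\<forall>t\<in>insert s S. \<not> t dvd k)})
      = real (card (?A q N)) - real (card (?A (lcm q s) N))"
      using sub card_mono[OF _ sub] by (simp add: card_Diff_subset of_nat_diff)
    moreover have "(2::real) ^ card (insert s S) = 2 ^ card S + 2 ^ card S"
      using insert.hyps by simp
    ultimately show ?thesis using d1[of N] d2[of N] by (simp add: abs_le_iff algebra_simps)
  qed
  then show ?case by blast
qed

definition mult_density :: "nat set \<Rightarrow> real" where
  "mult_density S = lim (\<lambda>N. real (mult_count S N) / real N)"

lemma bounded_over_n_tendsto:
  fixes f :: "nat \<Rightarrow> real"
  assumes "\<And>N. \<bar>f N - d * real N\<bar> \<le> c"
  shows "(\<lambda>N. f N / real N) \<longlonglongrightarrow> d"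
proof -
  have "(\<lambda>N. f N / real N - d) \<longlonglongrightarrow> 0"
  proof (rule Lim_null_comparison)
    show "\<forall>\<^sub>F N in sequentially. norm (f N / real N - d) \<le> c * (1 / real N)"
      using eventually_gt_at_top[of 0]
    proof eventually_elim
      case (elim N)
      then have "f N / real N - d = (f N - d * real N) / real N" by (simp add: field_simps)
      then show ?case using assms[of N] elim by (simp add: divide_right_mono)
    qed
    show "(\<lambda>N. c * (1 / real N)) \<longlonglongrightarrow> 0"
      using tendsto_mult_right_zero[OF lim_1_over_n] by blast
  qed
  then show ?thesis by (simp add: LIM_zero_iff)
qed

text \<open>The sieve with \<open>q = 1\<close> counts the complement, so the density is one minus
  that of the sieve, with the same error.\<close>

lemma mult_count_approx_aux:
  assumes "finite S" "0 \<notin> S"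
  shows "\<exists>d. \<forall>N. \<bar>real (mult_count S N) - d * real N\<bar> \<le> 2 ^ card S"
proof -
  obtain d where d: "\<And>N. \<bar>real (card {k \<in> {1..N}. 1 dvd k \<and> (\<forall>s\<in>S. \<not> s dvd k)}) - d * real N\<bar> \<le> 2 ^ card S"
    using sieve_density[OF assms, of 1] by auto
  have "\<bar>real (mult_count S N) - (1 - d) * real N\<bar> \<le> 2 ^ card S" for N
  proof -
    have "mult_count S N + card {k \<in> {1..N}. 1 dvd k \<and> (\<forall>s\<in>S. \<not> s dvd k)} = card {1..N}"
      unfolding mult_count_def
      by (subst card_Un_disjoint[symmetric]) (auto simp del: card_atLeastAtMost intro!: arg_cong[where f=card])
    then have "real (mult_count S N) + real (card {k \<in> {1..N}. 1 dvd k \<and> (\<forall>s\<in>S. \<not> s dvd k)}) = real N"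
      by (simp flip: of_nat_add)
    then show ?thesis using d[of N] by (simp add: algebra_simps abs_le_iff)
  qed
  then show ?thesis by blast
qed

lemma
  assumes "finite S" "0 \<notin> S"
  shows mult_count_approx: "\<bar>real (mult_count S N) - mult_density S * real N\<bar> \<le> 2 ^ card S"
    and mult_density_tendsto: "(\<lambda>N. real (mult_count S N) / real N) \<longlonglongrightarrow> mult_density S"
proof -
  obtain d where d: "\<And>N. \<bar>real (mult_count S N) - d * real N\<bar> \<le> 2 ^ card S"
    using mult_count_approx_aux[OF assms] by auto
  have l: "(\<lambda>N. real (mult_count S N) / real N) \<longlonglongrightarrow> d"
    by (rule bounded_over_n_tendsto[OF d])
  then have "mult_density S = d" unfolding mult_density_def by (rule limI)
  then show "\<bar>real (mult_count S N) - mult_density S * real N\<bar> \<le> 2 ^ card S"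
    and "(\<lambda>N. real (mult_count S N) / real N) \<longlonglongrightarrow> mult_density S"
    using d l by auto
qed

lemma mult_count_mono: "S \<subseteq> S' \<Longrightarrow> mult_count S N \<le> mult_count S' N"
  unfolding mult_count_def by (rule card_mono) auto

lemma mult_density_mono:
  assumes "S \<subseteq> S'" "finite S'" "0 \<notin> S'"
  shows "mult_density S \<le> mult_density S'"
proof (rule LIMSEQ_le[OF mult_density_tendsto mult_density_tendsto])
  show "\<exists>N. \<forall>n\<ge>N. real (mult_count S n) / real n \<le> real (mult_count S' n) / real n"
    using mult_count_mono[OF assms(1)] by (auto intro!: divide_right_mono)
qed (use assms finite_subset in auto)

lemma mult_density_empty: "mult_density {} = 0"
  using mult_density_tendsto[of "{}"] by (simp add: mult_count_def LIMSEQ_const_iff)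

lemma mult_count_le_union_multiples:
  assumes "m > 0" "\<And>q. q \<in> Q \<Longrightarrow> q \<in> S \<or> m dvd q"
  shows "mult_count Q N \<le> mult_count S N + N div m"
proof -
  have "mult_count Q N \<le> card ({k \<in> {1..N}. \<exists>s\<in>S. s dvd k} \<union> {k \<in> {1..N}. m dvd k})"
    unfolding mult_count_def
  proof (rule card_mono)
    show "{k \<in> {1..N}. \<exists>q\<in>Q. q dvd k}
        \<subseteq> {k \<in> {1..N}. \<exists>s\<in>S. s dvd k} \<union> {k \<in> {1..N}. m dvd k}"
    proof
      fix k assume "k \<in> {k \<in> {1..N}. \<exists>q\<in>Q. q dvd k}"
      then obtain q where q: "k \<in> {1..N}" "q \<in> Q" "q dvd k" by auto
      then show "k \<in> {k \<in> {1..N}. \<exists>s\<in>S. s dvd k} \<union> {k \<in> {1..N}. m dvd k}"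
        using assms(2)[OF q(2)] dvd_trans[of m q k] by auto
    qed
  qed simp
  also have "\<dots> \<le> mult_count S N + N div m"
    unfolding mult_count_def card_multiples[OF assms(1), symmetric] by (rule card_Un_le)
  finally show ?thesis .
qed

text \<open>Union bound: the overlap of the two kinds of order times is ignored, which makes the
  bound independent of the intervals in \<open>Q\<close>.\<close>

lemma mult_density_le_union_multiples:
  assumes "m > 0" "\<And>q. q \<in> Q \<Longrightarrow> q \<in> S \<or> m dvd q"
    and "finite Q" "0 \<notin> Q" "finite S" "0 \<notin> S"
  shows "mult_density Q \<le> mult_density S + 1 / real m"
proof (rule LIMSEQ_le[OF mult_density_tendsto])
  show "(\<lambda>N. real (mult_count S N) / real N + 1 / real m) \<longlonglongrightarrow> mult_density S + 1 / real m"
    by (intro tendsto_add mult_density_tendsto assms tendsto_const)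
  have "real (mult_count Q N) / real N \<le> real (mult_count S N) / real N + 1 / real m" if "N \<ge> 1" for N
  proof -
    have "real (mult_count Q N) \<le> real (mult_count S N) + real (N div m)"
      using mult_count_le_union_multiples[of m Q S N] assms by (metis of_nat_add of_nat_le_iff)
    also have "real (N div m) \<le> real N / real m" by (rule real_div_le)
    finally show ?thesis using that assms(1) by (simp add: field_simps)
  qed
  then show "\<exists>N. \<forall>n\<ge>N. real (mult_count Q n) / real n \<le> real (mult_count S n) / real n + 1 / real m"
    by blast
qed (use assms in auto)

lemma mult_density_ge:
  assumes "s \<in> S" "finite S" "0 \<notin> S"
  shows "1 / real s \<le> mult_density S"
proof -
  have s: "s > 0" using assms by (cases s) auto
  have "(\<lambda>N. real (mult_count {s} N) / real N) \<longlonglongrightarrow> 1 / real s"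
  proof (rule bounded_over_n_tendsto)
    fix N
    show "\<bar>real (mult_count {s} N) - 1 / real s * real N\<bar> \<le> 1"
      using real_div_ge[of N s] real_div_le[of N s] card_multiples[OF s, of N]
      by (simp add: mult_count_def abs_le_iff)
  qed
  moreover have "(\<lambda>N. real (mult_count {s} N) / real N) \<longlonglongrightarrow> mult_density {s}"
    using mult_density_tendsto[of "{s}"] s by auto
  ultimately have "mult_density {s} = 1 / real s" by (rule LIMSEQ_unique[symmetric])
  then show ?thesis using mult_density_mono[of "{s}" S] assms by simp
qed

text \<open>Turns the additive error \<open>2 ^ L\<close> into a relative one. A nonempty
  \<open>S\<close> has density at least \<open>1 / L\<close>, so at least
  \<open>2 * r * 2 ^ L\<close> multiples are expected up to \<open>W\<close>, and the error is a
  fraction of at most \<open>1 / r\<close>. For empty \<open>S\<close> both sides vanish.\<close>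

lemma mult_count_density_ratio:
  assumes "S \<subseteq> {1..L}" "r \<ge> 1" "W = 2 * r * L * 2 ^ L"
  shows "mult_density S \<le> (1 + 1 / real r) * (real (mult_count S W) / real W)"
    and "real (mult_count S W) / real W \<le> (1 + 1 / real r) * mult_density S"
proof -
  have fin: "finite S" "0 \<notin> S" using assms(1) finite_subset by auto
  have "mult_density S \<le> (1 + 1 / real r) * (real (mult_count S W) / real W) \<and>
     real (mult_count S W) / real W \<le> (1 + 1 / real r) * mult_density S"
  proof (cases "S = {}")
    case True
    then show ?thesis by (simp add: mult_density_empty mult_count_def)
  next
    case False
    then obtain s where s: "s \<in> S" by auto
    then have sL: "1 \<le> s" "s \<le> L" using assms(1) by auto
    then have W: "W > 0" using assms by auto
    have "card S \<le> L" using card_mono[OF _ assms(1)] by simp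
    then have e: "(2::real) ^ card S \<le> 2 ^ L" by simp
    have ap: "\<bar>real (mult_count S W) - mult_density S * real W\<bar> \<le> 2 ^ L"
      using mult_count_approx[OF fin, of W] e by linarith
    have "1 / real L \<le> 1 / real s" using sL by (simp add: frac_le)
    with mult_density_ge[OF s fin] have d: "1 / real L \<le> mult_density S" by linarith
    have r: "1 / real L * real W = 2 * real r * 2 ^ L" using assms sL by simp
    have d2: "2 * real r * 2 ^ L \<le> mult_density S * real W"
      using mult_right_mono[OF d, of "real W"] r by simp
    then have d3: "2 * 2 ^ L * real r \<le> mult_density S * real W" by (simp add: mult_ac)
    \<comment> \<open>The factor 2 in \<open>W\<close> pays here: when the error
      \<open>2 ^ L\<close> is subtracted from \<open>2 * 2 ^ L * r\<close>, at least
      \<open>2 ^ L * r\<close> remains, so the error is also small relative to the count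
      itself.\<close>
    have "2 ^ L * 1 \<le> 2 ^ L * real r" using assms(2) by (intro mult_left_mono) auto
    then have c3: "2 ^ L * real r \<le> real (mult_count S W)" using ap d3 by linarith
    have 1: "2 ^ L \<le> 1 / real r * real (mult_count S W)"
      using c3 assms(2) by (simp add: field_simps)
    have "0 \<le> 2 ^ L * real r" by simp
    then have "2 ^ L * real r \<le> mult_density S * real W" using d3 by linarith
    then have 2: "2 ^ L \<le> 1 / real r * (mult_density S * real W)"
      using assms(2) by (simp add: field_simps)
    have 3: "mult_density S * real W \<le> (1 + 1 / real r) * real (mult_count S W)"
      using ap 1 by (simp add: algebra_simps abs_le_iff)
    have 4: "real (mult_count S W) \<le> (1 + 1 / real r) * mult_density S * real W"
      using ap 2 by (simp add: algebra_simps abs_le_iff)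
    from W have "real W > 0" by simp
    then show ?thesis using 3 4 by (simp add: pos_le_divide_eq pos_divide_le_eq)
  qed
  then show "mult_density S \<le> (1 + 1 / real r) * (real (mult_count S W) / real W)"
    and "real (mult_count S W) / real W \<le> (1 + 1 / real r) * mult_density S" by auto
qed

section \<open>From counted orders to the long-run joint cost\<close>

lemma num_orders_eq:
  assumes "\<Delta> > 0" "n \<ge> 1" "\<And>i. i \<in> {1..n} \<Longrightarrow> k i \<ge> 1 \<and> T i = real (k i) * \<Delta>" "D \<ge> 0"
  shows "num_orders n T D = mult_count (k ` {1..n}) (nat \<lfloor>D / \<Delta>\<rfloor>) + 1"
proof -
  let ?N = "nat \<lfloor>D / \<Delta>\<rfloor>"
  let ?A = "{j \<in> {1..?N}. \<exists>s\<in>k ` {1..n}. s dvd j}"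
  have le: "q \<le> ?N \<longleftrightarrow> real q * \<Delta> \<le> D" for q
    using assms(1,4) by (simp add: le_nat_iff le_floor_iff pos_le_divide_eq)
  have le2: "j \<le> nat \<lfloor>D / T i\<rfloor> \<longleftrightarrow> real (j * k i) * \<Delta> \<le> D" if "i \<in> {1..n}" for i j
    using assms(1,4) assms(3)[OF that] by (simp add: le_nat_iff le_floor_iff pos_le_divide_eq mult_ac)
  \<comment> \<open>Time 0 is an order of every commodity, whereas \<open>mult_count\<close> starts
    at 1; this is the \<open>+ 1\<close> of the statement.\<close>
  have "(\<Union>i\<in>{1..n}. (\<lambda>j. real j * T i) ` {0..nat \<lfloor>D / T i\<rfloor>}) = (\<lambda>q. real q * \<Delta>) ` insert 0 ?A"
    (is "?L = ?R")
  proof (intro set_eqI iffI)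
    fix y assume "y \<in> ?L"
    then obtain i j where ij: "i \<in> {1..n}" "j \<le> nat \<lfloor>D / T i\<rfloor>" "y = real j * T i" by auto
    then have "y = real (j * k i) * \<Delta>" "j * k i \<le> ?N" using assms(3)[OF ij(1)] le[of "j * k i"] le2[OF ij(1), of j] by simp_all
    moreover have "j * k i \<in> insert 0 ?A" using calculation(2) ij(1) assms(3)[OF ij(1)]
      by (cases "j = 0") (auto intro!: bexI[of _ i])
    ultimately show "y \<in> ?R" by blast
  next
    fix y assume "y \<in> ?R"
    then consider "y = 0" | q i where "q \<in> {1..?N}" "i \<in> {1..n}" "k i dvd q" "y = real q * \<Delta>" by auto
    then show "y \<in> ?L"
    proof cases
      case 1
      then show ?thesis using assms(2) by (auto intro!: bexI[of _ 1] image_eqI[of _ _ 0])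
    next
      case 2
      then obtain j where j: "q = j * k i" by (metis dvd_def mult.commute)
      then have "j \<le> nat \<lfloor>D / T i\<rfloor>" "y = real j * T i"
        using 2 le[of q] le2[OF 2(2), of j] assms(3)[OF 2(2)] by simp_all
      then show ?thesis using 2(2) by (intro UN_I[of i] image_eqI[of _ _ j]) auto
    qed
  qed
  then have "num_orders n T D = card ((\<lambda>q. real q * \<Delta>) ` insert 0 ?A)"
    unfolding num_orders_def by simp
  also have "\<dots> = card (insert 0 ?A)" using assms(1) by (intro card_image) (auto simp: inj_on_def)
  finally show ?thesis by (simp add: mult_count_def)
qed

text \<open>The definition uses \<open>Lim\<close>, so convergence has to be proved along with the
  value; the error is bounded uniformly in \<open>D\<close> and vanishes after division by
  \<open>D\<close>.\<close>

lemma joint_cost_eq: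
  assumes "\<Delta> > 0" "n \<ge> 1" "\<And>i. i \<in> {1..n} \<Longrightarrow> k i \<ge> 1 \<and> T i = real (k i) * \<Delta>"
  shows "joint_cost n K T = (K :: nat \<Rightarrow> real) 0 * (mult_density (k ` {1..n}) / \<Delta>)"
proof -
  let ?Q = "k ` {1..n}"
  have Q: "finite ?Q" "0 \<notin> ?Q" using assms(3) by force+
  let ?d = "mult_density ?Q"
  have "((\<lambda>D. real (num_orders n T D) / D - ?d / \<Delta>) \<longlongrightarrow> 0) at_top"
  proof (rule Lim_null_comparison)
    \<comment> \<open>The three summands are the sieve error, the order at time 0, and the effect of
      rounding \<open>D / \<Delta>\<close> down to an integer.\<close>
    show "\<forall>\<^sub>F D in at_top. norm (real (num_orders n T D) / D - ?d / \<Delta>) \<le> (2 ^ card ?Q + 1 + \<bar>?d\<bar>) * (1 / D)"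
      using eventually_gt_at_top[of 0]
    proof eventually_elim
      case (elim D)
      let ?N = "nat \<lfloor>D / \<Delta>\<rfloor>"
      have "0 \<le> D / \<Delta>" using elim assms(1) by simp
      then have "real ?N = of_int \<lfloor>D / \<Delta>\<rfloor>" by simp
      then have "\<bar>D / \<Delta> - real ?N\<bar> \<le> 1" by linarith
      then have "\<bar>?d * (D / \<Delta> - real ?N)\<bar> \<le> \<bar>?d\<bar> * 1" unfolding abs_mult by (intro mult_left_mono) auto
      then have "\<bar>?d * (D / \<Delta>) - ?d * real ?N\<bar> \<le> \<bar>?d\<bar>"
        by (simp only: right_diff_distrib mult_1_right)
      moreover have "real (num_orders n T D) = real (mult_count ?Q ?N) + 1"
        using num_orders_eq[OF assms(1-3), where D=D] elim by simp
      ultimately have "\<bar>real (num_orders n T D) - ?d * (D / \<Delta>)\<bar> \<le> 2 ^ card ?Q + 1 + \<bar>?d\<bar>"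
        using mult_count_approx[OF Q, of ?N] by linarith
      moreover have "real (num_orders n T D) / D - ?d / \<Delta> = (real (num_orders n T D) - ?d * (D / \<Delta>)) / D"
        using elim by (simp add: field_simps)
      ultimately show ?case using elim by (simp add: divide_right_mono)
    qed
    have "((\<lambda>D::real. 1 / D) \<longlongrightarrow> 0) at_top"
      using tendsto_inverse_0_at_top[OF filterlim_ident] by (simp add: divide_inverse)
    then show "((\<lambda>D. (2 ^ card ?Q + 1 + \<bar>?d\<bar>) * (1 / D)) \<longlongrightarrow> 0) at_top"
      by (rule tendsto_mult_right_zero)
  qed
  then have "((\<lambda>D. real (num_orders n T D) / D) \<longlongrightarrow> ?d / \<Delta>) at_top"
    by (simp add: LIM_zero_iff)
  then show ?thesis unfolding joint_cost_def by (simp add: tendsto_Lim)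
qed

section \<open>Rounding intervals\<close>

text \<open>The difference of two values factors as
  \<open>(t - s) * (H i * (s * t) - K i) / (s * t)\<close>, so its sign depends only on how
  \<open>s * t\<close> compares with \<open>K i / H i\<close>, the square of the minimiser. The next
  lemma is the mirror image.\<close>

lemma marginal_cost_mono:
  assumes "K i > 0" "H i > 0" "sqrt (K i / H i) \<le> s" "s \<le> t"
  shows "marginal_cost K H i s \<le> marginal_cost K H i t"
proof -
  have s: "s > 0" using assms by (meson divide_pos_pos less_le_trans real_sqrt_gt_zero)
  have "K i / H i \<le> s\<^sup>2" using assms(3) s by (metis less_eq_real_def real_sqrt_le_iff real_sqrt_unique)
  also have "\<dots> \<le> s * t" using s assms(4) by (simp add: power2_eq_square)
  finally have "0 \<le> H i * (s * t) - K i" using assms(2) by (simp add: pos_divide_le_eq mult_ac)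
  moreover have "marginal_cost K H i t - marginal_cost K H i s
    = (t - s) * (H i * (s * t) - K i) / (s * t)"
    using s assms(4) unfolding marginal_cost_def by (simp add: field_simps)
  ultimately show ?thesis using s assms(4) by (smt (verit) mult_nonneg_nonneg divide_nonneg_nonneg)
qed

lemma marginal_cost_antimono:
  assumes "K i > 0" "H i > 0" "0 < s" "s \<le> t" "t \<le> sqrt (K i / H i)"
  shows "marginal_cost K H i t \<le> marginal_cost K H i s"
proof -
  have "s * t \<le> t\<^sup>2" using assms by (simp add: power2_eq_square)
  also have "t\<^sup>2 \<le> (sqrt (K i / H i))\<^sup>2" using assms by (intro power_mono) auto
  also have "\<dots> = K i / H i" using assms by simp
  finally have "H i * (s * t) - K i \<le> 0" using assms(2) by (simp add: pos_le_divide_eq mult_ac)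
  moreover have "marginal_cost K H i t - marginal_cost K H i s
    = (t - s) * (H i * (s * t) - K i) / (s * t)"
    using assms unfolding marginal_cost_def by (simp add: field_simps)
  moreover have "(t - s) * (H i * (s * t) - K i) / (s * t) \<le> 0"
    using assms calculation(1) by (intro divide_nonpos_nonneg mult_nonneg_nonpos) auto
  ultimately show ?thesis by linarith
qed

text \<open>The last multiple of \<open>B\<close> not beyond the minimiser of the marginal cost, or
  \<open>B\<close> itself if the minimiser is smaller. A closed form instead of a search keeps the
  number of steps independent of the data.\<close>

definition best_mult :: "(nat \<Rightarrow> real) \<Rightarrow> (nat \<Rightarrow> real) \<Rightarrow> nat \<Rightarrow> real \<Rightarrow> nat" where
  "best_mult K H i B = nat \<lfloor>max 1 (sqrt (K i / H i) / B)\<rfloor>"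

lemma best_mult_ge_1: "best_mult K H i B \<ge> 1"
  unfolding best_mult_def by (simp add: le_nat_iff le_floor_iff)

text \<open>By unimodality only the two multiples around the minimiser matter. The disjunction
  avoids deciding which one is better; the algorithm tries both.\<close>

lemma best_mult_optimal:
  assumes "K i > 0" "H i > 0" "B > 0" "k' \<ge> 1"
  shows "marginal_cost K H i (real (best_mult K H i B) * B) \<le> marginal_cost K H i (real k' * B)
    \<or> marginal_cost K H i (real (best_mult K H i B + 1) * B) \<le> marginal_cost K H i (real k' * B)"
proof -
  let ?\<tau> = "sqrt (K i / H i)"
  let ?k = "best_mult K H i B"
  have k: "real ?k = of_int \<lfloor>max 1 (?\<tau> / B)\<rfloor>"
    unfolding best_mult_def by simp
  have hi: "?\<tau> \<le> real (?k + 1) * B"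
  proof -
    have "?\<tau> / B \<le> real ?k + 1" unfolding k by linarith
    then show ?thesis using assms(3) by (simp add: pos_divide_le_eq add.commute)
  qed
  show ?thesis
  proof (cases "k' \<le> ?k")
    case False
    then have "real (?k + 1) * B \<le> real k' * B" using assms(3) by (intro mult_right_mono) auto
    then show ?thesis using marginal_cost_mono[of K i H, OF assms(1,2) hi] by blast
  next
    case True
    then have le: "real k' * B \<le> real ?k * B" using assms(3) by (intro mult_right_mono) auto
    show ?thesis
    proof (cases "?k = k'")
      case False
      \<comment> \<open>A smaller \<open>k'\<close> excludes the clamping at 1, so
        \<open>?k * B\<close> really lies on the decreasing branch.\<close>
      then have "?k > 1" using True assms(4) by linarith
      then have "real ?k \<le> ?\<tau> / B" using k by (smt (verit) floor_one of_int_1 of_int_floor_le of_nat_1 of_nat_less_iff)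
      then have "real ?k * B \<le> ?\<tau>" using assms(3) by (simp add: pos_le_divide_eq)
      then show ?thesis using marginal_cost_antimono[of K i H, OF assms(1,2) _ le] assms by simp
    qed simp
  qed
qed

text \<open>On the chord from \<open>a\<close> to \<open>b\<close> the holding cost is matched exactly, and the ordering cost is
  lost by at most \<open>(a + b)\<^sup>2 / (4 * a * b)\<close>.\<close>

lemma round_to_multiple:
  assumes "K i > 0" "H i > 0" "B > 0" "8 * B \<le> t"
  shows "\<exists>k\<ge>1. marginal_cost K H i (real k * B) \<le> 289 / 288 * marginal_cost K H i t"
proof -
  define k where "k = nat \<lfloor>t / B\<rfloor>"
  have tB: "8 \<le> t / B" using assms by (simp add: pos_le_divide_eq)
  then have k: "real k = of_int \<lfloor>t / B\<rfloor>" "8 \<le> k" unfolding k_def by (auto simp: le_nat_iff le_floor_iff)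
  define a b where "a = real k * B" and "b = real (k + 1) * B"
  have "real k \<le> t / B" "t / B \<le> real k + 1" using k by linarith+
  then have ab: "a \<le> t" "t \<le> b" unfolding a_def b_def using assms(3)
    by (simp_all add: pos_le_divide_eq pos_divide_le_eq add.commute)
  have pos: "0 < a" "0 < t" "a < b" using k assms ab unfolding a_def b_def by (auto simp: mult_strict_right_mono)
  have "8 * b \<le> 9 * a" unfolding a_def b_def using k(2) assms(3) by (simp add: algebra_simps)
  define l where "l = (b - t) / (b - a)"
  have "l * (b - a) = b - t" using pos unfolding l_def by simp
  then have l: "0 \<le> l" "0 \<le> 1 - l"
    using ab pos by (simp_all add: l_def)
  have lt: "l * a + (1 - l) * b = t" using \<open>l * (b - a) = b - t\<close> by (simp add: algebra_simps)
  \<comment> \<open>The ratio of \<open>b\<close> to \<open>a\<close> is at most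
    \<open>9 / 8\<close>, and \<open>(a + b)\<^sup>2 / (a * b)\<close> grows with this ratio up to
    \<open>289 / 72\<close>. Expanding the product gives exactly this bound; a quarter of it is
    \<open>289 / 288\<close>.\<close>
  have "(9 * a - 8 * b) * (9 * b - 8 * a) \<ge> 0"
    using \<open>8 * b \<le> 9 * a\<close> pos by (intro mult_nonneg_nonneg) auto
  then have "72 * (a + b)\<^sup>2 \<le> 289 * (a * b)" by (simp add: power2_eq_square algebra_simps)
  moreover have "4 * ((a + b - t) * t) \<le> (a + b)\<^sup>2"
    using zero_le_power2[of "a + b - 2 * t"] by (simp add: power2_eq_square algebra_simps)
  ultimately have "(a + b - t) * t \<le> 289 / 288 * (a * b)" by linarith
  moreover have "l / a + (1 - l) / b = (a + b - t) / (a * b)"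
  proof -
    have "l / a + (1 - l) / b = (a + b - (l * a + (1 - l) * b)) / (a * b)"
      using pos by (simp add: field_simps)
    then show ?thesis using lt by simp
  qed
  moreover have "0 < a * b" using pos by simp
  ultimately have "l / a + (1 - l) / b \<le> 289 / 288 * (1 / t)"
    using pos(2) by (simp add: pos_divide_le_eq pos_le_divide_eq)
  then have "K i * (l / a + (1 - l) / b) \<le> K i * (289 / 288 * (1 / t))" using assms by (intro mult_left_mono) auto
  moreover have "H i * t \<le> 289 / 288 * (H i * t)" using assms pos by simp
  moreover have "l * marginal_cost K H i a + (1 - l) * marginal_cost K H i b
     = K i * (l / a + (1 - l) / b) + H i * (l * a + (1 - l) * b)"
    unfolding marginal_cost_def by (simp add: algebra_simps)
  moreover have "289 / 288 * marginal_cost K H i t = K i * (289 / 288 * (1 / t)) + 289 / 288 * (H i * t)"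
    unfolding marginal_cost_def by (simp add: algebra_simps)
  ultimately have c: "l * marginal_cost K H i a + (1 - l) * marginal_cost K H i b \<le> 289 / 288 * marginal_cost K H i t"
    using lt by simp
  have "marginal_cost K H i a \<le> 289 / 288 * marginal_cost K H i t \<or>
      marginal_cost K H i b \<le> 289 / 288 * marginal_cost K H i t" (is "?x \<le> ?z \<or> ?y \<le> ?z")
  proof (rule ccontr)
    assume "\<not> ?thesis"
    then have "?z < ?x" "?z < ?y" by auto
    then have "l * (- ?x) + (1 - l) * (- ?y) < - ?z"
      using l by (intro convex_bound_lt) auto
    then show False using c by simp
  qed
  then show ?thesis unfolding a_def b_def using k(2) by (metis le_add2 le_trans one_le_numeral)
qed

section \<open>Power-of-two rounding and the constant \<open>1 / (sqrt 2 * ln 2)\<close>\<close>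

lemma ln_2_le: "ln 2 \<le> (7 / 10 :: real)"
proof -
  have "(2::real) \<le> (1 + 1/10 + (1/10)\<^sup>2 / 2) ^ 7" by (simp add: power2_eq_square power_divide)
  also have "\<dots> \<le> exp (1/10) ^ 7"
    using exp_lower_Taylor_quadratic[of "1/10::real"] by (intro power_mono) auto
  also have "\<dots> = exp (7/10)" by (simp add: exp_of_nat_mult[symmetric])
  finally show ?thesis by (metis exp_le_cancel_iff exp_ln zero_less_numeral)
qed

text \<open>The lower bound lets the rounding loss \<open>289 / 288\<close> of the short case
  disappear in the final constant. The upper bound turns a relative error \<open>10 / r\<close> into
  an absolute one of at most \<open>11 / r\<close>, hence the 11 in the choice of
  \<open>r\<close>.\<close>

lemma sqrt2_ln2_bounds:
  shows "289 / 288 \<le> 1 / (sqrt 2 * ln (2::real))" and "1 / (sqrt 2 * ln (2::real)) \<le> 11 / 10"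
proof -
  have s: "sqrt 2 \<le> 142 / 100" "141 / 100 \<le> sqrt (2::real)"
    by (rule real_le_lsqrt; simp add: power2_eq_square) (rule real_le_rsqrt, simp add: power2_eq_square)
  have "ln 2 * sqrt 2 \<le> 7 / 10 * (142 / 100 :: real)" using s ln_2_le by (intro mult_mono) auto
  then show "289 / 288 \<le> 1 / (sqrt 2 * ln (2::real))" 
    by (subst pos_le_divide_eq) (auto simp: mult_ac)
  have "2 / 3 * (141 / 100) \<le> ln 2 * sqrt (2 :: real)" using s ln2_ge_two_thirds by (intro mult_mono) auto
  then show "1 / (sqrt 2 * ln (2::real)) \<le> 11 / 10"
    by (subst pos_divide_le_eq) (auto simp: mult_ac)
qed

text \<open>Subtracting \<open>h\<close> permutes the residues modulo \<open>R\<close>; in the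
  averaging argument this removes the dependence on the rounded interval, up to an offset of at most
  one step of the scale.\<close>

lemma sum_mod_shift:
  fixes h :: int
  assumes "R > 0"
  shows "(\<Sum>j<R. f (nat ((int j - h) mod int R))) = (\<Sum>i<R. f i)"
proof -
  let ?g = "\<lambda>j. nat ((int j - h) mod int R)"
  have inj: "inj_on ?g {..<R}"
  proof (rule inj_onI)
    fix i j assume ij: "i \<in> {..<R}" "j \<in> {..<R}" "?g i = ?g j"
    then have "(int i - h) mod int R = (int j - h) mod int R"
      using assms by (simp add: nat_eq_iff)
    then have "(int i - h + h) mod int R = (int j - h + h) mod int R" by (rule mod_add_cong) simp
    then show "i = j" using ij by simp
  qed
  have "?g ` {..<R} \<subseteq> {..<R}" using assms by (auto simp: nat_less_iff)
  then have "bij_betw ?g {..<R} {..<R}" using inj endo_inj_surj[of "{..<R}" ?g] by (simp add: bij_betw_def)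
  then show ?thesis by (rule sum.reindex_bij_betw)
qed

text \<open>\<open>w\<close> is the step of the scale of bases. A lower bound for
  \<open>w - 1\<close> comes from \<open>1 + z \<le> exp z\<close> and an upper bound for
  \<open>w\<close> from Bernoulli's inequality. The factor \<open>1 + 1 / R\<close> is the price of
  averaging over finitely many bases.\<close>

lemma root_of_two_bounds:
  assumes "R > 0"
  defines "w \<equiv> 2 powr (1 / real R)"
  shows "w ^ R = 2" "1 < w" "w / (w - 1) \<le> real R * ((1 + 1 / real R) / ln 2)"
proof -
  show wR: "w ^ R = 2" using assms by (simp add: w_def powr_powr flip: powr_realpow)
  show w1: "1 < w" using assms unfolding w_def by simp
  have "1 + ln 2 / real R \<le> w"
    using exp_ge_add_one_self[of "ln 2 / real R"] by (simp add: w_def powr_def)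
  then have l: "ln 2 \<le> real R * (w - 1)" using assms(1) by (simp add: field_simps)
  have "2 \<le> (1 + 1 / real R) ^ R"
    using Bernoulli_inequality[of "1 / real R" R] assms(1) by (simp add: order_trans[of "-1" 0])
  then have "w ^ R \<le> (1 + 1 / real R) ^ R" using wR by simp
  then have w2: "w \<le> 1 + 1 / real R" using assms(1) w1 by (subst (asm) power_mono_iff) auto
  have "w * ln 2 \<le> (1 + 1 / real R) * (real R * (w - 1))"
    using l w1 w2 by (intro mult_mono) auto
  then show "w / (w - 1) \<le> real R * ((1 + 1 / real R) / ln 2)"
    using w1 by (simp add: pos_divide_le_eq pos_le_divide_eq mult_ac)
qed

text \<open>Rounding \<open>T\<close> to the power-of-two multiple of the base \<open>x * 2 powr (j / R - 1 / 2)\<close> nearest to it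
  multiplies \<open>T\<close> by a factor in \<open>2 powr {-1/2..1/2}\<close>; over all \<open>R\<close> bases these factors are equally
  spaced on the logarithmic scale, so that both averages are geometric sums.\<close>

lemma pow2_rounding_average:
  assumes "R > 0" "x > 0" "x \<le> T"
  defines "y \<equiv> \<lambda>j::nat. x * 2 powr (real j / real R - 1 / 2)"
    and "c \<equiv> real R * ((1 + 1 / real R) / (sqrt 2 * ln 2))"
  shows "\<exists>q::nat \<Rightarrow> nat. (\<Sum>j<R. 2 ^ q j * y j) \<le> c * T \<and> (\<Sum>j<R. 1 / (2 ^ q j * y j)) \<le> c / T
    \<and> (T = x \<longrightarrow> (\<forall>j<R. q j = 0))"
proof -
  define a where "a = log 2 (T / x)"
  have Tx: "T = x * 2 powr a" "a \<ge> 0" using assms unfolding a_def by (auto simp: field_simps)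
  \<comment> \<open>On the scale with steps \<open>1 / R\<close> the interval \<open>T\<close> lies
    between grid points, and \<open>u\<close> is its offset to the next one. It multiplies all
    factors by the same \<open>2 powr (u / R)\<close>, so only its extreme values matter
    below.\<close>
  define h where "h = \<lceil>a * real R\<rceil>"
  define u where "u = of_int h - a * real R"
  have u: "0 \<le> u" "u \<le> 1" unfolding u_def h_def by linarith+
  have h0: "h \<ge> 0" unfolding h_def using Tx(2) by (simp add: ceiling_mono[of 0, simplified])
  \<comment> \<open>Base \<open>j\<close> is doubled so often that its exponent differs from that of
    \<open>T\<close> by \<open>u / R - 1 / 2 + g j / R\<close>, which lies between
    \<open>-1 / 2\<close> and \<open>1 / 2\<close>. The quotient is nonpositive since
    \<open>j < R\<close> and \<open>h \<ge> 0\<close>, so \<open>nat\<close> loses nothing.\<close>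
  define q where "q j = nat (- ((int j - h) div int R))" for j
  define g where "g j = nat ((int j - h) mod int R)" for j
  define w where "w = 2 powr (1 / real R)"
  note w = root_of_two_bounds[OF assms(1), folded w_def]
  have y: "2 ^ q j * y j = T * (2 powr (u / real R - 1 / 2) * w ^ g j)" if "j < R" for j
  proof -
    let ?d = "(int j - h) div int R"
    have "?d \<le> 0" using zdiv_mono1[of "int j - h" "int j" "int R"] that h0 by simp
    then have q: "(2::real) ^ q j = 2 powr (- of_int ?d)" unfolding q_def
      by (simp flip: powr_realpow)
    have "int R * ?d + int (g j) = int j - h" unfolding g_def using assms(1) by simp
    then have "of_int (int R * ?d + int (g j)) = (of_int (int j - h) :: real)" by (rule arg_cong)
    then have "real R * of_int ?d + real (g j) = real j - of_int h" by simp
    then have e: "- of_int ?d + (real j / real R - 1 / 2) = a + ((u / real R - 1 / 2) + real (g j) / real R)"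
      using assms(1) unfolding u_def by (simp add: field_simps)
    have "w ^ g j = 2 powr (real (g j) / real R)" unfolding w_def
      by (simp add: powr_powr flip: powr_realpow)
    then have "T * (2 powr (u / real R - 1 / 2) * w ^ g j)
        = x * 2 powr (a + ((u / real R - 1 / 2) + real (g j) / real R))"
      unfolding Tx(1) by (simp only: powr_add mult.assoc)
    also have "\<dots> = x * (2 powr (- of_int ?d) * 2 powr (real j / real R - 1 / 2))"
      unfolding e[symmetric] by (simp only: powr_add)
    finally show ?thesis unfolding q y_def by simp
  qed
  have s1: "(\<Sum>j<R. w ^ g j) = 1 / (w - 1)"
    unfolding g_def using sum_mod_shift[OF assms(1), of "\<lambda>i. w ^ i" h] w(1,2) by (simp add: geometric_sum)
  have s2: "(\<Sum>j<R. (1 / w) ^ g j) = w / (2 * (w - 1))"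
  proof -
    have "(\<Sum>j<R. (1 / w) ^ g j) = (\<Sum>j<R. (1 / w) ^ j)"
      unfolding g_def using sum_mod_shift[OF assms(1), of "\<lambda>i. (1 / w) ^ i" h] by simp
    also have "\<dots> = ((1 / w) ^ R - 1) / (1 / w - 1)" using w(2) by (intro geometric_sum) auto
    also have "\<dots> = (- (1 / 2)) / (- ((w - 1) / w))"
      using w(1,2) by (simp add: power_one_over diff_divide_distrib)
    also have "\<dots> = w / (2 * (w - 1))" by simp
    finally show ?thesis .
  qed
  have T0: "T > 0" using assms by simp
  have c: "c = real R * ((1 + 1 / real R) / ln 2) / sqrt 2" unfolding c_def by simp
  \<comment> \<open>Both sums get the same bound: \<open>u = 1\<close> is the worst case for the
    intervals and \<open>u = 0\<close> for their inverses.\<close>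
  have wc: "w / (w - 1) / sqrt 2 \<le> c" unfolding c using w(3) by (intro divide_right_mono) auto
  have half: "(2::real) powr (1 / 2) = sqrt 2" by (simp add: powr_half_sqrt)
  have "2 powr (u / real R) \<le> w" unfolding w_def using u(2) by (intro powr_mono divide_right_mono) auto
  then have f1: "2 powr (u / real R - 1 / 2) \<le> w / sqrt 2"
    by (simp add: powr_diff half divide_right_mono)
  have "1 \<le> 2 powr (u / real R)" using u(1) by (intro ge_one_powr_ge_zero) auto
  then have f2: "1 / 2 powr (u / real R - 1 / 2) \<le> sqrt 2"
    by (simp add: powr_diff half pos_divide_le_eq)
  have "(\<Sum>j<R. 2 ^ q j * y j) = T * 2 powr (u / real R - 1 / 2) * (\<Sum>j<R. w ^ g j)"
    unfolding sum_distrib_left by (intro sum.cong) (auto simp: y)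
  also have "\<dots> \<le> T * (w / sqrt 2) * (\<Sum>j<R. w ^ g j)"
    using f1 T0 w(2) by (intro mult_right_mono mult_left_mono sum_nonneg) auto
  also have "\<dots> = T * (w / (w - 1) / sqrt 2)" unfolding s1 by simp
  also have "\<dots> \<le> T * c" using wc T0 by (intro mult_left_mono) auto
  finally have A: "(\<Sum>j<R. 2 ^ q j * y j) \<le> c * T" by (simp add: mult.commute)
  have "(\<Sum>j<R. 1 / (2 ^ q j * y j)) = (1 / T) * (1 / 2 powr (u / real R - 1 / 2)) * (\<Sum>j<R. (1 / w) ^ g j)"
    unfolding sum_distrib_left by (intro sum.cong) (auto simp: y power_one_over)
  also have "\<dots> \<le> (1 / T) * sqrt 2 * (\<Sum>j<R. (1 / w) ^ g j)"
    using f2 T0 w(2) by (intro mult_right_mono mult_left_mono sum_nonneg) auto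
  also have "\<dots> = (1 / T) * (w / (w - 1) / sqrt 2)"
  proof -
    have "sqrt 2 / 2 = 1 / sqrt (2::real)" using real_div_sqrt[of 2] by (simp add: field_simps)
    have "sqrt 2 * (w / (2 * (w - 1))) = w / (w - 1) * (sqrt 2 / 2)" by (simp add: mult.commute)
    also have "\<dots> = w / (w - 1) / sqrt 2" unfolding \<open>sqrt 2 / 2 = 1 / sqrt (2::real)\<close> by simp
    finally show ?thesis unfolding s2 by (simp only: mult.assoc)
  qed
  also have "\<dots> \<le> (1 / T) * c" using wc T0 by (intro mult_left_mono) auto
  finally have B: "(\<Sum>j<R. 1 / (2 ^ q j * y j)) \<le> c / T" by simp
  \<comment> \<open>For \<open>T = x\<close> no doubling occurs, so the bound on the inverses also
    bounds the sum of \<open>1 / y j\<close>; this controls the joint cost term.\<close>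
  have C: "T = x \<longrightarrow> (\<forall>j<R. q j = 0)"
    using assms(2) unfolding q_def h_def a_def by simp
  show ?thesis using A B C by blast
qed

text \<open>The joint cost \<open>K 0 / x\<close> is treated like the ordering cost of a commodity 0
  with interval \<open>x\<close>. Summed over the \<open>R\<close> bases every term is within the
  factor, so some base does at least as well as the average for the total cost.\<close>

lemma pow2_policy:
  fixes T :: "nat \<Rightarrow> real"
  assumes "R > 0" "x > 0" "\<And>i. i \<in> {1..n} \<Longrightarrow> x \<le> T i"
    and nn: "K 0 > 0" "\<And>i. i \<in> {1..n} \<Longrightarrow> K i > 0 \<and> H i > 0"
  shows "\<exists>y (q :: nat \<Rightarrow> nat). x / sqrt 2 \<le> y \<and> y \<le> sqrt 2 * x
    \<and> K 0 / y + (\<Sum>i\<in>{1..n}. marginal_cost K H i (2 ^ q i * y))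
      \<le> (1 + 1 / real R) / (sqrt 2 * ln 2) * (K 0 / x + (\<Sum>i\<in>{1..n}. marginal_cost K H i (T i)))"
proof -
  define c where "c = (1 + 1 / real R) / (sqrt 2 * ln 2)"
  define y where "y j = x * 2 powr (real j / real R - 1 / 2)" for j :: nat
  define U where "U i = (if i = 0 then x else T i)" for i
  have U: "x \<le> U i" if "i \<in> {0..n}" for i using that assms(3) unfolding U_def by auto
  define ok where "ok i q \<longleftrightarrow> (\<Sum>j<R. 2 ^ q j * y j) \<le> real R * c * U i
     \<and> (\<Sum>j<R. 1 / (2 ^ q j * y j)) \<le> real R * c / U i \<and> (U i = x \<longrightarrow> (\<forall>j<R. q j = 0))"
    for i and q :: "nat \<Rightarrow> nat"
  have "\<exists>q. ok i q" if "i \<in> {0..n}" for i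
    using pow2_rounding_average[OF assms(1,2) U[OF that]] unfolding ok_def y_def c_def .
  then obtain q where "\<And>i. i \<in> {0..n} \<Longrightarrow> ok i (q i)" by metis
  note q = this[unfolded ok_def]
  define F where "F j = K 0 / y j + (\<Sum>i\<in>{1..n}. marginal_cost K H i (2 ^ q i j * y j))" for j
  define G where "G = K 0 / x + (\<Sum>i\<in>{1..n}. marginal_cost K H i (T i))"
  have z: "(\<Sum>j<R. K 0 / y j) \<le> real R * c * (K 0 / x)"
  proof -
    have "(\<Sum>j<R. 1 / y j) \<le> real R * c / x" 
    proof -
      have q0: "(\<Sum>j<R. 1 / (2 ^ q 0 j * y j)) \<le> real R * c / x" "\<forall>j<R. q 0 j = 0"
        using q[of 0, THEN conjunct2, unfolded U_def] by auto
      have "(\<Sum>j<R. 1 / y j) = (\<Sum>j<R. 1 / (2 ^ q 0 j * y j))"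
        using q0(2) by (intro sum.cong) auto
      then show ?thesis using q0(1) by simp
    qed
    then have "K 0 * (\<Sum>j<R. 1 / y j) \<le> K 0 * (real R * c / x)" using nn by (intro mult_left_mono) auto
    then show ?thesis by (simp add: sum_distrib_left mult_ac)
  qed
  have m: "(\<Sum>j<R. marginal_cost K H i (2 ^ q i j * y j)) \<le> real R * c * marginal_cost K H i (T i)"
    if i: "i \<in> {1..n}" for i
  proof -
    have "(\<Sum>j<R. marginal_cost K H i (2 ^ q i j * y j))
      = K i * (\<Sum>j<R. 1 / (2 ^ q i j * y j)) + H i * (\<Sum>j<R. 2 ^ q i j * y j)"
      by (simp add: marginal_cost_def sum.distrib sum_distrib_left mult_ac)
    also have "\<dots> \<le> K i * (real R * c / T i) + H i * (real R * c * T i)"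
      using q[of i] i nn(2)[OF i] by (intro add_mono mult_left_mono) (auto simp: U_def)
    also have "\<dots> = real R * c * marginal_cost K H i (T i)"
      by (simp add: marginal_cost_def algebra_simps)
    finally show ?thesis .
  qed
  have "(\<Sum>j<R. F j) = (\<Sum>j<R. K 0 / y j) + (\<Sum>i\<in>{1..n}. \<Sum>j<R. marginal_cost K H i (2 ^ q i j * y j))"
    unfolding F_def sum.distrib by (subst sum.swap) simp
  also have "\<dots> \<le> real R * c * (K 0 / x) + (\<Sum>i\<in>{1..n}. real R * c * marginal_cost K H i (T i))"
    using z m by (intro add_mono sum_mono) auto
  also have "\<dots> = real R * (c * G)" unfolding G_def by (simp add: sum_distrib_left algebra_simps)
  finally have le: "(\<Sum>j<R. F j) \<le> real R * (c * G)" .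
  have "\<exists>j<R. F j \<le> c * G"
  proof (rule ccontr)
    assume "\<not> ?thesis"
    then have "(\<Sum>j<R. c * G) < (\<Sum>j<R. F j)" using assms(1) by (intro sum_strict_mono) (auto simp: not_le)
    then show False using le by simp
  qed
  then obtain j where j: "j < R" "F j \<le> c * G" by blast
  have half: "(2::real) powr (1 / 2) = sqrt 2" by (simp add: powr_half_sqrt)
  define e where "e = real j / real R - 1 / 2"
  have "- (1 / 2) \<le> e" "e \<le> 1 / 2" using j(1) unfolding e_def by (auto simp: field_simps)
  then have "2 powr (- (1 / 2)) \<le> (2::real) powr e" "(2::real) powr e \<le> 2 powr (1 / 2)"
    by (auto intro!: powr_mono)
  then have "x / sqrt 2 \<le> y j" "y j \<le> sqrt 2 * x"
    using assms(2) unfolding y_def e_def[symmetric]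
    by (simp_all add: powr_minus half divide_simps mult.commute)
  then show ?thesis using j(2) unfolding F_def G_def c_def
    by (intro exI[of _ "y j"] exI[of _ "\<lambda>i. q i j"]) simp
qed

section \<open>The relaxation with a common lower bound\<close>

text \<open>The least value of \<open>K 0 / s\<close> plus the marginal costs over intervals of at
  least \<open>s\<close>: each cost is unimodal, so its constrained minimiser is the larger of
  \<open>s\<close> and the free minimiser.\<close>

definition relaxed_cost :: "nat \<Rightarrow> (nat \<Rightarrow> real) \<Rightarrow> (nat \<Rightarrow> real) \<Rightarrow> real \<Rightarrow> real" where
  "relaxed_cost n K H s = K 0 / s + (\<Sum>i\<in>{1..n}. marginal_cost K H i (max s (sqrt (K i / H i))))"

text \<open>The free minimiser of the pooled cost of the joint order and the commodities of
  \<open>I\<close>, which are those held at the common lower bound. \<open>I\<close> is a prefix in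
  the order of the individual minimisers.\<close>

definition prefix_optimum :: "nat \<Rightarrow> (nat \<Rightarrow> real) \<Rightarrow> (nat \<Rightarrow> real) \<Rightarrow> nat \<Rightarrow> real" where
  "prefix_optimum n K H j =
    (let I = {i \<in> {1..n}. sqrt (K i / H i) \<le> sqrt (K j / H j)}
     in sqrt ((K 0 + (\<Sum>i\<in>I. K i)) / (\<Sum>i\<in>I. H i)))"

lemma marginal_cost_ge:
  assumes "K i > 0" "H i > 0" "0 < s" "s \<le> t"
  shows "marginal_cost K H i (max s (sqrt (K i / H i))) \<le> marginal_cost K H i t"
proof (cases "sqrt (K i / H i) \<le> t")
  case True
  then show ?thesis using assms by (intro marginal_cost_mono) auto
next
  case False
  then have "max s (sqrt (K i / H i)) = sqrt (K i / H i)" using assms by simp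
  then show ?thesis using marginal_cost_antimono[of K i H t "sqrt (K i / H i)"] False assms by simp
qed

lemma relaxed_cost_le:
  assumes "\<And>i. i \<in> {1..n} \<Longrightarrow> K i > 0 \<and> H i > 0" "0 < s" "\<And>i. i \<in> {1..n} \<Longrightarrow> s \<le> T i"
  shows "relaxed_cost n K H s \<le> K 0 / s + (\<Sum>i\<in>{1..n}. marginal_cost K H i (T i))"
  unfolding relaxed_cost_def using assms by (intro add_left_mono sum_mono marginal_cost_ge) auto

text \<open>Commodities with a minimiser below \<open>s\<close> all use \<open>s\<close>, and
  together with the joint order they act as one commodity with summed parameters; the others
  contribute a constant. Constant functions and the index 0 phrase the pooled cost as a
  \<open>marginal_cost\<close>.\<close>

lemma relaxed_cost_split:
  assumes "I \<subseteq> {1..n}" "\<And>i. i \<in> I \<Longrightarrow> sqrt (K i / H i) \<le> s"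
    "\<And>i. i \<in> {1..n} - I \<Longrightarrow> s \<le> sqrt (K i / H i)"
  shows "relaxed_cost n K H s = marginal_cost (\<lambda>_. K 0 + sum K I) (\<lambda>_. sum H I) 0 s
    + (\<Sum>i\<in>{1..n} - I. marginal_cost K H i (sqrt (K i / H i)))"
proof -
  have "(\<Sum>i\<in>{1..n}. marginal_cost K H i (max s (sqrt (K i / H i))))
    = (\<Sum>i\<in>{1..n} - I. marginal_cost K H i (max s (sqrt (K i / H i))))
     + (\<Sum>i\<in>I. marginal_cost K H i (max s (sqrt (K i / H i))))"
    using assms(1) by (intro sum.subset_diff) auto
  also have "(\<Sum>i\<in>{1..n} - I. marginal_cost K H i (max s (sqrt (K i / H i))))
    = (\<Sum>i\<in>{1..n} - I. marginal_cost K H i (sqrt (K i / H i)))"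
    using assms(3) by (intro sum.cong) (auto simp: max_absorb2)
  also have "(\<Sum>i\<in>I. marginal_cost K H i (max s (sqrt (K i / H i)))) = (\<Sum>i\<in>I. marginal_cost K H i s)"
    using assms(2) by (intro sum.cong) (auto simp: max_absorb1)
  finally show ?thesis
    unfolding relaxed_cost_def
    by (simp add: marginal_cost_def sum.distrib sum_divide_distrib sum_distrib_right add_divide_distrib)
qed

text \<open>Between consecutive individual minimisers the relaxed cost is a pooled cost plus a
  constant, hence unimodal. Moving \<open>t\<close> towards the pooled minimiser does not increase
  it; the move ends there, at an individual minimiser, or at the lower limit
  \<open>a\<close>.\<close>

lemma relaxed_cost_candidate:
  assumes "n \<ge> 1" "K 0 > 0" "\<And>i. i \<in> {1..n} \<Longrightarrow> K i > 0 \<and> H i > 0" "0 < a" "a \<le> t"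
  shows "\<exists>x. (x = a \<or> (\<exists>j\<in>{1..n}. x = sqrt (K j / H j) \<or> x = prefix_optimum n K H j))
    \<and> a \<le> x \<and> relaxed_cost n K H x \<le> relaxed_cost n K H t"
proof -
  let ?\<tau> = "\<lambda>i. sqrt (K i / H i)"
  define I where "I = {i \<in> {1..n}. ?\<tau> i \<le> t}"
  define J where "J = {1..n} - I"
  have fin: "finite I" "finite J" "I \<subseteq> {1..n}" unfolding I_def J_def by auto
  define P Q where "P = K 0 + sum K I" and "Q = sum H I"
  have P: "P > 0" using assms(2,3) fin unfolding P_def by (intro add_pos_nonneg sum_nonneg) (force intro: less_imp_le)+
  let ?f = "marginal_cost (\<lambda>_. P) (\<lambda>_. Q) 0"
  have split: "relaxed_cost n K H s = ?f s + (\<Sum>i\<in>J. marginal_cost K H i (?\<tau> i))"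
    if "\<And>i. i \<in> I \<Longrightarrow> ?\<tau> i \<le> s" "\<And>i. i \<in> J \<Longrightarrow> s \<le> ?\<tau> i" for s
    unfolding P_def Q_def J_def by (intro relaxed_cost_split) (use that fin in \<open>auto simp: J_def\<close>)
  have red: "relaxed_cost n K H s \<le> relaxed_cost n K H t"
    if "\<And>i. i \<in> I \<Longrightarrow> ?\<tau> i \<le> s" "\<And>i. i \<in> J \<Longrightarrow> s \<le> ?\<tau> i" "?f s \<le> ?f t" for s
  proof -
    have "relaxed_cost n K H t = ?f t + (\<Sum>i\<in>J. marginal_cost K H i (?\<tau> i))"
      by (rule split) (auto simp: I_def J_def)
    then show ?thesis using split[OF that(1,2)] that(3) by simp
  qed
  have Ile: "?\<tau> i \<le> t" if "i \<in> I" for i using that unfolding I_def by auto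
  have Jgt: "t < ?\<tau> i" if "i \<in> J" for i using that unfolding J_def I_def by auto
  have minJ: "\<exists>l\<in>J. \<forall>i\<in>J. ?\<tau> l \<le> ?\<tau> i" if "J \<noteq> {}"
  proof -
    have "Min (?\<tau> ` J) \<in> ?\<tau> ` J" using fin that by (intro Min_in) auto
    then obtain l where l: "l \<in> J" "Min (?\<tau> ` J) = ?\<tau> l" by blast
    have "Min (?\<tau> ` J) \<le> ?\<tau> i" if "i \<in> J" for i using fin that by (intro Min_le) auto
    then have "\<forall>i\<in>J. ?\<tau> l \<le> ?\<tau> i" unfolding l(2) by blast
    then show ?thesis using l(1) by blast
  qed
  show ?thesis
  proof (cases "I = {}")
    case True
    then have J: "J = {1..n}" "J \<noteq> {}" using assms(1) unfolding J_def by auto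
    obtain l where l: "l \<in> J" "\<forall>i\<in>J. ?\<tau> l \<le> ?\<tau> i" using minJ[OF J(2)] by blast
    \<comment> \<open>No commodity is held at \<open>t\<close>, so only \<open>P / s\<close> varies,
      and it decreases up to the first individual minimiser.\<close>
    have "?f (?\<tau> l) \<le> ?f t" using True P Jgt[OF l(1)] assms(4,5)
      unfolding marginal_cost_def Q_def by (simp add: frac_le)
    then have "relaxed_cost n K H (?\<tau> l) \<le> relaxed_cost n K H t" using True l by (intro red) auto
    moreover have "a \<le> ?\<tau> l" using Jgt[OF l(1)] assms(5) by linarith
    ultimately show ?thesis using l(1) unfolding J(1) by blast
  next
    case False
    have "Max (?\<tau> ` I) \<in> ?\<tau> ` I" using fin False by (intro Max_in) auto
    then obtain j where j: "j \<in> I" "?\<tau> j = Max (?\<tau> ` I)" by auto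
    have jm: "?\<tau> i \<le> ?\<tau> j" if "i \<in> I" for i unfolding j(2) using fin that by (intro Max_ge) auto
    have jt: "?\<tau> j \<le> t" "j \<in> {1..n}" using j(1) unfolding I_def by auto
    \<comment> \<open>\<open>I\<close> was defined by \<open>t\<close>. That it is determined by the
      commodity \<open>j\<close> alone, ties included, leaves only \<open>n\<close> pooled
      minimisers to try.\<close>
    have "I = {i \<in> {1..n}. ?\<tau> i \<le> ?\<tau> j}" using jm jt fin(3) unfolding I_def by fastforce
    then have x: "prefix_optimum n K H j = sqrt (P / Q)"
      unfolding prefix_optimum_def P_def Q_def Let_def by simp
    have Q: "Q > 0" unfolding Q_def using False fin assms(3) by (intro sum_pos) auto
    let ?x = "sqrt (P / Q)"
    have x0: "?x > 0" using P Q by simp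
    have t0: "t > 0" using assms by simp
    show ?thesis
    proof (cases "t \<le> ?x")
      case True
      show ?thesis
      proof (cases "\<forall>i\<in>J. ?x \<le> ?\<tau> i")
        case all: True
        have "?f ?x \<le> ?f t" using True P Q t0 by (intro marginal_cost_antimono) auto
        moreover have "?\<tau> i \<le> ?x" if "i \<in> I" for i using Ile[OF that] True by linarith
        ultimately have "relaxed_cost n K H ?x \<le> relaxed_cost n K H t" using all by (intro red) auto
        moreover have "a \<le> ?x" using True assms(5) by linarith
        ultimately show ?thesis using jt(2) unfolding x[symmetric] by blast
      next
        case False
        then have "J \<noteq> {}" by auto
        then obtain l where l: "l \<in> J" "\<forall>i\<in>J. ?\<tau> l \<le> ?\<tau> i" using minJ by blast
        then have "?\<tau> l \<le> ?x" using False by (meson le_cases order_trans)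
        then have "?f (?\<tau> l) \<le> ?f t" using P Q t0 Jgt[OF l(1)] by (intro marginal_cost_antimono) auto
        moreover have "?\<tau> i \<le> ?\<tau> l" if "i \<in> I" for i using Ile[OF that] Jgt[OF l(1)] by linarith
        ultimately have "relaxed_cost n K H (?\<tau> l) \<le> relaxed_cost n K H t" using l(2) by (intro red) auto
        moreover have "l \<in> {1..n}" using l(1) unfolding J_def by auto
        moreover have "a \<le> ?\<tau> l" using Jgt[OF l(1)] assms(5) by linarith
        ultimately show ?thesis by blast
      qed
    next
      case False
      define s where "s = max (max a (?\<tau> j)) ?x"
      have s: "?x \<le> s" "s \<le> t" "a \<le> s" "?\<tau> j \<le> s" using False jt assms(5) unfolding s_def by auto
      have "?f s \<le> ?f t" using P Q s by (intro marginal_cost_mono) auto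
      moreover have "s \<le> ?\<tau> i" if "i \<in> J" for i using Jgt[OF that] s(2) by linarith
      moreover have "?\<tau> i \<le> s" if "i \<in> I" for i using jm[OF that] s(4) by linarith
      ultimately have "relaxed_cost n K H s \<le> relaxed_cost n K H t" by (intro red) auto
      moreover have "s = a \<or> s = ?\<tau> j \<or> s = prefix_optimum n K H j"
        unfolding x s_def by (auto simp: max_def)
      ultimately show ?thesis using s(3) jt(2) by blast
    qed
  qed
qed

section \<open>Candidate policies\<close>

text \<open>One of the two listed multiples of \<open>m\<close> is optimal among all of them, so two
  numbers represent infinitely many intervals.\<close>

definition menu :: "(nat \<Rightarrow> real) \<Rightarrow> (nat \<Rightarrow> real) \<Rightarrow> real \<Rightarrow> nat set \<Rightarrow> nat \<Rightarrow> nat \<Rightarrow> nat set" where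
  "menu K H \<Delta> S m i =
    (let k = best_mult K H i (real m * \<Delta>) in {k * m, (k + 1) * m} \<union> S)"

definition menu_cost :: "(nat \<Rightarrow> real) \<Rightarrow> (nat \<Rightarrow> real) \<Rightarrow> real \<Rightarrow> nat set \<Rightarrow> nat \<Rightarrow> nat \<Rightarrow> real" where
  "menu_cost K H \<Delta> S m i = Min ((\<lambda>q. marginal_cost K H i (real q * \<Delta>)) ` menu K H \<Delta> S m i)"

text \<open>The density of the union is replaced by the sum of the densities of its two parts, and
  the first of these by a finite count. The result is computable, and its joint part does not depend
  on which menu items are taken.\<close>

definition estimate ::
  "nat \<Rightarrow> (nat \<Rightarrow> real) \<Rightarrow> (nat \<Rightarrow> real) \<Rightarrow> real \<Rightarrow> nat \<Rightarrow> nat set \<Rightarrow> nat \<Rightarrow> real" where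
  "estimate n K H \<Delta> W S m = K 0 * (real (mult_count S W) / (real W * \<Delta>) + 1 / (real m * \<Delta>))
    + (\<Sum>i\<in>{1..n}. menu_cost K H \<Delta> S m i)"

lemma menu_cost_le:
  assumes "finite S" "q \<in> menu K H \<Delta> S m i"
  shows "menu_cost K H \<Delta> S m i \<le> marginal_cost K H i (real q * \<Delta>)"
  using assms unfolding menu_cost_def by (intro Min_le) (auto simp: menu_def Let_def)

lemma menu_cost_le_multiple:
  assumes "K i > 0" "H i > 0" "\<Delta> > 0" "m \<ge> 1" "finite S" "k \<ge> 1"
  shows "menu_cost K H \<Delta> S m i \<le> marginal_cost K H i (real k * (real m * \<Delta>))"
proof -
  let ?b = "best_mult K H i (real m * \<Delta>)"
  have B: "real m * \<Delta> > 0" using assms by simp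
  have "menu_cost K H \<Delta> S m i \<le> marginal_cost K H i (real (?b * m) * \<Delta>)"
    "menu_cost K H \<Delta> S m i \<le> marginal_cost K H i (real ((?b + 1) * m) * \<Delta>)"
    by (rule menu_cost_le[OF assms(5)]; simp add: menu_def Let_def)+
  then have "menu_cost K H \<Delta> S m i \<le> marginal_cost K H i (real ?b * (real m * \<Delta>))"
    "menu_cost K H \<Delta> S m i \<le> marginal_cost K H i (real (?b + 1) * (real m * \<Delta>))"
    by (simp_all only: of_nat_mult mult.assoc)
  then show ?thesis using best_mult_optimal[of K i H, OF assms(1,2) B assms(6)] by linarith
qed

text \<open>Whatever menu items are chosen, all orders fall on multiples of an element of
  \<open>S\<close> or of \<open>m\<close>. The factor \<open>1 + 1 / r\<close> comes from the count
  and is granted to the other terms as well.\<close>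

lemma policy_cost_le_estimate:
  assumes inst: "jrp_instance n K H" "\<Delta> > 0"
    and S: "S \<subseteq> {1..L}" "r \<ge> 1" "W = 2 * r * L * 2 ^ L" "m \<ge> 1"
    and q: "\<And>i. i \<in> {1..n} \<Longrightarrow> q i \<in> menu K H \<Delta> S m i \<and> T i = real (q i) * \<Delta>
      \<and> marginal_cost K H i (T i) = menu_cost K H \<Delta> S m i"
  shows "feasible n \<Delta> T" "avg_cost n K H T \<le> (1 + 1 / real r) * estimate n K H \<Delta> W S m"
proof -
  have pos: "n \<ge> 1" "K 0 > 0" "\<And>i. i \<in> {1..n} \<Longrightarrow> K i > 0 \<and> H i > 0"
    using inst unfolding jrp_instance_def by auto
  have q1: "q i \<ge> 1" "q i \<in> S \<or> m dvd q i" if "i \<in> {1..n}" for i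
    using q[OF that] S(1,4) best_mult_ge_1[of K H i "real m * \<Delta>"]
    by (auto simp: menu_def Let_def Suc_le_eq)
  show "feasible n \<Delta> T" unfolding feasible_def using q1(1) q by blast
  have fin: "finite S" "0 \<notin> S" using S(1) finite_subset by auto
  have J: "joint_cost n K T = K 0 * (mult_density (q ` {1..n}) / \<Delta>)"
    using joint_cost_eq[of \<Delta> n q T K] inst(2) pos(1) q1(1) q by simp
  have "mult_density (q ` {1..n}) \<le> mult_density S + 1 / real m"
    using q1 S(4) fin by (intro mult_density_le_union_multiples) force+
  also have "mult_density S \<le> (1 + 1 / real r) * (real (mult_count S W) / real W)"
    using mult_count_density_ratio(1)[OF S(1-3)] .
  also have "1 / real m \<le> (1 + 1 / real r) * (1 / real m)"
    by (simp add: algebra_simps)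
  finally have "mult_density (q ` {1..n}) \<le> (1 + 1 / real r) * (real (mult_count S W) / real W + 1 / real m)"
    by (simp add: algebra_simps)
  then have "K 0 * (mult_density (q ` {1..n}) / \<Delta>)
      \<le> K 0 * ((1 + 1 / real r) * (real (mult_count S W) / real W + 1 / real m) / \<Delta>)"
    using pos inst by (intro mult_left_mono divide_right_mono) auto
  also have "\<dots> = (1 + 1 / real r) * (K 0 * (real (mult_count S W) / (real W * \<Delta>) + 1 / (real m * \<Delta>)))"
    by (simp add: add_divide_distrib[of _ _ \<Delta>, symmetric] flip: divide_divide_eq_left)
  finally have A: "joint_cost n K T \<le> \<dots>" unfolding J .
  have mc: "(\<Sum>i\<in>{1..n}. marginal_cost K H i (T i)) = (\<Sum>i\<in>{1..n}. menu_cost K H \<Delta> S m i)"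
    by (intro sum.cong refl) (use q in blast)
  have "0 \<le> (\<Sum>i\<in>{1..n}. marginal_cost K H i (T i))"
  proof (rule sum_nonneg)
    fix i assume i: "i \<in> {1..n}"
    then show "0 \<le> marginal_cost K H i (T i)"
      using q[OF i] pos(3)[OF i] inst(2) by (simp add: marginal_cost_def)
  qed
  then have "(\<Sum>i\<in>{1..n}. menu_cost K H \<Delta> S m i)
      \<le> (1 + 1 / real r) * (\<Sum>i\<in>{1..n}. menu_cost K H \<Delta> S m i)"
    unfolding mc by (simp add: algebra_simps)
  then show "avg_cost n K H T \<le> (1 + 1 / real r) * estimate n K H \<Delta> W S m"
    unfolding avg_cost_def estimate_def mc using A by (simp add: distrib_left)
qed

text \<open>\<open>l / r\<close> discretises the ratio of the common base to \<open>x\<close>; the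
  result is rounded down to a multiple of \<open>\<Delta>\<close> and kept positive.\<close>

definition base_mult :: "nat \<Rightarrow> real \<Rightarrow> real \<Rightarrow> nat \<Rightarrow> nat" where
  "base_mult r \<Delta> x l = nat \<lfloor>max 1 (x * real l / (real r * \<Delta>))\<rfloor>"

lemma base_mult_ge_1: "base_mult r \<Delta> x l \<ge> 1"
  unfolding base_mult_def by (simp add: le_nat_iff le_floor_iff)

text \<open>The values left by \<open>relaxed_cost_candidate\<close> for the lower limit
  \<open>a = r * \<Delta>\<close>.\<close>

definition base_candidate :: "nat \<Rightarrow> (nat \<Rightarrow> real) \<Rightarrow> (nat \<Rightarrow> real) \<Rightarrow> real \<Rightarrow> nat \<Rightarrow> real \<Rightarrow> bool" where
  "base_candidate n K H \<Delta> r x \<longleftrightarrow>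
    x = real r * \<Delta> \<or> (\<exists>j\<in>{1..n}. x = sqrt (K j / H j) \<or> x = prefix_optimum n K H j)"

section \<open>Candidates against an arbitrary feasible policy\<close>

lemma joint_cost_ge:
  assumes "jrp_instance n K H" "\<Delta> > 0" "\<And>i. i \<in> {1..n} \<Longrightarrow> k i \<ge> 1 \<and> T i = real (k i) * \<Delta>" "j \<in> {1..n}"
  shows "K 0 / T j \<le> joint_cost n K T"
proof -
  have pos: "n \<ge> 1" "K 0 > 0" using assms unfolding jrp_instance_def by auto
  have "1 / real (k j) \<le> mult_density (k ` {1..n})"
    using assms(3,4) by (intro mult_density_ge) force+
  then have "K 0 * (1 / real (k j) / \<Delta>) \<le> K 0 * (mult_density (k ` {1..n}) / \<Delta>)"
    using pos assms(2) by (intro mult_left_mono divide_right_mono) auto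
  then show ?thesis using joint_cost_eq[of \<Delta> n k T K] assms pos by simp
qed

lemma avg_cost_nonneg:
  assumes "jrp_instance n K H" "\<Delta> > 0" "feasible n \<Delta> T"
  shows "0 \<le> avg_cost n K H T"
proof -
  have pos: "n \<ge> 1" "K 0 > 0" "\<And>i. i \<in> {1..n} \<Longrightarrow> K i > 0 \<and> H i > 0"
    using assms(1) unfolding jrp_instance_def by auto
  obtain k where k: "\<And>i. i \<in> {1..n} \<Longrightarrow> k i \<ge> 1 \<and> T i = real (k i) * \<Delta>"
    using assms(3) unfolding feasible_def by metis
  have one: "1 \<in> {1..n}" using pos(1) by simp
  have "0 \<le> K 0 / T 1" using pos k[OF one] assms(2) by simp
  then have "0 \<le> joint_cost n K T"
    using joint_cost_ge[of n K H \<Delta> k T 1, OF assms(1,2) k one] by linarith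
  moreover have "0 \<le> (\<Sum>i\<in>{1..n}. marginal_cost K H i (T i))"
  proof (rule sum_nonneg)
    fix i assume i: "i \<in> {1..n}"
    then show "0 \<le> marginal_cost K H i (T i)"
      using k[OF i] pos(3)[OF i] assms(2) by (simp add: marginal_cost_def)
  qed
  ultimately show ?thesis unfolding avg_cost_def by simp
qed

text \<open>Since \<open>k j \<le> r\<close>, the density is at least \<open>1 / r\<close>, and the
  extra \<open>1 / r\<^sup>2\<close> is a fraction \<open>1 / r\<close> of it; the counting error
  adds another \<open>1 / r\<close>. Commodities with \<open>k i \<le> L\<close> keep their
  interval, and the others exceed \<open>8 * r\<^sup>2\<close> and lose at most
  \<open>289 / 288\<close>. The common factor in the statement dominates both losses.\<close>

lemma estimate_small_interval:
  assumes inst: "jrp_instance n K H" "\<Delta> > 0"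
    and k: "\<And>i. i \<in> {1..n} \<Longrightarrow> k i \<ge> 1 \<and> T i = real (k i) * \<Delta>"
    and r: "r \<ge> 1" "L = 8 * r\<^sup>2" "W = 2 * r * L * 2 ^ L"
    and j: "j \<in> {1..n}" "k j \<le> r"
  defines "S \<equiv> k ` {1..n} \<inter> {1..L}"
  shows "estimate n K H \<Delta> W S (r\<^sup>2) \<le> 1 / (sqrt 2 * ln 2) * (1 + 2 / real r) * avg_cost n K H T"
proof -
  define c where "c = 1 / (sqrt 2 * ln (2::real))"
  have c: "289 / 288 \<le> c" unfolding c_def by (rule sqrt2_ln2_bounds)
  have pos: "n \<ge> 1" "K 0 > 0" "\<And>i. i \<in> {1..n} \<Longrightarrow> K i > 0 \<and> H i > 0"
    using inst unfolding jrp_instance_def by auto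
  have J: "joint_cost n K T = K 0 * (mult_density (k ` {1..n}) / \<Delta>)"
    using joint_cost_eq[of \<Delta> n k T K] inst(2) pos(1) k by simp
  have Q: "finite (k ` {1..n})" "0 \<notin> k ` {1..n}" using k by force+
  have fin: "finite S" unfolding S_def by simp
  have r0: "real r > 0" using r(1) by simp
  have "real (mult_count S W) / real W \<le> (1 + 1 / real r) * mult_density S"
    by (rule mult_count_density_ratio(2)[OF _ r(1,3)]) (simp add: S_def)
  also have "\<dots> \<le> (1 + 1 / real r) * mult_density (k ` {1..n})"
    using Q by (intro mult_left_mono mult_density_mono) (auto simp: S_def)
  finally have 1: "real (mult_count S W) / real W \<le> (1 + 1 / real r) * mult_density (k ` {1..n})" .
  have "1 / real r \<le> 1 / real (k j)" using j k[OF j(1)] by (intro divide_left_mono) auto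
  also have "1 / real (k j) \<le> mult_density (k ` {1..n})" using j Q by (intro mult_density_ge) auto
  finally have "1 / real r * (1 / real r) \<le> 1 / real r * mult_density (k ` {1..n})"
    by (intro mult_left_mono) auto
  with 1 have "real (mult_count S W) / real W + 1 / real r * (1 / real r) \<le> (1 + 2 / real r) * mult_density (k ` {1..n})"
    by (simp add: algebra_simps)
  then have "K 0 * ((real (mult_count S W) / real W + 1 / real r * (1 / real r)) / \<Delta>)
     \<le> K 0 * ((1 + 2 / real r) * mult_density (k ` {1..n}) / \<Delta>)"
    using pos inst by (intro mult_left_mono divide_right_mono) auto
  then have "K 0 * (real (mult_count S W) / (real W * \<Delta>) + 1 / (real (r\<^sup>2) * \<Delta>)) \<le> (1 + 2 / real r) * joint_cost n K T"
    unfolding J by (simp add: add_divide_distrib power2_eq_square mult_ac)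
  also have "\<dots> \<le> c * ((1 + 2 / real r) * joint_cost n K T)"
  proof -
    have "0 \<le> K 0 / T j" using pos k[OF j(1)] inst by simp
    then have "0 \<le> joint_cost n K T" using joint_cost_ge[of n K H \<Delta> k T j, OF inst k j(1)] by linarith
    then have "0 \<le> (1 + 2 / real r) * joint_cost n K T" by simp
    then have "1 * ((1 + 2 / real r) * joint_cost n K T) \<le> c * ((1 + 2 / real r) * joint_cost n K T)"
      using c by (intro mult_right_mono) auto
    then show ?thesis by simp
  qed
  finally have A: "K 0 * (real (mult_count S W) / (real W * \<Delta>) + 1 / (real (r\<^sup>2) * \<Delta>)) \<le> \<dots>" .
  have B: "menu_cost K H \<Delta> S (r\<^sup>2) i \<le> c * (1 + 2 / real r) * marginal_cost K H i (T i)" if i: "i \<in> {1..n}" for i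
  proof -
    have C0: "0 \<le> marginal_cost K H i (T i)" using pos(3)[OF i] k[OF i] inst(2) by (simp add: marginal_cost_def)
    have "menu_cost K H \<Delta> S (r\<^sup>2) i \<le> 289 / 288 * marginal_cost K H i (T i)"
    proof (cases "k i \<le> L")
      case True
      then have "k i \<in> menu K H \<Delta> S (r\<^sup>2) i" using i k[OF i] by (auto simp: menu_def Let_def S_def)
      from menu_cost_le[OF fin this] show ?thesis using C0 k[OF i] by simp
    next
      case False
      have r2: "0 < real (r\<^sup>2) * \<Delta>" using r0 inst(2) by simp
      have "real L \<le> real (k i)" using False by simp
      then have "8 * (real (r\<^sup>2) * \<Delta>) \<le> T i" using k[OF i] r(2) inst(2) by simp
      then obtain k' where k': "k' \<ge> 1" "marginal_cost K H i (real k' * (real (r\<^sup>2) * \<Delta>)) \<le> 289 / 288 * marginal_cost K H i (T i)"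
        using round_to_multiple[of K i H "real (r\<^sup>2) * \<Delta>"] pos(3)[OF i] r2 by blast
      moreover have "menu_cost K H \<Delta> S (r\<^sup>2) i \<le> marginal_cost K H i (real k' * (real (r\<^sup>2) * \<Delta>))"
        using pos(3)[OF i] inst r(1) fin k'(1) by (intro menu_cost_le_multiple) auto
      ultimately show ?thesis by linarith
    qed
    also have "\<dots> \<le> c * marginal_cost K H i (T i)" using c C0 by (intro mult_right_mono) auto
    also have "\<dots> = c * 1 * marginal_cost K H i (T i)" by simp
    also have "\<dots> \<le> c * (1 + 2 / real r) * marginal_cost K H i (T i)"
      using c C0 by (intro mult_right_mono mult_left_mono) auto
    finally show ?thesis .
  qed
  have "estimate n K H \<Delta> W S (r\<^sup>2) \<le> c * ((1 + 2 / real r) * joint_cost n K T)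
     + (\<Sum>i\<in>{1..n}. c * (1 + 2 / real r) * marginal_cost K H i (T i))"
    unfolding estimate_def using A B by (intro add_mono sum_mono) auto
  also have "\<dots> = c * (1 + 2 / real r) * avg_cost n K H T"
    unfolding avg_cost_def distrib_left[of "c * (1 + 2 / real r)"] sum_distrib_left[symmetric] by simp
  finally show ?thesis unfolding c_def .
qed

text \<open>Averaging over \<open>R = r\<close> bases costs \<open>1 + 1 / r\<close> beyond the
  constant. Replacing the real base \<open>y\<close> by \<open>x * l / r\<close>, and this by a
  multiple of \<open>\<Delta>\<close>, shortens it by at most \<open>x / r\<close> each time,
  together \<open>3 * y / r\<close> because \<open>x \<le> 3 / 2 * y\<close>. Shortening raises only
  ordering costs. The count vanishes as \<open>S\<close> is empty.\<close>

lemma estimate_large_interval: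
  assumes inst: "jrp_instance n K H" "\<Delta> > 0"
    and k: "\<And>i. i \<in> {1..n} \<Longrightarrow> k i \<ge> 1 \<and> T i = real (k i) * \<Delta>"
    and r: "r \<ge> 7"
    and kr: "\<And>i. i \<in> {1..n} \<Longrightarrow> r < k i"
  shows "\<exists>x l. base_candidate n K H \<Delta> r x \<and> 1 \<le> l \<and> l \<le> r\<^sup>2 \<and>
    estimate n K H \<Delta> W {} (base_mult r \<Delta> x l)
      \<le> 1 / (sqrt 2 * ln 2) * ((1 + 1 / real r) / (1 - 3 / real r)) * avg_cost n K H T"
proof -
  have pos: "n \<ge> 1" "K 0 > 0" "\<And>i. i \<in> {1..n} \<Longrightarrow> K i > 0 \<and> H i > 0"
    using inst unfolding jrp_instance_def by auto
  define c where "c = (1 + 1 / real r) / (sqrt 2 * ln (2::real))"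
  have r7: "7 \<le> real r" using r by simp
  have fT: "finite (T ` {1..n})" by simp
  have "Min (T ` {1..n}) \<in> T ` {1..n}" using pos(1) by (intro Min_in) auto
  then obtain j where j: "j \<in> {1..n}" "Min (T ` {1..n}) = T j" by auto
  have jle: "T j \<le> T i" if "i \<in> {1..n}" for i unfolding j(2)[symmetric] using fT that by (intro Min_le) auto
  have Tj: "real r * \<Delta> \<le> T j" using kr[OF j(1)] k[OF j(1)] inst(2) by simp
  have a0: "0 < real r * \<Delta>" using r7 inst(2) by simp
  \<comment> \<open>The lower limit \<open>r * \<Delta>\<close> on \<open>x\<close> is what later
    makes one unit \<open>\<Delta>\<close> at most \<open>x / r\<close>.\<close>
  obtain x where x: "base_candidate n K H \<Delta> r x" "real r * \<Delta> \<le> x"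
    "relaxed_cost n K H x \<le> relaxed_cost n K H (T j)"
    using relaxed_cost_candidate[of n K H, OF pos a0 Tj] unfolding base_candidate_def by blast
  have x0: "x > 0" using x(2) a0 by linarith
  have "relaxed_cost n K H (T j) \<le> K 0 / T j + (\<Sum>i\<in>{1..n}. marginal_cost K H i (T i))"
    using pos Tj a0 jle by (intro relaxed_cost_le) auto
  also have "\<dots> \<le> avg_cost n K H T" unfolding avg_cost_def
    using joint_cost_ge[of n K H \<Delta> k T j, OF inst k j(1)] by simp
  finally have rel: "relaxed_cost n K H x \<le> avg_cost n K H T" using x(3) by linarith
  obtain y q where y: "x / sqrt 2 \<le> y" "y \<le> sqrt 2 * x"
    "K 0 / y + (\<Sum>i\<in>{1..n}. marginal_cost K H i (2 ^ q i * y)) \<le> c * relaxed_cost n K H x"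
    using pow2_policy[of r x n "\<lambda>i. max x (sqrt (K i / H i))" K H] r x0 pos
    unfolding c_def relaxed_cost_def by auto
  have s: "sqrt 2 \<le> 15 / 10" "14 / 10 \<le> sqrt (2::real)"
    by (rule real_le_lsqrt; simp add: power2_eq_square) (rule real_le_rsqrt, simp add: power2_eq_square)
  have "x * (2 / 3) = x / (15 / 10)" by simp
  also have "\<dots> \<le> x / sqrt 2" using s x0 by (intro divide_left_mono) auto
  finally have ylo: "x * (2 / 3) \<le> y" using y(1) by linarith
  have "sqrt 2 * x \<le> 15 / 10 * x" using s x0 by (intro mult_right_mono) auto
  then have yhi: "y \<le> 15 / 10 * x" using y(2) by linarith
  define l where "l = nat \<lfloor>real r * y / x\<rfloor>"
  have ry: "2 / 3 * real r \<le> real r * y / x" "real r * y / x \<le> 15 / 10 * real r"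
    using ylo yhi x0 r7 by (simp_all add: pos_le_divide_eq pos_divide_le_eq)
  have l: "real l = of_int \<lfloor>real r * y / x\<rfloor>" 
  proof -
    have "0 \<le> real r * y / x" using ry(1) r7 by linarith
    then show ?thesis unfolding l_def by simp
  qed
  have lb: "real r * y / x - 1 < real l" "real l \<le> real r * y / x" unfolding l by linarith+
  have l1: "1 \<le> l" using lb(1) ry(1) r7 by linarith
  \<comment> \<open>\<open>l\<close> is in fact at most \<open>3 / 2 * r\<close>; the larger range
    is the one that the short case needs.\<close>
  have "real l \<le> real r * real r" using lb(2) ry(2) r7 mult_right_mono[of 7 "real r" "real r"] by linarith
  then have l2: "l \<le> r\<^sup>2" by (metis of_nat_le_iff of_nat_mult power2_eq_square)
  define z where "z = x * real l / real r"
  have z: "y - x / real r \<le> z" "z \<le> y"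
  proof -
    have r0: "real r > 0" using r7 by linarith
    have "real r * y / x \<le> real l + 1" using lb by linarith
    then have "real r * y - x \<le> real l * x" "real l * x \<le> real r * y"
      using lb x0 by (simp_all add: pos_le_divide_eq pos_divide_le_eq algebra_simps)
    moreover have "y - x / real r = (real r * y - x) / real r"
      using r0 by (simp add: diff_divide_distrib)
    ultimately show "y - x / real r \<le> z" "z \<le> y"
      unfolding z_def using r0
      by (simp_all add: divide_right_mono pos_divide_le_eq mult.commute)
  qed
  define m where "m = base_mult r \<Delta> x l"
  have xr: "\<Delta> \<le> x / real r" using x(2) r7 by (simp add: pos_le_divide_eq mult.commute)
  have xr2: "x / real r \<le> x / 7" using r7 x0 by (intro divide_left_mono) auto
  have zD: "\<Delta> \<le> z" using xr xr2 z(1) ylo x0 by linarith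
  have "x * real l / (real r * \<Delta>) = z / \<Delta>" unfolding z_def by simp
  moreover have "1 \<le> z / \<Delta>" using zD inst(2) by simp
  ultimately have m: "real m = of_int \<lfloor>z / \<Delta>\<rfloor>" unfolding m_def base_mult_def by (simp add: max_absorb2)
  have mb: "z / \<Delta> - 1 \<le> real m" "real m \<le> z / \<Delta>" unfolding m by linarith+
  define B where "B = real m * \<Delta>"
  have "z / \<Delta> \<le> real m + 1" using mb by linarith
  then have Bz: "z - \<Delta> \<le> B" "B \<le> z" unfolding B_def
    using mb inst(2) by (simp_all add: pos_le_divide_eq pos_divide_le_eq algebra_simps)
  define \<rho> where "\<rho> = 1 - 3 / real r"
  have \<rho>0: "\<rho> > 0" unfolding \<rho>_def using r7 by simp
  have m1: "m \<ge> 1" unfolding m_def by (rule base_mult_ge_1)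
  have y0: "y > 0" using ylo x0 by linarith
  have "x \<le> y * (3 / 2)" using ylo by linarith
  then have "2 * (x / real r) \<le> 2 * (y * (3 / 2) / real r)" using r7 by (intro mult_left_mono divide_right_mono) auto
  moreover have "\<rho> * y = y - 2 * (y * (3 / 2) / real r)" unfolding \<rho>_def by (simp add: left_diff_distrib)
  ultimately have By: "\<rho> * y \<le> B" "B \<le> y" using Bz z xr by linarith+
  have B0: "B > 0" unfolding B_def using m1 inst(2) by simp
  have inv: "1 / B \<le> 1 / \<rho> * (1 / y)"
    using By(1) \<rho>0 y0 B0 by (simp add: pos_divide_le_eq pos_le_divide_eq mult_ac frac_le)
  have \<rho>1: "1 \<le> 1 / \<rho>" using \<rho>0 unfolding \<rho>_def by simp
  have mc: "menu_cost K H \<Delta> {} m i \<le> 1 / \<rho> * marginal_cost K H i (2 ^ q i * y)" if i: "i \<in> {1..n}" for i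
  proof -
    have "menu_cost K H \<Delta> {} m i \<le> marginal_cost K H i (real (2 ^ q i) * (real m * \<Delta>))"
      using pos(3)[OF i] inst m1 by (intro menu_cost_le_multiple) auto
    also have "\<dots> = K i / 2 ^ q i * (1 / B) + H i * 2 ^ q i * B" by (simp add: marginal_cost_def B_def mult_ac)
    also have "\<dots> \<le> K i / 2 ^ q i * (1 / \<rho> * (1 / y)) + H i * 2 ^ q i * (1 / \<rho> * y)"
    proof (intro add_mono mult_left_mono)
      have "1 * y \<le> 1 / \<rho> * y" using \<rho>1 y0 by (intro mult_right_mono) auto
      then show "B \<le> 1 / \<rho> * y" using By(2) by linarith
    qed (use inv pos(3)[OF i] in auto)
    also have "\<dots> = 1 / \<rho> * marginal_cost K H i (2 ^ q i * y)"
      by (simp add: marginal_cost_def distrib_left mult_ac)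
    finally show ?thesis .
  qed
  have "K 0 * (1 / B) \<le> K 0 * (1 / \<rho> * (1 / y))" using inv pos(2) by (intro mult_left_mono) auto
  moreover have "(\<Sum>i\<in>{1..n}. menu_cost K H \<Delta> {} m i) \<le> (\<Sum>i\<in>{1..n}. 1 / \<rho> * marginal_cost K H i (2 ^ q i * y))"
    using mc by (intro sum_mono) auto
  ultimately have "estimate n K H \<Delta> W {} m \<le> 1 / \<rho> * (K 0 / y + (\<Sum>i\<in>{1..n}. marginal_cost K H i (2 ^ q i * y)))"
    unfolding estimate_def B_def[symmetric]
    by (simp add: mult_count_def distrib_left sum_distrib_left mult_ac)
  also have "\<dots> \<le> 1 / \<rho> * (c * relaxed_cost n K H x)" using y(3) \<rho>0 by (intro mult_left_mono) auto
  also have "\<dots> \<le> 1 / \<rho> * (c * avg_cost n K H T)"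
    using rel \<rho>0 unfolding c_def by (intro mult_left_mono) auto
  also have "\<dots> = 1 / (sqrt 2 * ln 2) * ((1 + 1 / real r) / (1 - 3 / real r)) * avg_cost n K H T"
    unfolding c_def \<rho>_def by simp
  finally show ?thesis using x(1) l1 l2 unfolding m_def by blast
qed

text \<open>With \<open>u = 1 / r\<close>, the second inequality amounts to
  \<open>31 * u \<le> 5\<close>. The least integer \<open>r\<close> satisfying it is 7, whence the
  summand 7 in the choice of \<open>r\<close>.\<close>

lemma ratio_bounds:
  assumes "r \<ge> (7::real)"
  shows "1 + 2 / r \<le> (1 + 1 / r) / (1 - 3 / r)"
    and "(1 + 1 / r) * ((1 + 1 / r) / (1 - 3 / r)) \<le> 1 + 10 / r"
proof -
  define u where "u = 1 / r"
  have u: "0 < u" "u \<le> 1 / 7" using assms unfolding u_def by (auto intro: divide_left_mono)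
  have "0 < 1 - 3 * u" using u by simp
  have uu: "u * u \<le> 1 / 7 * u" "0 \<le> u * u" using u by (auto intro!: mult_right_mono)
  have "(1 + 2 * u) * (1 - 3 * u) \<le> 1 + u" using uu u by (simp add: algebra_simps)
  then show "1 + 2 / r \<le> (1 + 1 / r) / (1 - 3 / r)"
    using \<open>0 < 1 - 3 * u\<close> unfolding u_def by (simp add: pos_le_divide_eq)
  have "(1 + u) * (1 + u) \<le> (1 + 10 * u) * (1 - 3 * u)" using uu u by (simp add: algebra_simps)
  then have "(1 + u) * ((1 + u) / (1 - 3 * u)) \<le> 1 + 10 * u"
    using \<open>0 < 1 - 3 * u\<close> by (simp add: pos_divide_le_eq)
  then show "(1 + 1 / r) * ((1 + 1 / r) / (1 - 3 / r)) \<le> 1 + 10 / r"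
    unfolding u_def by simp
qed

lemma good_candidate:
  assumes inst: "jrp_instance n K H" "\<Delta> > 0" "feasible n \<Delta> T"
    and r: "r \<ge> 7" "L = 8 * r\<^sup>2" "W = 2 * r * L * 2 ^ L"
  shows "\<exists>S x l. S \<subseteq> {1..L} \<and> base_candidate n K H \<Delta> r x \<and> 1 \<le> l \<and> l \<le> r\<^sup>2 \<and>
    (1 + 1 / real r) * estimate n K H \<Delta> W S (base_mult r \<Delta> x l)
      \<le> 1 / (sqrt 2 * ln 2) * (1 + 10 / real r) * avg_cost n K H T"
proof -
  define c where "c = 1 / (sqrt 2 * ln (2::real))"
  have c0: "c > 0" unfolding c_def by simp
  have pos: "n \<ge> 1" "K 0 > 0" "\<And>i. i \<in> {1..n} \<Longrightarrow> K i > 0 \<and> H i > 0"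
    using inst unfolding jrp_instance_def by auto
  have r7: "7 \<le> real r" using r(1) by simp
  obtain k where k: "\<And>i. i \<in> {1..n} \<Longrightarrow> k i \<ge> 1 \<and> T i = real (k i) * \<Delta>"
    using inst(3) unfolding feasible_def by metis
  have av: "0 \<le> avg_cost n K H T" by (rule avg_cost_nonneg[OF inst])
  define \<beta> where "\<beta> = (1 + 1 / real r) / (1 - 3 / real r)"
  have "\<exists>S x l. S \<subseteq> {1..L} \<and> base_candidate n K H \<Delta> r x \<and> 1 \<le> l \<and> l \<le> r\<^sup>2 \<and>
    estimate n K H \<Delta> W S (base_mult r \<Delta> x l) \<le> c * \<beta> * avg_cost n K H T"
  proof (cases "\<exists>j\<in>{1..n}. k j \<le> r")
    case True
    then obtain j where j: "j \<in> {1..n}" "k j \<le> r" by blast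
    let ?S = "k ` {1..n} \<inter> {1..L}"
    \<comment> \<open>With \<open>x = r * \<Delta>\<close> and \<open>l = r\<^sup>2\<close> the
      formula for long intervals returns exactly \<open>r\<^sup>2\<close>, so the short case needs
      no bases of its own.\<close>
    have "real r * \<Delta> * real (r\<^sup>2) / (real r * \<Delta>) = real (r\<^sup>2)" using r7 inst(2) by simp
    moreover have "1 \<le> real (r\<^sup>2)" using r(1) by simp
    ultimately have b: "base_mult r \<Delta> (real r * \<Delta>) (r\<^sup>2) = r\<^sup>2"
      unfolding base_mult_def by (simp only: max_absorb2 floor_of_nat nat_int)
    have "estimate n K H \<Delta> W ?S (r\<^sup>2) \<le> c * (1 + 2 / real r) * avg_cost n K H T"
      unfolding c_def using r(1) by (intro estimate_small_interval[of n K H \<Delta> k T, OF inst(1,2) k _ r(2,3) j]) auto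
    also have "\<dots> \<le> c * \<beta> * avg_cost n K H T"
      using ratio_bounds(1)[OF r7] c0 av unfolding \<beta>_def by (intro mult_right_mono mult_left_mono) auto
    finally show ?thesis using b r(1)
      by (intro exI[of _ ?S] exI[of _ "real r * \<Delta>"] exI[of _ "r\<^sup>2"]) (auto simp: base_candidate_def)
  next
    case False
    then have "\<And>i. i \<in> {1..n} \<Longrightarrow> r < k i" by (simp add: not_le)
    from estimate_large_interval[of n K H \<Delta> k T, OF inst(1,2) k r(1) this, of W]
    show ?thesis unfolding c_def \<beta>_def by blast
  qed
  then obtain S x l where *: "S \<subseteq> {1..L}" "base_candidate n K H \<Delta> r x" "1 \<le> l" "l \<le> r\<^sup>2"
    and e: "estimate n K H \<Delta> W S (base_mult r \<Delta> x l) \<le> c * \<beta> * avg_cost n K H T" by blast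
  have "(1 + 1 / real r) * estimate n K H \<Delta> W S (base_mult r \<Delta> x l)
      \<le> (1 + 1 / real r) * (c * \<beta> * avg_cost n K H T)"
    using e by (intro mult_left_mono) auto
  also have "\<dots> = c * ((1 + 1 / real r) * \<beta>) * avg_cost n K H T" by simp
  also have "\<dots> \<le> c * (1 + 10 / real r) * avg_cost n K H T"
    using ratio_bounds(2)[OF r7] c0 av unfolding \<beta>_def by (intro mult_right_mono mult_left_mono) auto
  finally show ?thesis using * unfolding c_def by blast
qed

section \<open>Reasoning about programs\<close>

text \<open>Total correctness with a step bound; an upper bound instead of the exact count absorbs
  branches of different length.\<close>

definition runs :: "com \<Rightarrow> state \<Rightarrow> nat \<Rightarrow> (state \<Rightarrow> bool) \<Rightarrow> bool" where
  "runs p s T Q \<longleftrightarrow> (\<exists>t s'. exec p s t s' \<and> t \<le> T \<and> Q s')"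

lemma runs_mono:
  assumes "runs p s T Q" "T \<le> T'" "\<And>s'. Q s' \<Longrightarrow> Q' s'"
  shows "runs p s T' Q'"
  using assms unfolding runs_def by (meson le_trans)

lemma runs_Seq:
  assumes "runs p s T1 P" "\<And>s'. P s' \<Longrightarrow> runs q s' T2 Q" "T1 + T2 \<le> T"
  shows "runs (Seq p q) s T Q"
proof -
  obtain t1 s1 where 1: "exec p s t1 s1" "t1 \<le> T1" "P s1" using assms(1) unfolding runs_def by blast
  obtain t2 s2 where 2: "exec q s1 t2 s2" "t2 \<le> T2" "Q s2" using assms(2)[OF 1(3)] unfolding runs_def by blast
  have "exec (Seq p q) s (t1 + t2) s2" using 1(1) 2(1) by (rule exec_Seq)
  then show ?thesis using 1 2 assms(3) unfolding runs_def by (meson add_mono le_trans)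
qed

text \<open>The invariant is indexed by the number of completed iterations, and the index settles
  the loop test, so termination and the bound come together. The factor \<open>N + 1\<close> charges
  the final failing test as a full iteration.\<close>

lemma runs_While:
  assumes "I 0 s"
    and "\<And>k s. k < N \<Longrightarrow> I k s \<Longrightarrow> aval a s < aval b s \<and> runs p s T (I (Suc k))"
    and "\<And>s. I N s \<Longrightarrow> \<not> aval a s < aval b s"
  shows "runs (WhileLess a b p) s ((N + 1) * (T + acost a + acost b + 1)) (I N)"
proof -
  let ?c = "acost a + acost b + 1"
  have "runs (WhileLess a b p) s ((N - k) * (T + ?c) + ?c) (I N)" if "k \<le> N" "I k s" for k s
    using that
  proof (induction "N - k" arbitrary: k s)
    case 0
    then have "k = N" by simp
    with 0 have "I N s" by simp
    have "exec (WhileLess a b p) s ?c s" by (rule exec_WhileFalse[OF assms(3)[OF \<open>I N s\<close>]])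
    then show ?case using \<open>I N s\<close> unfolding runs_def by (meson le_add2)
  next
    case (Suc d)
    then have k: "k < N" by simp
    from assms(2)[OF k Suc.prems(2)] obtain t s' where
      1: "aval a s < aval b s" "exec p s t s'" "t \<le> T" "I (Suc k) s'" unfolding runs_def by blast
    have "d = N - Suc k" "Suc k \<le> N" using Suc k by auto
    from Suc.hyps(1)[OF this 1(4)] obtain t' s'' where
      2: "exec (WhileLess a b p) s' t' s''" "t' \<le> (N - Suc k) * (T + ?c) + ?c" "I N s''"
      unfolding runs_def by blast
    have "(N - k) * (T + ?c) = (T + ?c) + (N - Suc k) * (T + ?c)"
      using k by (metis Suc_diff_Suc mult_Suc)
    then have "?c + t + t' \<le> (N - k) * (T + ?c) + ?c" using 1(3) 2(2) by linarith
    moreover have "exec (WhileLess a b p) s (?c + t + t') s''" using exec_WhileTrue[OF 1(1,2) 2(1)] .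
    ultimately show ?case using 2(3) unfolding runs_def by blast
  qed
  from this[of 0 s] assms(1) have "runs (WhileLess a b p) s (N * (T + ?c) + ?c) (I N)" by simp
  then show ?thesis by (rule runs_mono) (auto simp: algebra_simps)
qed

fun straight_line :: "com \<Rightarrow> bool" where
  "straight_line (Seq p q) \<longleftrightarrow> straight_line p \<and> straight_line q"
| "straight_line (IfLess a b p q) \<longleftrightarrow> straight_line p \<and> straight_line q"
| "straight_line (WhileLess a b p) \<longleftrightarrow> False"
| "straight_line _ \<longleftrightarrow> True"

text \<open>The value on loops is irrelevant.\<close>

fun effect :: "com \<Rightarrow> state \<Rightarrow> state" where
  "effect Skip s = s"
| "effect (SetReg r a) s = ((fst s)(r := aval a s), snd s)"
| "effect (SetMem a b) s = (fst s, (snd s)(nat \<lfloor>aval a s\<rfloor> := aval b s))"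
| "effect (Seq p q) s = effect q (effect p s)"
| "effect (IfLess a b p q) s = (if aval a s < aval b s then effect p s else effect q s)"
| "effect (WhileLess a b p) s = s"

fun max_steps :: "com \<Rightarrow> nat" where
  "max_steps Skip = 1"
| "max_steps (SetReg r a) = acost a + 1"
| "max_steps (SetMem a b) = acost a + acost b + 1"
| "max_steps (Seq p q) = max_steps p + max_steps q"
| "max_steps (IfLess a b p q) = acost a + acost b + 1 + max (max_steps p) (max_steps q)"
| "max_steps (WhileLess a b p) = 0"

lemma exec_straight:
  "straight_line p \<Longrightarrow> \<exists>t\<le>max_steps p. exec p s t (effect p s)"
proof (induction p arbitrary: s)
  case Skip
  then show ?case using exec_Skip[of s] by auto
next
  case (SetReg r a)
  then show ?case using exec_SetReg[of r a s] by auto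
next
  case (SetMem a b)
  then show ?case using exec_SetMem[of a b s] by auto
next
  case (Seq p q)
  then obtain t1 t2 where t: "t1 \<le> max_steps p" "exec p s t1 (effect p s)" "t2 \<le> max_steps q"
    "exec q (effect p s) t2 (effect q (effect p s))" by (metis straight_line.simps(1))
  from exec_Seq[OF t(2,4)] show ?case using t(1,3)
    by (intro exI[of _ "t1 + t2"]) simp
next
  case (IfLess a b p q)
  show ?case
  proof (cases "aval a s < aval b s")
    case True
    obtain t where t: "t \<le> max_steps p" "exec p s t (effect p s)" using IfLess.IH(1)[of s] IfLess.prems by auto
    from exec_IfTrue[OF True t(2)] show ?thesis using t(1) True
      by (intro exI[of _ "acost a + acost b + 1 + t"]) auto
  next
    case False
    obtain t where t: "t \<le> max_steps q" "exec q s t (effect q s)" using IfLess.IH(2)[of s] IfLess.prems by auto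
    from exec_IfFalse[OF False t(2)] show ?thesis using t(1) False
      by (intro exI[of _ "acost a + acost b + 1 + t"]) auto
  qed
qed simp

lemma runs_straight:
  assumes "straight_line p" "max_steps p \<le> T" "Q (effect p s)"
  shows "runs p s T Q"
  using exec_straight[OF assms(1), of s] assms(2,3) unfolding runs_def by (meson le_trans)

lemma runs_straight_Seq:
  assumes "straight_line p" "runs q (effect p s) T' Q" "max_steps p + T' \<le> T"
  shows "runs (Seq p q) s T Q"
  by (rule runs_Seq[where P = "\<lambda>s'. s' = effect p s", OF runs_straight[OF assms(1) order_refl refl]])
    (use assms in auto)

definition mask_set :: "nat \<Rightarrow> nat \<Rightarrow> nat set" where
  "mask_set L M = Suc ` {e. e < L \<and> odd (M div 2 ^ e)}"

lemma mask_set_subset: "mask_set L M \<subseteq> {1..L}"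
  unfolding mask_set_def by auto

text \<open>Bit \<open>e\<close> stands for \<open>Suc e\<close>, because 0 is never a member. The
  mask of a given set is the \<open>set_encode\<close> of the set shifted down by one.\<close>

lemma mask_set_surj:
  assumes "S \<subseteq> {1..L}"
  shows "\<exists>M<2 ^ L. mask_set L M = S"
proof -
  define A where "A = {e. Suc e \<in> S}"
  have A: "A \<subseteq> {..<L}" using assms unfolding A_def by auto
  then have fin: "finite A" using finite_subset by blast
  have "set_encode A \<le> (\<Sum>i<L. 2 ^ i)" unfolding set_encode_def using A by (intro sum_mono2) auto
  also have "\<dots> < 2 ^ L" using sum_power2[of L] by (simp add: lessThan_atLeast0)
  finally have "set_encode A < 2 ^ L" .
  moreover have "{e. e < L \<and> odd (set_encode A div 2 ^ e)} = A"
    using set_encode_inverse[OF fin] A unfolding set_decode_def by auto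
  then have "mask_set L (set_encode A) = Suc ` A" unfolding mask_set_def by simp
  moreover have "Suc ` A = S"
  proof (intro set_eqI iffI)
    fix s assume "s \<in> S"
    then have "s = Suc (s - 1)" "s - 1 \<in> A" using assms unfolding A_def by auto
    then show "s \<in> Suc ` A" by blast
  qed (auto simp: A_def)
  ultimately show ?thesis by blast
qed

lemma mask_set_Suc:
  "Suc ` {e'. e' < Suc e \<and> odd (M div 2 ^ e')}
    = (if odd (M div 2 ^ e) then {Suc e} else {}) \<union> Suc ` {e'. e' < e \<and> odd (M div 2 ^ e')}"
  by (auto simp: less_Suc_eq)

lemma mult_count_Suc:
  "mult_count S (Suc k) = mult_count S k + (if \<exists>s\<in>S. s dvd Suc k then 1 else 0)"
proof -
  have "{j \<in> {1..Suc k}. \<exists>s\<in>S. s dvd j}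
    = (if \<exists>s\<in>S. s dvd Suc k then {Suc k} else {}) \<union> {j \<in> {1..k}. \<exists>s\<in>S. s dvd j}"
    by (auto simp: le_Suc_eq)
  then show ?thesis unfolding mult_count_def by auto
qed

lemma of_int_floor_div: "real_of_int \<lfloor>real a / real b\<rfloor> = real (a div b)"
  by (simp add: floor_divide_of_nat_eq)

lemma of_int_floor_half: "real_of_int \<lfloor>real a / 2\<rfloor> = real (a div 2)"
  using of_int_floor_div[of a 2] by simp

lemma real_mod: "real a - real b * real (a div b) = real (a mod b)"
proof -
  have "real (b * (a div b) + a mod b) = real a" by (simp only: mult_div_mod_eq)
  then show ?thesis by (simp only: of_nat_add of_nat_mult)
qed

lemma nat_floor_add: "nat \<lfloor>real a + real b\<rfloor> = a + b"
  by (simp flip: of_nat_add)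

lemma div_power2_Suc: "(a :: nat) div 2 ^ e div 2 = a div 2 ^ Suc e"
  by (simp only: power_Suc2 div_mult2_eq)

text \<open>A divisibility test with the operations of the machine: rounding \<open>k\<close> down
  to a multiple of \<open>Suc e\<close> makes it smaller exactly if it is not a multiple.\<close>

lemma floor_mult_less_iff:
  "real_of_int \<lfloor>real k / (real e + 1)\<rfloor> * (real e + 1) < real k \<longleftrightarrow> \<not> Suc e dvd k"
proof -
  have "real_of_int \<lfloor>real k / (real e + 1)\<rfloor> = real (k div Suc e)"
    using of_int_floor_div[of k "Suc e"] by (simp add: add.commute)
  moreover have "real (k div Suc e) * (real e + 1) = real (k div Suc e * Suc e)"
    by (simp add: algebra_simps)
  ultimately have "?thesis \<longleftrightarrow> (k div Suc e * Suc e < k \<longleftrightarrow> \<not> Suc e dvd k)" by (simp only: of_nat_less_iff)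
  moreover have "k div Suc e * Suc e < k \<longleftrightarrow> \<not> Suc e dvd k"
    by (metis dvd_div_mult_self dvd_triv_right div_times_less_eq_dividend nat_less_le)
  ultimately show ?thesis by blast
qed

section \<open>The program\<close>

abbreviation (input) seq (infixr ";;" 60) where "p ;; q \<equiv> Seq p q"

text \<open>Registers 0 to 2 hold the input, 3 to 7 the parameters \<open>r\<close>, \<open>L\<close>, \<open>2 ^ L\<close>, \<open>W\<close> and the number of
  candidates, 8 and 9 the best estimate and its candidate, 10 the current candidate, 11 to 17 its
  components and its estimate; the others are scratch.\<close>

definition init_params :: com where
  "init_params =
    SetReg 3 (Add (Floor (Div (Const 11) (Reg 1))) (Const 7)) ;;
    SetReg 4 (Mul (Const 8) (Mul (Reg 3) (Reg 3))) ;;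
    SetReg 5 (Const 1)"

text \<open>The language has no exponentiation, so \<open>2 ^ L\<close> takes \<open>L\<close>
  doublings.\<close>

definition double_loop :: com where
  "double_loop = WhileLess (Reg 18) (Reg 4)
    (SetReg 5 (Add (Reg 5) (Reg 5)) ;; SetReg 18 (Add (Reg 18) (Const 1)))"

definition init_counts :: com where
  "init_counts =
    SetReg 6 (Mul (Const 2) (Mul (Reg 3) (Mul (Reg 4) (Reg 5)))) ;;
    SetReg 7 (Mul (Const 3) (Mul (Reg 0) (Mul (Mul (Reg 3) (Reg 3)) (Reg 5))))"

definition params :: "nat \<Rightarrow> real \<Rightarrow> nat \<Rightarrow> nat \<Rightarrow> state \<Rightarrow> bool" where
  "params n \<Delta> r L s \<longleftrightarrow> fst s 0 = real n \<and> fst s 2 = \<Delta> \<and> fst s 3 = real r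
      \<and> fst s 4 = real L \<and> fst s 5 = 2 ^ L \<and> fst s 6 = real (2 * r * L * 2 ^ L)
      \<and> fst s 7 = real (3 * n * r\<^sup>2 * 2 ^ L)"

lemma runs_init:
  assumes "\<epsilon> > 0" "r = nat \<lfloor>11 / \<epsilon>\<rfloor> + 7" "L = 8 * r\<^sup>2"
  shows "runs (init_params ;; double_loop ;; init_counts) (input_state \<epsilon> n K H \<Delta>) (20 * (L + 10))
    (\<lambda>s. snd s = snd (input_state \<epsilon> n K H \<Delta>) \<and> params n \<Delta> r L s)"
proof -
  let ?m = "snd (input_state \<epsilon> n K H \<Delta>)"
  define I where "I k s \<longleftrightarrow> snd s = ?m \<and> fst s 0 = real n \<and> fst s 2 = \<Delta> \<and> fst s 3 = real r
      \<and> fst s 4 = real L \<and> fst s 5 = 2 ^ k \<and> fst s 18 = real k" for k and s :: state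
  have r: "real_of_int \<lfloor>11 / \<epsilon>\<rfloor> + 7 = real r" using assms by simp
  have L: "8 * (real r * real r) = real L" unfolding assms(3) by (simp add: power2_eq_square)
  let ?s = "effect init_params (input_state \<epsilon> n K H \<Delta>)"
  have "I 0 ?s" using r L by (simp add: I_def init_params_def input_state_def)
  then have "runs double_loop ?s ((L + 1) * (8 + acost (Reg 18) + acost (Reg 4) + 1)) (I L)"
    unfolding double_loop_def
    by (rule runs_While) (auto intro!: runs_straight simp: I_def)
  then have "runs (double_loop ;; init_counts) ?s ((L + 1) * 11 + 50)
      (\<lambda>s. snd s = ?m \<and> params n \<Delta> r L s)"
  proof (rule runs_Seq)
    fix s assume "I L s"
    then show "runs init_counts s 50 (\<lambda>s. snd s = ?m \<and> params n \<Delta> r L s)"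
      unfolding init_counts_def
      by (intro runs_straight) (auto simp: I_def params_def power2_eq_square)
  qed simp
  then show ?thesis
    by (rule runs_straight_Seq[rotated]) (simp_all add: init_params_def)
qed

text \<open>Candidates are numbered in mixed radix, with digits below 3, \<open>n\<close>,
  \<open>r\<^sup>2\<close> and \<open>2 ^ L\<close> from the lowest to the highest, so one counter
  replaces four nested loops. Index and scale are shifted by one since they start at 1.\<close>

definition decode_prog :: com where
  "decode_prog =
    SetReg 18 (Floor (Div (Reg 10) (Const 3))) ;;
    SetReg 11 (Sub (Reg 10) (Mul (Const 3) (Reg 18))) ;;
    SetReg 19 (Floor (Div (Reg 18) (Reg 0))) ;;
    SetReg 12 (Add (Sub (Reg 18) (Mul (Reg 0) (Reg 19))) (Const 1)) ;;
    SetReg 20 (Mul (Reg 3) (Reg 3)) ;;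
    SetReg 14 (Floor (Div (Reg 19) (Reg 20))) ;;
    SetReg 13 (Add (Sub (Reg 19) (Mul (Reg 20) (Reg 14))) (Const 1))"

definition kind_of :: "nat \<Rightarrow> nat" where
  "kind_of c = c mod 3"

definition index_of :: "nat \<Rightarrow> nat \<Rightarrow> nat" where
  "index_of n c = c div 3 mod n + 1"

definition scale_of :: "nat \<Rightarrow> nat \<Rightarrow> nat \<Rightarrow> nat" where
  "scale_of n r c = c div 3 div n mod r\<^sup>2 + 1"

definition mask_of :: "nat \<Rightarrow> nat \<Rightarrow> nat \<Rightarrow> nat" where
  "mask_of n r c = c div 3 div n div r\<^sup>2"

text \<open>The frame condition of a program part: what is still needed sits in lower registers than
  what the part overwrites, so an initial segment expresses what survives.\<close>

definition agree :: "nat \<Rightarrow> state \<Rightarrow> state \<Rightarrow> bool" where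
  "agree b s s' \<longleftrightarrow> (\<forall>q<b. fst s' q = fst s q)"

lemma runs_decode:
  assumes "fst s 0 = real n" "fst s 3 = real r" "fst s 10 = real c"
  shows "runs decode_prog s 60 (\<lambda>s'. agree 11 s s' \<and> snd s' = snd s \<and> fst s' 11 = real (kind_of c)
    \<and> fst s' 12 = real (index_of n c) \<and> fst s' 13 = real (scale_of n r c) \<and> fst s' 14 = real (mask_of n r c))"
proof -
  have 1: "real_of_int \<lfloor>real c / 3\<rfloor> = real (c div 3)" using of_int_floor_div[of c 3] by simp
  have 2: "real_of_int \<lfloor>real (c div 3) / real n\<rfloor> = real (c div 3 div n)" by (rule of_int_floor_div)
  have 3: "real_of_int \<lfloor>real (c div 3 div n) / (real r * real r)\<rfloor> = real (c div 3 div n div r\<^sup>2)"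
    using of_int_floor_div[of "c div 3 div n" "r\<^sup>2"] by (simp add: power2_eq_square)
  have m: "real c - 3 * real (c div 3) = real (c mod 3)"
    "real (c div 3) - real n * real (c div 3 div n) = real (c div 3 mod n)"
    "real (c div 3 div n) - real r * real r * real (c div 3 div n div r\<^sup>2) = real (c div 3 div n mod r\<^sup>2)"
    using real_mod[of c 3] real_mod[of "c div 3" n] real_mod[of "c div 3 div n" "r\<^sup>2"]
    by (simp_all add: power2_eq_square)
  show ?thesis unfolding decode_prog_def
    by (rule runs_straight)
      (simp_all add: assms 1 2 3 m agree_def kind_of_def index_of_def scale_of_def mask_of_def)
qed

definition holds_instance :: "nat \<Rightarrow> (nat \<Rightarrow> real) \<Rightarrow> (nat \<Rightarrow> real) \<Rightarrow> state \<Rightarrow> bool" where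
  "holds_instance n K H s \<longleftrightarrow> (\<forall>i\<le>n. snd s i = K i) \<and> (\<forall>i\<in>{1..n}. snd s (n + i) = H i)"

definition tau :: "nat \<Rightarrow> aexp" where
  "tau q = Sqrt (Div (Mem (Reg q)) (Mem (Add (Reg 0) (Reg q))))"

lemma holds_instanceD:
  assumes "holds_instance n K H s"
  shows "snd s 0 = K 0" "i \<in> {1..n} \<Longrightarrow> snd s i = K i" "i \<in> {1..n} \<Longrightarrow> snd s (n + i) = H i"
  using assms by (auto simp: holds_instance_def)

lemma acost_tau [simp]: "acost (tau q) = 8"
  by (simp add: tau_def)

lemma aval_tau:
  assumes "holds_instance n K H s" "fst s 0 = real n" "fst s q = real i" "i \<in> {1..n}"
  shows "aval (tau q) s = sqrt (K i / H i)"
  using assms by (simp add: tau_def holds_instance_def nat_int_add)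

definition prefix_step :: com where
  "prefix_step =
    IfLess (tau 12) (tau 18) Skip
      (SetReg 19 (Add (Reg 19) (Mem (Reg 18))) ;;
       SetReg 20 (Add (Reg 20) (Mem (Add (Reg 0) (Reg 18))))) ;;
    SetReg 18 (Add (Reg 18) (Const 1))"

definition prefix_prog :: com where
  "prefix_prog =
    (SetReg 18 (Const 1) ;; SetReg 19 (Mem (Const 0)) ;; SetReg 20 (Const 0)) ;;
    WhileLess (Reg 18) (Add (Reg 0) (Const 1)) prefix_step"

lemma Collect_atLeastAtMost_Suc:
  "{i \<in> {1..Suc k}. P i} = (if P (Suc k) then {Suc k} else {}) \<union> {i \<in> {1..k}. P i}"
  by (auto simp: le_Suc_eq)

lemma runs_prefix:
  assumes s0: "params n \<Delta> r L s0" "holds_instance n K H s0" "fst s0 12 = real j" "j \<in> {1..n}"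
  shows "runs prefix_prog s0 (50 * (n + 1) + 10) (\<lambda>s. agree 18 s0 s \<and> snd s = snd s0
    \<and> sqrt (fst s 19 / fst s 20) = prefix_optimum n K H j)"
proof -
  let ?A = "\<lambda>k. {i \<in> {1..k}. sqrt (K i / H i) \<le> sqrt (K j / H j)}"
  define I where "I k s \<longleftrightarrow> agree 18 s0 s \<and> snd s = snd s0 \<and> fst s 18 = real (Suc k)
    \<and> fst s 19 = K 0 + sum K (?A k) \<and> fst s 20 = sum H (?A k)" for k s
  let ?s = "effect (SetReg 18 (Const 1) ;; SetReg 19 (Mem (Const 0)) ;; SetReg 20 (Const 0)) s0"
  have "I 0 ?s" using s0(2) by (simp add: I_def agree_def holds_instance_def)
  then have "runs (WhileLess (Reg 18) (Add (Reg 0) (Const 1)) prefix_step) ?s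
    ((n + 1) * (35 + acost (Reg 18) + acost (Add (Reg 0) (Const 1)) + 1)) (I n)"
  proof (rule runs_While)
    fix k s assume k: "k < n" and I: "I k s"
    have s: "holds_instance n K H s" "fst s 0 = real n" "fst s 12 = real j" "fst s 18 = real (Suc k)"
      using I s0 by (auto simp: I_def agree_def holds_instance_def params_def)
    have t: "aval (tau 12) s = sqrt (K j / H j)" "aval (tau 18) s = sqrt (K (Suc k) / H (Suc k))"
      using k by (auto intro!: aval_tau[OF s(1,2)] s s0(4))
    have m: "snd s (nat \<lfloor>real (Suc k)\<rfloor>) = K (Suc k)" "snd s (nat \<lfloor>real n + real (Suc k)\<rfloor>) = H (Suc k)"
      unfolding nat_floor_add floor_of_nat nat_int using holds_instanceD(2,3)[OF s(1), of "Suc k"] k by simp_all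
    have A: "?A (Suc k) = (if sqrt (K (Suc k) / H (Suc k)) \<le> sqrt (K j / H j) then {Suc k} else {}) \<union> ?A k"
      by (rule Collect_atLeastAtMost_Suc)
    have fin: "finite (?A k)" "Suc k \<notin> ?A k" by auto
    have "I (Suc k) (effect prefix_step s)"
    proof (cases "sqrt (K j / H j) < sqrt (K (Suc k) / H (Suc k))")
      case True
      then have "?A (Suc k) = ?A k" unfolding A by simp
      then show ?thesis using I True unfolding prefix_step_def
        by (simp add: t I_def agree_def)
    next
      case False
      then have "?A (Suc k) = insert (Suc k) (?A k)" unfolding A by auto
      then have "sum K (?A (Suc k)) = K (Suc k) + sum K (?A k)" "sum H (?A (Suc k)) = H (Suc k) + sum H (?A k)"
        using fin by simp_all
      then show ?thesis using I False m s unfolding prefix_step_def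
        by (simp add: t I_def agree_def)
    qed
    then show "aval (Reg 18) s < aval (Add (Reg 0) (Const 1)) s \<and> runs prefix_step s 35 (I (Suc k))"
      using s k by (auto intro!: runs_straight simp: prefix_step_def)
  next
    fix s assume "I n s"
    then show "\<not> aval (Reg 18) s < aval (Add (Reg 0) (Const 1)) s"
      using s0 by (simp add: I_def agree_def params_def)
  qed
  then have "runs prefix_prog s0 (50 * (n + 1) + 10) (I n)"
    unfolding prefix_prog_def by (rule runs_straight_Seq[rotated]) simp_all
  then show ?thesis
    by (rule runs_mono) (auto simp: I_def prefix_optimum_def Let_def)
qed

definition candidate_base ::
  "nat \<Rightarrow> (nat \<Rightarrow> real) \<Rightarrow> (nat \<Rightarrow> real) \<Rightarrow> real \<Rightarrow> nat \<Rightarrow> nat \<Rightarrow> nat \<Rightarrow> real" where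
  "candidate_base n K H \<Delta> r v j =
    (if v < 1 then real r * \<Delta> else if v < 2 then sqrt (K j / H j) else prefix_optimum n K H j)"

text \<open>The default is overwritten: kind 2 keeps the pooled minimiser, kinds 0 and 1 take the
  individual one, and kind 0 then takes \<open>r * \<Delta>\<close>.\<close>

definition select_prog :: com where
  "select_prog =
    SetReg 15 (Sqrt (Div (Reg 19) (Reg 20))) ;;
    IfLess (Reg 11) (Const 2) (SetReg 15 (tau 12)) Skip ;;
    IfLess (Reg 11) (Const 1) (SetReg 15 (Mul (Reg 3) (Reg 2))) Skip ;;
    SetReg 16 (Div (Mul (Reg 15) (Reg 13)) (Mul (Reg 3) (Reg 2))) ;;
    IfLess (Reg 16) (Const 1) (SetReg 16 (Const 1)) Skip ;;
    SetReg 16 (Floor (Reg 16))"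

lemma real_base_mult:
  "real (base_mult r \<Delta> x l) = of_int \<lfloor>if x * real l / (real r * \<Delta>) < 1 then 1 else x * real l / (real r * \<Delta>)\<rfloor>"
  unfolding base_mult_def by (auto simp: max_def)

lemma runs_select:
  assumes "params n \<Delta> r L s" "holds_instance n K H s"
    and "fst s 11 = real v" "fst s 12 = real j" "j \<in> {1..n}" "fst s 13 = real l"
    and "sqrt (fst s 19 / fst s 20) = prefix_optimum n K H j"
  shows "runs select_prog s 80 (\<lambda>s'. agree 15 s s' \<and> snd s' = snd s
    \<and> fst s' 16 = real (base_mult r \<Delta> (candidate_base n K H \<Delta> r v j) l))"
proof (rule runs_straight)
  have t: "aval (tau 12) s' = sqrt (K j / H j)" if "snd s' = snd s" "fst s' 0 = fst s 0" "fst s' 12 = fst s 12" for s'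
    using that assms by (intro aval_tau[of n]) (auto simp: params_def holds_instance_def)
  show "agree 15 s (effect select_prog s) \<and> snd (effect select_prog s) = snd s
    \<and> fst (effect select_prog s) 16 = real (base_mult r \<Delta> (candidate_base n K H \<Delta> r v j) l)"
    using assms unfolding select_prog_def
    by (simp add: t real_base_mult candidate_base_def agree_def params_def)
qed (simp_all add: select_prog_def)

definition bit_of :: "nat \<Rightarrow> aexp" where
  "bit_of q = Sub (Reg q) (Mul (Const 2) (Floor (Div (Reg q) (Const 2))))"

lemma acost_bit_of [simp]: "acost (bit_of q) = 8"
  by (simp add: bit_of_def)

lemma aval_bit_of: "fst s q = real a \<Longrightarrow> aval (bit_of q) s = real (a mod 2)"
  using real_mod[of a 2] by (simp add: bit_of_def of_int_floor_half)

definition scan_step :: com where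
  "scan_step =
    IfLess (Const 0) (bit_of 20)
      (IfLess (Mul (Floor (Div (Reg 18) (Add (Reg 21) (Const 1)))) (Add (Reg 21) (Const 1))) (Reg 18)
        Skip (SetReg 19 (Const 1)))
      Skip ;;
    SetReg 20 (Floor (Div (Reg 20) (Const 2))) ;;
    SetReg 21 (Add (Reg 21) (Const 1))"

definition scan_prog :: com where
  "scan_prog =
    (SetReg 19 (Const 0) ;; SetReg 20 (Reg 14) ;; SetReg 21 (Const 0)) ;;
    WhileLess (Reg 21) (Reg 4) scan_step"

lemma runs_scan:
  assumes "fst s0 4 = real L" "fst s0 14 = real M" "fst s0 18 = real k"
  shows "runs scan_prog s0 (50 * (L + 1) + 10) (\<lambda>s. agree 19 s0 s \<and> snd s = snd s0
    \<and> fst s 19 = (if \<exists>d\<in>mask_set L M. d dvd k then 1 else 0))"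
proof -
  let ?A = "\<lambda>e. Suc ` {e'. e' < e \<and> odd (M div 2 ^ e')}"
  define I where "I e s \<longleftrightarrow> agree 19 s0 s \<and> snd s = snd s0 \<and> fst s 21 = real e
    \<and> fst s 20 = real (M div 2 ^ e) \<and> fst s 19 = (if \<exists>d\<in>?A e. d dvd k then 1 else 0)" for e s
  let ?s = "effect (SetReg 19 (Const 0) ;; SetReg 20 (Reg 14) ;; SetReg 21 (Const 0)) s0"
  have "I 0 ?s" using assms by (simp add: I_def agree_def)
  then have "runs (WhileLess (Reg 21) (Reg 4) scan_step) ?s
    ((L + 1) * (45 + acost (Reg 21) + acost (Reg 4) + 1)) (I L)"
  proof (rule runs_While)
    fix e s assume e: "e < L" and I: "I e s"
    have s: "fst s 4 = real L" "fst s 18 = real k" "fst s 20 = real (M div 2 ^ e)" "fst s 21 = real e"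
      using I assms by (auto simp: I_def agree_def)
    have half: "real_of_int \<lfloor>real (M div 2 ^ e) / 2\<rfloor> = real (M div 2 ^ Suc e)"
      by (simp only: of_int_floor_half div_power2_Suc)
    have "I (Suc e) (effect scan_step s)"
    proof (cases "odd (M div 2 ^ e)")
      case False
      then have "aval (bit_of 20) s = 0" using aval_bit_of[OF s(3)] by simp
      moreover have "?A (Suc e) = ?A e" using mask_set_Suc[of e M] False by simp
      ultimately show ?thesis using I half s unfolding scan_step_def
        by (simp add: I_def agree_def)
    next
      case True
      then have "aval (bit_of 20) s = 1" using aval_bit_of[OF s(3)] by (simp add: odd_iff_mod_2_eq_one)
      moreover have "?A (Suc e) = insert (Suc e) (?A e)" using mask_set_Suc[of e M] True by simp
      ultimately show ?thesis using I half s unfolding scan_step_def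
        by (simp add: I_def agree_def floor_mult_less_iff)
    qed
    then show "aval (Reg 21) s < aval (Reg 4) s \<and> runs scan_step s 45 (I (Suc e))"
      using s e by (auto intro!: runs_straight simp: scan_step_def)
  next
    fix s assume "I L s"
    then show "\<not> aval (Reg 21) s < aval (Reg 4) s" using assms by (simp add: I_def agree_def)
  qed
  then have "runs scan_prog s0 (50 * (L + 1) + 10) (I L)"
    unfolding scan_prog_def by (rule runs_straight_Seq[rotated]) simp_all
  then show ?thesis
    by (rule runs_mono) (auto simp: I_def mask_set_def)
qed

definition count_step :: com where
  "count_step = scan_prog ;; SetReg 17 (Add (Reg 17) (Reg 19)) ;; SetReg 18 (Add (Reg 18) (Const 1))"

definition count_prog :: com where
  "count_prog =
    (SetReg 17 (Const 0) ;; SetReg 18 (Const 1)) ;;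
    WhileLess (Reg 18) (Add (Reg 6) (Const 1)) count_step ;;
    SetReg 17 (Mul (Mem (Const 0)) (Add (Div (Reg 17) (Mul (Reg 6) (Reg 2))) (Div (Const 1) (Mul (Reg 16) (Reg 2)))))"

lemma runs_count:
  assumes s0: "params n \<Delta> r L s0" "holds_instance n K H s0" "fst s0 14 = real M" "fst s0 16 = real m"
    and W: "W = 2 * r * L * 2 ^ L"
  shows "runs count_prog s0 ((W + 1) * (50 * (L + 1) + 30) + 30) (\<lambda>s. agree 17 s0 s \<and> snd s = snd s0
    \<and> fst s 17 = K 0 * (real (mult_count (mask_set L M) W) / (real W * \<Delta>) + 1 / (real m * \<Delta>)))"
proof -
  define I where "I k s \<longleftrightarrow> agree 17 s0 s \<and> snd s = snd s0 \<and> fst s 18 = real (Suc k)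
    \<and> fst s 17 = real (mult_count (mask_set L M) k)" for k s
  have W0: "fst s0 6 = real W" using s0(1) unfolding W params_def by simp
  let ?s = "effect (SetReg 17 (Const 0) ;; SetReg 18 (Const 1)) s0"
  have "I 0 ?s" by (simp add: I_def agree_def mult_count_def)
  then have "runs (WhileLess (Reg 18) (Add (Reg 6) (Const 1)) count_step) ?s
    ((W + 1) * ((50 * (L + 1) + 25) + acost (Reg 18) + acost (Add (Reg 6) (Const 1)) + 1)) (I W)"
  proof (rule runs_While)
    fix k s assume k: "k < W" and I: "I k s"
    have s: "fst s 4 = real L" "fst s 6 = real W" "fst s 14 = real M" "fst s 18 = real (Suc k)"
      using I s0 W0 by (auto simp: I_def agree_def params_def)
    have "runs count_step s (50 * (L + 1) + 25) (I (Suc k))"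
      unfolding count_step_def
    proof (rule runs_Seq[OF runs_scan[OF s(1,3,4)]])
      fix s' assume s': "agree 19 s s' \<and> snd s' = snd s
        \<and> fst s' 19 = (if \<exists>d\<in>mask_set L M. d dvd Suc k then 1 else 0)"
      then have "fst s' 17 = fst s 17" "fst s' 18 = fst s 18" "agree 17 s s'" by (auto simp: agree_def)
      then show "runs (SetReg 17 (Add (Reg 17) (Reg 19)) ;; SetReg 18 (Add (Reg 18) (Const 1))) s' 10 (I (Suc k))"
        using I s' by (intro runs_straight) (auto simp: I_def mult_count_Suc agree_def)
    qed simp
    then show "aval (Reg 18) s < aval (Add (Reg 6) (Const 1)) s \<and> runs count_step s (50 * (L + 1) + 25) (I (Suc k))"
      using s k by auto
  next
    fix s assume "I W s"
    then show "\<not> aval (Reg 18) s < aval (Add (Reg 6) (Const 1)) s" using W0 by (simp add: I_def agree_def)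
  qed
  then have "runs (WhileLess (Reg 18) (Add (Reg 6) (Const 1)) count_step ;;
    SetReg 17 (Mul (Mem (Const 0)) (Add (Div (Reg 17) (Mul (Reg 6) (Reg 2))) (Div (Const 1) (Mul (Reg 16) (Reg 2))))))
    ?s ((W + 1) * (50 * (L + 1) + 30) + 15) (\<lambda>s. agree 17 s0 s \<and> snd s = snd s0
    \<and> fst s 17 = K 0 * (real (mult_count (mask_set L M) W) / (real W * \<Delta>) + 1 / (real m * \<Delta>)))"
  proof (rule runs_Seq)
    fix s assume I: "I W s"
    then have "fst s 6 = real W" "fst s 2 = \<Delta>" "fst s 16 = real m" "snd s 0 = K 0"
      using s0 W0 by (auto simp: I_def agree_def params_def holds_instance_def)
    then show "runs (SetReg 17 (Mul (Mem (Const 0)) (Add (Div (Reg 17) (Mul (Reg 6) (Reg 2))) (Div (Const 1) (Mul (Reg 16) (Reg 2))))))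
      s 15 (\<lambda>s. agree 17 s0 s \<and> snd s = snd s0
      \<and> fst s 17 = K 0 * (real (mult_count (mask_set L M) W) / (real W * \<Delta>) + 1 / (real m * \<Delta>)))"
      using I by (intro runs_straight) (auto simp: I_def agree_def)
  qed simp
  then show ?thesis
    unfolding count_prog_def by (rule runs_straight_Seq[rotated]) simp_all
qed

definition cost_at :: "nat \<Rightarrow> aexp" where
  "cost_at q = Add (Div (Mem (Reg 18)) (Mul (Reg q) (Reg 2)))
    (Mul (Mem (Add (Reg 0) (Reg 18))) (Mul (Reg q) (Reg 2)))"

lemma acost_cost_at [simp]: "acost (cost_at q) = 15"
  by (simp add: cost_at_def)

lemma aval_cost_at:
  assumes "holds_instance n K H s" "fst s 0 = real n" "fst s 2 = \<Delta>" "fst s 18 = real i" "i \<in> {1..n}"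
    "fst s q = real a"
  shows "aval (cost_at q) s = marginal_cost K H i (real a * \<Delta>)"
  using assms holds_instanceD(2,3)[OF assms(1,5)]
  by (simp add: cost_at_def marginal_cost_def nat_int_add)

definition keep_better :: com where
  "keep_better =
    SetReg 23 (cost_at 22) ;;
    IfLess (Reg 23) (Reg 21) (SetReg 20 (Reg 22) ;; SetReg 21 (Reg 23)) Skip"

text \<open>The minimiser is kept next to the minimum: the estimate needs the value, the policy the
  argument. Ties may be resolved either way.\<close>

definition best_in :: "(nat \<Rightarrow> real) \<Rightarrow> nat set \<Rightarrow> state \<Rightarrow> bool" where
  "best_in f A s \<longleftrightarrow> finite A \<and> (\<exists>a\<in>A. fst s 20 = real a \<and> fst s 21 = f a \<and> f a = Min (f ` A))"

lemma best_in_cong: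
  "best_in f A s \<Longrightarrow> fst s' 20 = fst s 20 \<Longrightarrow> fst s' 21 = fst s 21 \<Longrightarrow> best_in f A s'"
  by (simp add: best_in_def)

lemma effect_keep_better:
  assumes "holds_instance n K H s" "fst s 0 = real n" "fst s 2 = \<Delta>" "fst s 18 = real i" "i \<in> {1..n}"
    "fst s 22 = real a" "best_in (\<lambda>q. marginal_cost K H i (real q * \<Delta>)) A s"
  shows "best_in (\<lambda>q. marginal_cost K H i (real q * \<Delta>)) (insert a A) (effect keep_better s)"
    and "q \<notin> {20, 21, 23} \<Longrightarrow> fst (effect keep_better s) q = fst s q"
    and "snd (effect keep_better s) = snd s"
proof -
  let ?f = "\<lambda>q. marginal_cost K H i (real q * \<Delta>)"
  obtain b where b: "b \<in> A" "fst s 20 = real b" "fst s 21 = ?f b" "?f b = Min (?f ` A)" and fin: "finite A"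
    using assms(7) unfolding best_in_def by blast
  have "Min (?f ` insert a A) = Min (insert (?f a) (?f ` A))" by simp
  also have "\<dots> = min (?f a) (Min (?f ` A))" using b(1) fin by (intro Min_insert) auto
  finally have M: "Min (?f ` insert a A) = min (?f a) (?f b)" unfolding b(4) .
  have c: "aval (cost_at 22) s = ?f a" by (rule aval_cost_at[OF assms(1-6)])
  show "best_in ?f (insert a A) (effect keep_better s)"
  proof (cases "?f a < ?f b")
    case True
    then show ?thesis unfolding best_in_def M using b(2,3) fin assms(6)
      by (auto simp: keep_better_def c intro!: bexI[of _ a])
  next
    case False
    then show ?thesis unfolding best_in_def M using b(1,2,3) fin
      by (auto simp: keep_better_def c intro!: bexI[of _ b])
  qed
qed (simp_all add: keep_better_def)

definition menu_init :: com where
  "menu_init =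
    (SetReg 19 (Div (tau 18) (Mul (Reg 16) (Reg 2))) ;;
     IfLess (Reg 19) (Const 1) (SetReg 19 (Const 1)) Skip ;;
     SetReg 19 (Floor (Reg 19)) ;;
     SetReg 20 (Mul (Reg 19) (Reg 16)) ;;
     SetReg 21 (cost_at 20) ;;
     SetReg 22 (Mul (Add (Reg 19) (Const 1)) (Reg 16)) ;;
     SetReg 24 (Reg 14) ;;
     SetReg 25 (Const 0)) ;;
    keep_better"

definition menu_step :: com where
  "menu_step =
    SetReg 22 (Add (Reg 25) (Const 1)) ;;
    IfLess (Const 0) (bit_of 24) keep_better Skip ;;
    SetReg 24 (Floor (Div (Reg 24) (Const 2))) ;;
    SetReg 25 (Add (Reg 25) (Const 1))"

definition menu_prog :: com where
  "menu_prog = menu_init ;; WhileLess (Reg 25) (Reg 4) menu_step"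

lemma max_steps_keep_better [simp]: "max_steps keep_better = 23"
  by (simp add: keep_better_def)

lemma straight_line_keep_better [simp]: "straight_line keep_better"
  by (simp add: keep_better_def)

lemma real_best_mult:
  "real (best_mult K H i B) = of_int \<lfloor>if sqrt (K i / H i) / B < 1 then 1 else sqrt (K i / H i) / B\<rfloor>"
  unfolding best_mult_def by (auto simp: max_def)

lemma runs_menu:
  assumes s0: "params n \<Delta> r L s0" "holds_instance n K H s0" "fst s0 14 = real M" "fst s0 16 = real m"
    "fst s0 18 = real i" and i: "i \<in> {1..n}"
  shows "runs menu_prog s0 (60 * (L + 1) + 110) (\<lambda>s. agree 19 s0 s \<and> snd s = snd s0
    \<and> best_in (\<lambda>q. marginal_cost K H i (real q * \<Delta>)) (menu K H \<Delta> (mask_set L M) m i) s)"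
proof -
  let ?A = "\<lambda>e. Suc ` {e'. e' < e \<and> odd (M div 2 ^ e')}"
  let ?k = "best_mult K H i (real m * \<Delta>)"
  let ?f = "\<lambda>q. marginal_cost K H i (real q * \<Delta>)"
  define I where "I e s \<longleftrightarrow> agree 19 s0 s \<and> snd s = snd s0 \<and> fst s 25 = real e
    \<and> fst s 24 = real (M div 2 ^ e) \<and> best_in ?f ({?k * m, (?k + 1) * m} \<union> ?A e) s" for e s
  have env: "holds_instance n K H s \<and> fst s 0 = real n \<and> fst s 2 = \<Delta> \<and> fst s 18 = real i \<and> fst s 4 = real L
      \<and> fst s 16 = real m"
    if "agree 19 s0 s" "snd s = snd s0" for s
    using that s0 by (auto simp: agree_def holds_instance_def params_def)
  have init: "I 0 (effect menu_init s0)"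
  proof -
    have t: "aval (tau 18) s0 = sqrt (K i / H i)" using s0 i by (intro aval_tau[of n]) (auto simp: params_def)
    define u where "u = effect (SetReg 19 (Div (tau 18) (Mul (Reg 16) (Reg 2))) ;;
       IfLess (Reg 19) (Const 1) (SetReg 19 (Const 1)) Skip ;;
       SetReg 19 (Floor (Reg 19)) ;; SetReg 20 (Mul (Reg 19) (Reg 16))) s0"
    have u: "fst u 19 = real ?k" "fst u 20 = real (?k * m)" "agree 19 s0 u" "snd u = snd s0"
      using s0 t by (auto simp: u_def real_best_mult agree_def params_def)
    note eu = env[OF u(3,4)]
    have c: "aval (cost_at 20) u = ?f (?k * m)"
      using eu u(2) i by (intro aval_cost_at[of n]) auto
    define w where "w = effect (SetReg 21 (cost_at 20) ;;
       SetReg 22 (Mul (Add (Reg 19) (Const 1)) (Reg 16)) ;;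
       SetReg 24 (Reg 14) ;; SetReg 25 (Const 0)) u"
    have w: "agree 19 s0 w" "snd w = snd s0" "fst w 22 = real ((?k + 1) * m)" "fst w 24 = real M" "fst w 25 = 0"
      "fst w 20 = real (?k * m)" "fst w 21 = ?f (?k * m)"
      using u eu c s0 by (auto simp: w_def agree_def distrib_right)
    have "best_in ?f {?k * m} w" unfolding best_in_def using w(6,7) by auto
    moreover note ew = env[OF w(1,2)]
    ultimately have b: "best_in ?f (insert ((?k + 1) * m) {?k * m}) (effect keep_better w)"
      using w(3) i by (intro effect_keep_better(1)[of n]) auto
    have "effect menu_init s0 = effect keep_better w"
      by (simp add: menu_init_def w_def u_def)
    moreover have "agree 19 s0 (effect keep_better w)" "snd (effect keep_better w) = snd s0"
      "fst (effect keep_better w) 24 = real M" "fst (effect keep_better w) 25 = 0"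
      using w by (simp_all add: agree_def keep_better_def)
    moreover have "{?k * m, (?k + 1) * m} \<union> ?A 0 = insert ((?k + 1) * m) {?k * m}" by auto
    ultimately show ?thesis using b unfolding I_def by simp
  qed
  from init have "runs (WhileLess (Reg 25) (Reg 4) menu_step) (effect menu_init s0)
    ((L + 1) * (55 + acost (Reg 25) + acost (Reg 4) + 1)) (I L)"
  proof (rule runs_While)
    fix e s assume e: "e < L" and I: "I e s"
    have s: "agree 19 s0 s" "snd s = snd s0" "fst s 24 = real (M div 2 ^ e)" "fst s 25 = real e"
      using I by (auto simp: I_def)
    have half: "real_of_int \<lfloor>real (M div 2 ^ e) / 2\<rfloor> = real (M div 2 ^ Suc e)"
      by (simp only: of_int_floor_half div_power2_Suc)
    define u where "u = effect (SetReg 22 (Add (Reg 25) (Const 1))) s"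
    have u: "agree 19 s0 u" "snd u = snd s0" "fst u 22 = real (Suc e)" "fst u 24 = real (M div 2 ^ e)"
      "fst u 25 = real e"
      using s by (auto simp: u_def agree_def)
    have bu: "best_in ?f ({?k * m, (?k + 1) * m} \<union> ?A e) u"
      by (rule best_in_cong[of _ _ s]) (use I in \<open>simp_all add: I_def u_def\<close>)
    note eu = env[OF u(1,2)]
    have bit: "aval (bit_of 24) u = real (M div 2 ^ e mod 2)" by (rule aval_bit_of[OF u(4)])
    define v where "v = effect (IfLess (Const 0) (bit_of 24) keep_better Skip) u"
    have v: "agree 19 s0 v \<and> snd v = snd s0 \<and> fst v 24 = real (M div 2 ^ e) \<and> fst v 25 = real e
      \<and> best_in ?f ({?k * m, (?k + 1) * m} \<union> ?A (Suc e)) v"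
    proof (cases "odd (M div 2 ^ e)")
      case False
      then have "v = u" using bit by (simp add: v_def)
      moreover have "?A (Suc e) = ?A e" using mask_set_Suc[of e M] False by simp
      ultimately show ?thesis using u bu by simp
    next
      case True
      then have v: "v = effect keep_better u" using bit by (simp add: v_def odd_iff_mod_2_eq_one)
      have A: "?A (Suc e) = insert (Suc e) (?A e)" using mask_set_Suc[of e M] True by simp
      have "best_in ?f (insert (Suc e) ({?k * m, (?k + 1) * m} \<union> ?A e)) v"
        unfolding v using eu u(3) bu i by (intro effect_keep_better(1)[of n]) auto
      moreover have "agree 19 s0 v" "snd v = snd s0" "fst v 24 = fst u 24" "fst v 25 = fst u 25"
        using u(1,2) unfolding v by (simp_all add: keep_better_def agree_def)
      ultimately show ?thesis using u(4,5) unfolding A by (simp only: Un_insert_right simp_thms)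
    qed
    have "effect menu_step s = effect (SetReg 24 (Floor (Div (Reg 24) (Const 2))) ;;
        SetReg 25 (Add (Reg 25) (Const 1))) v"
      by (simp only: menu_step_def v_def u_def effect.simps(4))
    then have "effect menu_step s = ((fst v)(24 := real (M div 2 ^ Suc e), 25 := real (Suc e)), snd v)"
      using v half by (simp add: add.commute)
    moreover have "best_in ?f ({?k * m, (?k + 1) * m} \<union> ?A (Suc e)) (effect menu_step s)"
      by (rule best_in_cong[of _ _ v]) (use v calculation in simp_all)
    ultimately have "I (Suc e) (effect menu_step s)" using v unfolding I_def by (simp add: agree_def)
    then show "aval (Reg 25) s < aval (Reg 4) s \<and> runs menu_step s 55 (I (Suc e))"
      using env[OF s(1,2)] s e by (auto intro!: runs_straight simp: menu_step_def)
  next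
    fix s assume "I L s"
    then show "\<not> aval (Reg 25) s < aval (Reg 4) s" using env[of s] by (simp add: I_def)
  qed
  then have "runs menu_prog s0 (60 * (L + 1) + 110) (I L)"
    unfolding menu_prog_def by (rule runs_straight_Seq[rotated]) (simp_all add: menu_init_def)
  then show ?thesis
    by (rule runs_mono) (auto simp: I_def mask_set_def menu_def Let_def)
qed

text \<open>The intervals go to the cells after \<open>2 * n\<close>, so the instance survives for
  the candidates that follow.\<close>

definition store_prog :: com where
  "store_prog =
    SetMem (Add (Add (Reg 0) (Reg 0)) (Reg 18)) (Mul (Reg 20) (Reg 2)) ;;
    SetReg 17 (Add (Reg 17) (Reg 21)) ;;
    SetReg 18 (Add (Reg 18) (Const 1))"

definition policy_prog :: com where
  "policy_prog = SetReg 18 (Const 1) ;;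
    WhileLess (Reg 18) (Add (Reg 0) (Const 1)) (menu_prog ;; store_prog)"

definition stores_menu_policy ::
  "nat \<Rightarrow> nat \<Rightarrow> (nat \<Rightarrow> real) \<Rightarrow> (nat \<Rightarrow> real) \<Rightarrow> real \<Rightarrow> nat set \<Rightarrow> nat \<Rightarrow> state \<Rightarrow> bool" where
  "stores_menu_policy n j K H \<Delta> S m s \<longleftrightarrow> (\<forall>i\<in>{1..j}. \<exists>q\<in>menu K H \<Delta> S m i. snd s (2 * n + i) = real q * \<Delta>
     \<and> marginal_cost K H i (real q * \<Delta>) = menu_cost K H \<Delta> S m i)"

lemma runs_policy:
  assumes s0: "params n \<Delta> r L s0" "holds_instance n K H s0" "fst s0 14 = real M" "fst s0 16 = real m"
  shows "runs policy_prog s0 ((n + 1) * (60 * (L + 1) + 140) + 10) (\<lambda>s. agree 17 s0 s \<and> (\<forall>j\<le>2 * n. snd s j = snd s0 j)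
    \<and> fst s 17 = fst s0 17 + (\<Sum>i\<in>{1..n}. menu_cost K H \<Delta> (mask_set L M) m i)
    \<and> stores_menu_policy n n K H \<Delta> (mask_set L M) m s)"
proof -
  let ?S = "mask_set L M"
  define I where "I k s \<longleftrightarrow> agree 17 s0 s \<and> (\<forall>j\<le>2 * n. snd s j = snd s0 j) \<and> fst s 18 = real (Suc k)
    \<and> fst s 17 = fst s0 17 + (\<Sum>i\<in>{1..k}. menu_cost K H \<Delta> ?S m i)
    \<and> stores_menu_policy n k K H \<Delta> ?S m s" for k s
  let ?s = "effect (SetReg 18 (Const 1)) s0"
  have "I 0 ?s" by (simp add: I_def agree_def stores_menu_policy_def)
  then have "runs (WhileLess (Reg 18) (Add (Reg 0) (Const 1)) (menu_prog ;; store_prog)) ?s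
    ((n + 1) * ((60 * (L + 1) + 130) + acost (Reg 18) + acost (Add (Reg 0) (Const 1)) + 1)) (I n)"
  proof (rule runs_While)
    fix k s assume k: "k < n" and I: "I k s"
    have s: "params n \<Delta> r L s" "holds_instance n K H s" "fst s 14 = real M" "fst s 16 = real m" "fst s 18 = real (Suc k)"
      using I s0 by (auto simp: I_def agree_def params_def holds_instance_def)
    have "runs (menu_prog ;; store_prog) s (60 * (L + 1) + 130) (I (Suc k))"
    proof (rule runs_Seq[OF runs_menu[OF s]])
      fix s' assume *: "agree 19 s s' \<and> snd s' = snd s
        \<and> best_in (\<lambda>q. marginal_cost K H (Suc k) (real q * \<Delta>)) (menu K H \<Delta> ?S m (Suc k)) s'"
      then obtain q where q: "q \<in> menu K H \<Delta> ?S m (Suc k)" "fst s' 20 = real q"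
        "fst s' 21 = marginal_cost K H (Suc k) (real q * \<Delta>)"
        "marginal_cost K H (Suc k) (real q * \<Delta>) = menu_cost K H \<Delta> ?S m (Suc k)"
        unfolding best_in_def menu_cost_def by blast
      have s': "fst s' 0 = real n" "fst s' 2 = \<Delta>" "fst s' 18 = real (Suc k)" "fst s' 17 = fst s 17" "snd s' = snd s"
        "agree 17 s0 s'"
        using * s I by (auto simp: agree_def params_def I_def)
      have a: "nat \<lfloor>real n + real n + real (Suc k)\<rfloor> = 2 * n + Suc k"
        using nat_floor_add[of "n + n" "Suc k"] by simp
      have st: "stores_menu_policy n (Suc k) K H \<Delta> ?S m (f, (snd s)(2 * n + Suc k := real q * \<Delta>))" for f
        unfolding stores_menu_policy_def
      proof
        fix i assume "i \<in> {1..Suc k}"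
        then consider "i = Suc k" | "i \<in> {1..k}" by fastforce
        then show "\<exists>q'\<in>menu K H \<Delta> ?S m i. snd (f, (snd s)(2 * n + Suc k := real q * \<Delta>)) (2 * n + i) = real q' * \<Delta>
          \<and> marginal_cost K H i (real q' * \<Delta>) = menu_cost K H \<Delta> ?S m i"
        proof cases
          case 1
          then show ?thesis using q by (intro bexI[of _ q]) auto
        next
          case 2
          then show ?thesis using I unfolding I_def stores_menu_policy_def by auto
        qed
      qed
      show "runs store_prog s' 20 (I (Suc k))"
      proof (rule runs_straight)
        have "effect store_prog s' = ((fst s')(17 := fst s 17 + menu_cost K H \<Delta> ?S m (Suc k), 18 := real (Suc (Suc k))),
          (snd s)(2 * n + Suc k := real q * \<Delta>))"
          using a s' q by (simp add: store_prog_def)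
        then show "I (Suc k) (effect store_prog s')"
          using I s' st unfolding I_def by (auto simp: agree_def)
      qed (simp_all add: store_prog_def)
    qed (use k in auto)
    then show "aval (Reg 18) s < aval (Add (Reg 0) (Const 1)) s \<and> runs (menu_prog ;; store_prog) s (60 * (L + 1) + 130) (I (Suc k))"
      using s k by (auto simp: params_def)
  next
    fix s assume "I n s"
    then show "\<not> aval (Reg 18) s < aval (Add (Reg 0) (Const 1)) s"
      using s0 by (simp add: I_def agree_def params_def)
  qed
  then have "runs policy_prog s0 ((n + 1) * (60 * (L + 1) + 140) + 10) (I n)"
    unfolding policy_prog_def by (rule runs_straight_Seq[rotated]) (simp_all add: algebra_simps)
  then show ?thesis by (rule runs_mono) (auto simp: I_def)
qed

section \<open>Evaluation of one candidate and search over all\<close>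

definition eval_prog :: com where
  "eval_prog = decode_prog ;; prefix_prog ;; select_prog ;; count_prog ;; policy_prog"

definition eval_time :: "nat \<Rightarrow> nat \<Rightarrow> nat \<Rightarrow> nat" where
  "eval_time n L W = (W + 1) * (50 * (L + 1) + 30) + (n + 1) * (60 * (L + 1) + 200) + 200"

definition candidate_set :: "nat \<Rightarrow> nat \<Rightarrow> nat \<Rightarrow> nat \<Rightarrow> nat set" where
  "candidate_set n r L c = mask_set L (mask_of n r c)"

definition candidate_mult ::
  "nat \<Rightarrow> (nat \<Rightarrow> real) \<Rightarrow> (nat \<Rightarrow> real) \<Rightarrow> real \<Rightarrow> nat \<Rightarrow> nat \<Rightarrow> nat" where
  "candidate_mult n K H \<Delta> r c =
    base_mult r \<Delta> (candidate_base n K H \<Delta> r (kind_of c) (index_of n c)) (scale_of n r c)"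

definition candidate_estimate ::
  "nat \<Rightarrow> (nat \<Rightarrow> real) \<Rightarrow> (nat \<Rightarrow> real) \<Rightarrow> real \<Rightarrow> nat \<Rightarrow> nat \<Rightarrow> nat \<Rightarrow> nat \<Rightarrow> real" where
  "candidate_estimate n K H \<Delta> r L W c =
    estimate n K H \<Delta> W (candidate_set n r L c) (candidate_mult n K H \<Delta> r c)"

lemma params_agree: "params n \<Delta> r L s \<Longrightarrow> agree b s s' \<Longrightarrow> 8 \<le> b \<Longrightarrow> params n \<Delta> r L s'"
  by (simp add: params_def agree_def)

lemma holds_instance_cong:
  "holds_instance n K H s \<Longrightarrow> (\<And>j. j \<le> 2 * n \<Longrightarrow> snd s' j = snd s j) \<Longrightarrow> holds_instance n K H s'"
  by (simp add: holds_instance_def)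

lemma runs_eval:
  assumes s0: "params n \<Delta> r L s0" "holds_instance n K H s0" "fst s0 10 = real c"
    and W: "W = 2 * r * L * 2 ^ L" and n: "n \<ge> 1"
  shows "runs eval_prog s0 (eval_time n L W) (\<lambda>s. agree 11 s0 s \<and> (\<forall>j\<le>2 * n. snd s j = snd s0 j)
    \<and> fst s 17 = candidate_estimate n K H \<Delta> r L W c
    \<and> stores_menu_policy n n K H \<Delta> (candidate_set n r L c) (candidate_mult n K H \<Delta> r c) s)"
proof -
  let ?m = "candidate_mult n K H \<Delta> r c" and ?M = "mask_of n r c" and ?j = "index_of n c"
  have j: "?j \<in> {1..n}" using n by (simp add: index_of_def Suc_le_eq)
  have r0: "fst s0 0 = real n" "fst s0 3 = real r" using s0(1) by (auto simp: params_def)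
  show ?thesis unfolding eval_prog_def
  proof (rule runs_Seq[OF runs_decode[OF r0 s0(3)]])
    fix s1 assume 1: "agree 11 s0 s1 \<and> snd s1 = snd s0 \<and> fst s1 11 = real (kind_of c)
      \<and> fst s1 12 = real ?j \<and> fst s1 13 = real (scale_of n r c) \<and> fst s1 14 = real ?M"
    then have p1: "params n \<Delta> r L s1" "holds_instance n K H s1" "fst s1 12 = real ?j"
      using params_agree[OF s0(1), of 11 s1] holds_instance_cong[OF s0(2)] by auto
    show "runs (prefix_prog ;; select_prog ;; count_prog ;; policy_prog) s1 (eval_time n L W - 60)
      (\<lambda>s. agree 11 s0 s \<and> (\<forall>j\<le>2 * n. snd s j = snd s0 j)
      \<and> fst s 17 = candidate_estimate n K H \<Delta> r L W c
      \<and> stores_menu_policy n n K H \<Delta> (candidate_set n r L c) ?m s)"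
    proof (rule runs_Seq[OF runs_prefix[OF p1 j]])
      fix s2 assume 2: "agree 18 s1 s2 \<and> snd s2 = snd s1 \<and> sqrt (fst s2 19 / fst s2 20) = prefix_optimum n K H ?j"
      then have p2: "params n \<Delta> r L s2" "holds_instance n K H s2" "fst s2 11 = real (kind_of c)"
        "fst s2 12 = real ?j" "fst s2 13 = real (scale_of n r c)" "fst s2 14 = real ?M"
        using p1 1 params_agree[of n \<Delta> r L s1 18 s2] holds_instance_cong[OF p1(2)] by (auto simp: agree_def)
      show "runs (select_prog ;; count_prog ;; policy_prog) s2 ((W + 1) * (50 * (L + 1) + 30) + (n + 1) * (60 * (L + 1) + 140) + 120)
        (\<lambda>s. agree 11 s0 s \<and> (\<forall>j\<le>2 * n. snd s j = snd s0 j)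
        \<and> fst s 17 = candidate_estimate n K H \<Delta> r L W c
        \<and> stores_menu_policy n n K H \<Delta> (candidate_set n r L c) ?m s)"
      proof (rule runs_Seq[OF runs_select[OF p2(1-4) j p2(5)]])
        show "sqrt (fst s2 19 / fst s2 20) = prefix_optimum n K H ?j" using 2 by simp
        fix s3 assume "agree 15 s2 s3 \<and> snd s3 = snd s2
          \<and> fst s3 16 = real (base_mult r \<Delta> (candidate_base n K H \<Delta> r (kind_of c) ?j) (scale_of n r c))"
        then have 3: "agree 15 s2 s3" "snd s3 = snd s2" "fst s3 16 = real ?m"
          by (auto simp: candidate_mult_def)
        have p3: "params n \<Delta> r L s3" "holds_instance n K H s3" "fst s3 14 = real ?M"
          using p2 3 params_agree[of n \<Delta> r L s2 15 s3] holds_instance_cong[OF p2(2)] by (auto simp: agree_def)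
        show "runs (count_prog ;; policy_prog) s3 ((W + 1) * (50 * (L + 1) + 30) + (n + 1) * (60 * (L + 1) + 140) + 40)
          (\<lambda>s. agree 11 s0 s \<and> (\<forall>j\<le>2 * n. snd s j = snd s0 j)
          \<and> fst s 17 = candidate_estimate n K H \<Delta> r L W c
          \<and> stores_menu_policy n n K H \<Delta> (candidate_set n r L c) ?m s)"
        proof (rule runs_Seq[OF runs_count[OF p3 3(3) W]])
          fix s4 assume 4: "agree 17 s3 s4 \<and> snd s4 = snd s3
            \<and> fst s4 17 = K 0 * (real (mult_count (mask_set L ?M) W) / (real W * \<Delta>) + 1 / (real ?m * \<Delta>))"
          then have p4: "params n \<Delta> r L s4" "holds_instance n K H s4" "fst s4 14 = real ?M" "fst s4 16 = real ?m"
            using p3 3 params_agree[of n \<Delta> r L s3 17 s4] holds_instance_cong[OF p3(2)] by (auto simp: agree_def)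
          have a: "agree 11 s0 s4" using 1 2 3 4 by (auto simp: agree_def)
          have m: "snd s4 = snd s0" using 1 2 3 4 by simp
          show "runs policy_prog s4 ((n + 1) * (60 * (L + 1) + 140) + 10)
            (\<lambda>s. agree 11 s0 s \<and> (\<forall>j\<le>2 * n. snd s j = snd s0 j)
            \<and> fst s 17 = candidate_estimate n K H \<Delta> r L W c
            \<and> stores_menu_policy n n K H \<Delta> (candidate_set n r L c) ?m s)"
            by (rule runs_mono[OF runs_policy[OF p4] order_refl])
              (use a m 4 in \<open>auto simp: agree_def candidate_estimate_def estimate_def candidate_set_def\<close>)
        qed simp
      qed simp
    qed (simp add: eval_time_def algebra_simps)
  qed (simp add: eval_time_def)
qed

definition search_step :: com where
  "search_step = eval_prog ;;
    IfLess (Reg 17) (Reg 8) (SetReg 8 (Reg 17) ;; SetReg 9 (Reg 10)) Skip ;;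
    SetReg 10 (Add (Reg 10) (Const 1))"

text \<open>Candidate 0 is evaluated before the loop to give register 8 a first value, as there is
  no infinity to start from; the loop then begins with candidate 0 again.\<close>

definition search_prog :: com where
  "search_prog = SetReg 10 (Const 0) ;; eval_prog ;;
    (SetReg 8 (Reg 17) ;; SetReg 9 (Const 0) ;; SetReg 10 (Const 0)) ;;
    WhileLess (Reg 10) (Reg 7) search_step"

lemma runs_search:
  assumes s0: "params n \<Delta> r L s0" "holds_instance n K H s0"
    and W: "W = 2 * r * L * 2 ^ L" and n: "n \<ge> 1" and N: "N = 3 * n * r\<^sup>2 * 2 ^ L" "N > 0"
  shows "runs search_prog s0 ((N + 2) * (eval_time n L W + 20) + 10) (\<lambda>s. params n \<Delta> r L s \<and> holds_instance n K H s
    \<and> (\<exists>b<N. fst s 9 = real b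
      \<and> (\<forall>c<N. candidate_estimate n K H \<Delta> r L W b \<le> candidate_estimate n K H \<Delta> r L W c)))"
proof -
  let ?e = "candidate_estimate n K H \<Delta> r L W"
  define I where "I k s \<longleftrightarrow> params n \<Delta> r L s \<and> holds_instance n K H s \<and> fst s 10 = real k
    \<and> (\<exists>b<N. fst s 9 = real b \<and> fst s 8 = ?e b \<and> (\<forall>c<k. ?e b \<le> ?e c))" for k and s :: state
  have loop: "runs (WhileLess (Reg 10) (Reg 7) search_step) s
    ((N + 1) * ((eval_time n L W + 15) + acost (Reg 10) + acost (Reg 7) + 1)) (I N)" if "I 0 s" for s
    using that
  proof (rule runs_While)
    fix k s assume k: "k < N" and I: "I k s"
    then have s: "params n \<Delta> r L s" "holds_instance n K H s" "fst s 10 = real k" by (auto simp: I_def)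
    obtain b where b: "b < N" "fst s 9 = real b" "fst s 8 = ?e b" "\<forall>c<k. ?e b \<le> ?e c"
      using I by (auto simp: I_def)
    have "runs search_step s (eval_time n L W + 15) (I (Suc k))"
      unfolding search_step_def
    proof (rule runs_Seq[OF runs_eval[OF s W n]])
      fix s' assume *: "agree 11 s s' \<and> (\<forall>j\<le>2 * n. snd s' j = snd s j) \<and> fst s' 17 = ?e k
        \<and> stores_menu_policy n n K H \<Delta> (candidate_set n r L k) (candidate_mult n K H \<Delta> r k) s'"
      let ?p = "IfLess (Reg 17) (Reg 8) (SetReg 8 (Reg 17) ;; SetReg 9 (Reg 10)) Skip ;;
        SetReg 10 (Add (Reg 10) (Const 1))"
      have r: "fst s' 8 = ?e b" "fst s' 9 = real b" "fst s' 10 = real k" "fst s' 17 = ?e k"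
        using * s b by (auto simp: agree_def)
      have "agree 8 s (effect ?p s')" "snd (effect ?p s') = snd s'" using * by (auto simp: agree_def)
      then have p: "params n \<Delta> r L (effect ?p s')" "holds_instance n K H (effect ?p s')"
        using params_agree[OF s(1), of 8] holds_instance_cong[OF s(2)] * by auto
      define b' where "b' = (if ?e k < ?e b then k else b)"
      have b': "b' < N" "\<forall>c<Suc k. ?e b' \<le> ?e c"
        using b k by (auto simp: b'_def less_Suc_eq intro: order_trans less_imp_le)
      have "fst (effect ?p s') 9 = real b'" "fst (effect ?p s') 8 = ?e b'" "fst (effect ?p s') 10 = real (Suc k)"
        using r by (auto simp: b'_def)
      then have "I (Suc k) (effect ?p s')" using p b' unfolding I_def by blast
      then show "runs ?p s' 15 (I (Suc k))" by (intro runs_straight) simp_all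
    qed simp
    moreover have "fst s 7 = real N" using s(1) N(1) by (simp add: params_def)
    ultimately show "aval (Reg 10) s < aval (Reg 7) s \<and> runs search_step s (eval_time n L W + 15) (I (Suc k))"
      using s k by simp
  next
    fix s assume "I N s"
    then show "\<not> aval (Reg 10) s < aval (Reg 7) s" using N(1) by (simp add: I_def params_def)
  qed
  let ?s = "effect (SetReg 10 (Const 0)) s0"
  have s: "params n \<Delta> r L ?s" "holds_instance n K H ?s" "fst ?s 10 = real 0"
    using s0 by (auto simp: params_def holds_instance_def)
  let ?q = "(SetReg 8 (Reg 17) ;; SetReg 9 (Const 0) ;; SetReg 10 (Const 0)) ;;
    WhileLess (Reg 10) (Reg 7) search_step"
  have "runs (eval_prog ;; ?q) ?s ((N + 2) * (eval_time n L W + 20)) (I N)"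
  proof (rule runs_Seq[OF runs_eval[OF s W n]])
    fix s' assume *: "agree 11 ?s s' \<and> (\<forall>j\<le>2 * n. snd s' j = snd ?s j) \<and> fst s' 17 = ?e 0
      \<and> stores_menu_policy n n K H \<Delta> (candidate_set n r L 0) (candidate_mult n K H \<Delta> r 0) s'"
    let ?u = "effect (SetReg 8 (Reg 17) ;; SetReg 9 (Const 0) ;; SetReg 10 (Const 0)) s'"
    have "agree 8 ?s ?u" "snd ?u = snd s'" using * by (auto simp: agree_def)
    then have "params n \<Delta> r L ?u" "holds_instance n K H ?u"
      using params_agree[OF s(1), of 8] holds_instance_cong[OF s(2)] * by auto
    then have "I 0 ?u" using N(2) * unfolding I_def by simp
    from loop[OF this] show "runs ?q s' ((N + 1) * (eval_time n L W + 20) + 10) (I N)"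
      by (rule runs_straight_Seq[rotated]) (simp_all add: algebra_simps)
  qed (simp add: algebra_simps)
  then have "runs search_prog s0 ((N + 2) * (eval_time n L W + 20) + 10) (I N)"
    unfolding search_prog_def by (rule runs_straight_Seq[rotated]) simp_all
  then show ?thesis by (rule runs_mono) (auto simp: I_def)
qed

text \<open>Copying into the cells \<open>1, ..., n\<close> destroys the ordering costs, so it is
  postponed to the end.\<close>

definition output_prog :: com where
  "output_prog = SetReg 18 (Const 1) ;;
    WhileLess (Reg 18) (Add (Reg 0) (Const 1))
      (SetMem (Reg 18) (Mem (Add (Add (Reg 0) (Reg 0)) (Reg 18))) ;;
       SetReg 18 (Add (Reg 18) (Const 1)))"

lemma runs_output:
  assumes "fst s0 0 = real n"
  shows "runs output_prog s0 (30 * (n + 1) + 10) (\<lambda>s. \<forall>i\<in>{1..n}. snd s i = snd s0 (2 * n + i))"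
proof -
  define I where "I k s \<longleftrightarrow> fst s 0 = real n \<and> fst s 18 = real (Suc k) \<and>
    (\<forall>i\<in>{1..k}. snd s i = snd s0 (2 * n + i)) \<and> (\<forall>i\<in>{1..n}. snd s (2 * n + i) = snd s0 (2 * n + i))"
    for k and s :: state
  let ?p = "SetMem (Reg 18) (Mem (Add (Add (Reg 0) (Reg 0)) (Reg 18))) ;; SetReg 18 (Add (Reg 18) (Const 1))"
  have "I 0 (effect (SetReg 18 (Const 1)) s0)" using assms by (simp add: I_def)
  then have "runs (WhileLess (Reg 18) (Add (Reg 0) (Const 1)) ?p) (effect (SetReg 18 (Const 1)) s0)
    ((n + 1) * (20 + acost (Reg 18) + acost (Add (Reg 0) (Const 1)) + 1)) (I n)"
  proof (rule runs_While)
    fix k s assume k: "k < n" and I: "I k s"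
    have s: "fst s 0 = real n" "fst s 18 = real (Suc k)" using I by (auto simp: I_def)
    have a: "nat \<lfloor>real n + real n + real (Suc k)\<rfloor> = 2 * n + Suc k"
      using nat_floor_add[of "n + n" "Suc k"] by simp
    have "\<forall>i\<in>{1..n}. snd s (2 * n + i) = snd s0 (2 * n + i)" using I by (simp add: I_def)
    then have "snd s (2 * n + Suc k) = snd s0 (2 * n + Suc k)" by (rule bspec) (use k in auto)
    then have "effect ?p s = ((fst s)(18 := real (Suc (Suc k))), (snd s)(Suc k := snd s0 (2 * n + Suc k)))"
      using s a nat_int[of "Suc k"] by simp
    moreover have "\<forall>i\<in>{1..Suc k}. ((snd s)(Suc k := snd s0 (2 * n + Suc k))) i = snd s0 (2 * n + i)"
      using I by (auto simp: I_def le_Suc_eq)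
    moreover have "\<forall>i\<in>{1..n}. ((snd s)(Suc k := snd s0 (2 * n + Suc k))) (2 * n + i) = snd s0 (2 * n + i)"
      using I k by (auto simp: I_def)
    ultimately have "I (Suc k) (effect ?p s)" using s(1) unfolding I_def by simp
    then show "aval (Reg 18) s < aval (Add (Reg 0) (Const 1)) s \<and> runs ?p s 20 (I (Suc k))"
      using s k by (auto intro!: runs_straight)
  qed (simp add: I_def)
  then have "runs output_prog s0 (30 * (n + 1) + 10) (I n)"
    unfolding output_prog_def by (rule runs_straight_Seq[rotated]) simp_all
  then show ?thesis by (rule runs_mono) (auto simp: I_def)
qed

text \<open>The search keeps only the number of the best candidate, while the intervals in memory
  belong to the last one evaluated; so the winner is evaluated once more.\<close>

definition jrp_prog :: com where
  "jrp_prog = (init_params ;; double_loop ;; init_counts) ;; search_prog ;;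
    SetReg 10 (Reg 9) ;; eval_prog ;; output_prog"

lemma runs_jrp:
  assumes inst: "jrp_instance n K H"
    and r: "\<epsilon> > 0" "r = nat \<lfloor>11 / \<epsilon>\<rfloor> + 7" "L = 8 * r\<^sup>2"
    and W: "W = 2 * r * L * 2 ^ L" and N: "N = 3 * n * r\<^sup>2 * 2 ^ L"
  shows "runs jrp_prog (input_state \<epsilon> n K H \<Delta>) ((N + 3) * (eval_time n L W + 20) + 20 * (L + 10) + 30 * (n + 1) + 30)
    (\<lambda>s. \<exists>b<N. (\<forall>c<N. candidate_estimate n K H \<Delta> r L W b \<le> candidate_estimate n K H \<Delta> r L W c)
      \<and> (\<forall>i\<in>{1..n}. \<exists>q\<in>menu K H \<Delta> (candidate_set n r L b) (candidate_mult n K H \<Delta> r b) i. snd s i = real q * \<Delta>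
        \<and> marginal_cost K H i (real q * \<Delta>) = menu_cost K H \<Delta> (candidate_set n r L b) (candidate_mult n K H \<Delta> r b) i))"
    (is "runs _ _ _ ?Q")
proof -
  have n: "n \<ge> 1" using inst by (simp add: jrp_instance_def)
  have N0: "N > 0" using n r(2) N by simp
  show ?thesis unfolding jrp_prog_def
  proof (rule runs_Seq[OF runs_init[OF r]])
    fix s1 assume 1: "snd s1 = snd (input_state \<epsilon> n K H \<Delta>) \<and> params n \<Delta> r L s1"
    then have p: "params n \<Delta> r L s1" "holds_instance n K H s1"
      by (auto simp: holds_instance_def input_state_def)
    show "runs (search_prog ;; SetReg 10 (Reg 9) ;; eval_prog ;; output_prog) s1
      ((N + 3) * (eval_time n L W + 20) + 30 * (n + 1) + 30) ?Q"
    proof (rule runs_Seq[OF runs_search[OF p W n N N0]])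
      fix s2 assume "params n \<Delta> r L s2 \<and> holds_instance n K H s2 \<and> (\<exists>b<N. fst s2 9 = real b
        \<and> (\<forall>c<N. candidate_estimate n K H \<Delta> r L W b \<le> candidate_estimate n K H \<Delta> r L W c))"
      then obtain b where s2: "params n \<Delta> r L s2" "holds_instance n K H s2"
        and b: "b < N" "fst s2 9 = real b" "\<forall>c<N. candidate_estimate n K H \<Delta> r L W b \<le> candidate_estimate n K H \<Delta> r L W c"
        by blast
      let ?u = "effect (SetReg 10 (Reg 9)) s2"
      have u: "params n \<Delta> r L ?u" "holds_instance n K H ?u" "fst ?u 10 = real b"
        using s2 b(2) by (auto simp: params_def holds_instance_def)
      have "runs (eval_prog ;; output_prog) ?u (eval_time n L W + 30 * (n + 1) + 10) ?Q"
      proof (rule runs_Seq[OF runs_eval[OF u W n]])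
        fix s3 assume 3: "agree 11 ?u s3 \<and> (\<forall>j\<le>2 * n. snd s3 j = snd ?u j)
          \<and> fst s3 17 = candidate_estimate n K H \<Delta> r L W b
          \<and> stores_menu_policy n n K H \<Delta> (candidate_set n r L b) (candidate_mult n K H \<Delta> r b) s3"
        then have "fst s3 0 = real n" using u(1) by (auto simp: agree_def params_def)
        from runs_output[OF this] show "runs output_prog s3 (30 * (n + 1) + 10) ?Q"
        proof (rule runs_mono[OF _ order_refl])
          fix s :: state assume "\<forall>i\<in>{1..n}. snd s i = snd s3 (2 * n + i)"
          then show "?Q s" using 3 b(1,3) unfolding stores_menu_policy_def by (intro exI[of _ b]) auto
        qed
      qed simp
      then show "runs (SetReg 10 (Reg 9) ;; eval_prog ;; output_prog) s2 (eval_time n L W + 30 * (n + 1) + 20) ?Q"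
        by (rule runs_straight_Seq[rotated]) simp_all
    qed (simp add: algebra_simps)
  qed simp
qed

section \<open>Completeness of the enumeration and the total running time\<close>

lemma candidate_exists:
  assumes "S \<subseteq> {1..L}" "base_candidate n K H \<Delta> r x" "1 \<le> l" "l \<le> r\<^sup>2" "n \<ge> 1"
  shows "\<exists>c<3 * n * r\<^sup>2 * 2 ^ L. candidate_set n r L c = S \<and> candidate_mult n K H \<Delta> r c = base_mult r \<Delta> x l"
proof -
  obtain M where M: "M < 2 ^ L" "mask_set L M = S" using mask_set_surj[OF assms(1)] by blast
  obtain v j where vj: "v < 3" "j \<in> {1..n}" "candidate_base n K H \<Delta> r v j = x"
  proof -
    from assms(2) consider "x = real r * \<Delta>" | j where "j \<in> {1..n}" "x = sqrt (K j / H j)"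
      | j where "j \<in> {1..n}" "x = prefix_optimum n K H j" unfolding base_candidate_def by blast
    then show thesis
    proof cases
      case 1
      then show ?thesis using that[of 0 1] assms(5) by (simp add: candidate_base_def)
    next
      case 2
      then show ?thesis using that[of 1 j] by (simp add: candidate_base_def)
    next
      case 3
      then show ?thesis using that[of 2 j] by (simp add: candidate_base_def)
    qed
  qed
  \<comment> \<open>The digits are assembled from the highest down, inverting
    \<open>decode_prog\<close>.\<close>
  define c2 where "c2 = r\<^sup>2 * M + (l - 1)"
  define j' where "j' = j - 1"
  define c1 where "c1 = n * c2 + j'"
  define c where "c = 3 * c1 + v"
  have l: "l - 1 < r\<^sup>2" using assms(3,4) by simp
  then have r: "r \<noteq> 0" by (cases r) auto
  have c2: "c2 div r\<^sup>2 = M" "c2 mod r\<^sup>2 = l - 1" "c2 < r\<^sup>2 * 2 ^ L"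
  proof -
    show "c2 div r\<^sup>2 = M" "c2 mod r\<^sup>2 = l - 1" unfolding c2_def using l r by simp_all
    have "c2 < r\<^sup>2 * (M + 1)" unfolding c2_def using l by simp
    also have "\<dots> \<le> r\<^sup>2 * 2 ^ L" using M(1) by (intro mult_le_mono) auto
    finally show "c2 < r\<^sup>2 * 2 ^ L" .
  qed
  have jn: "j' < n" "j' + 1 = j" using vj(2) unfolding j'_def by auto
  have c1: "c1 div n = c2" "c1 mod n = j'" "c1 < n * (r\<^sup>2 * 2 ^ L)"
  proof -
    show "c1 div n = c2" "c1 mod n = j'" unfolding c1_def using jn assms(5) by simp_all
    have "c1 < n * (c2 + 1)" unfolding c1_def using jn by simp
    also have "\<dots> \<le> n * (r\<^sup>2 * 2 ^ L)" using c2(3) by (intro mult_le_mono) auto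
    finally show "c1 < n * (r\<^sup>2 * 2 ^ L)" .
  qed
  have c: "c div 3 = c1" "c mod 3 = v" "c < 3 * n * r\<^sup>2 * 2 ^ L"
    unfolding c_def using vj(1) c1(3) by auto
  have "candidate_set n r L c = S"
    unfolding candidate_set_def mask_of_def c(1) c1(1) c2(1) by (rule M(2))
  moreover have "candidate_mult n K H \<Delta> r c = base_mult r \<Delta> x l"
    unfolding candidate_mult_def kind_of_def index_of_def scale_of_def c(1,2) c1(1,2) c2(2) jn(2) vj(3)
    using assms(3) by simp
  ultimately show ?thesis using c(3) by blast
qed

lemma eval_time_le:
  assumes "n \<ge> 1" "L \<ge> 1" "W \<ge> 1"
  shows "eval_time n L W + 20 \<le> 1200 * (n * W * L)"
proof -
  have 1: "1 \<le> n * W * L" using assms by (simp add: Suc_le_eq)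
  have "(W + 1) * (50 * (L + 1) + 30) \<le> (2 * W) * (130 * L)" using assms by (intro mult_le_mono) auto
  also have "\<dots> \<le> 260 * (n * W * L)" using assms(1) by (simp add: mult_ac)
  finally have 2: "(W + 1) * (50 * (L + 1) + 30) \<le> 260 * (n * W * L)" .
  have "(n + 1) * (60 * (L + 1) + 200) \<le> (2 * n) * (320 * L)" using assms by (intro mult_le_mono) auto
  also have "\<dots> \<le> 640 * (n * W * L)" using assms(3) by (simp add: mult_ac)
  finally have 3: "(n + 1) * (60 * (L + 1) + 200) \<le> 640 * (n * W * L)" .
  have "a \<le> 260 * x \<Longrightarrow> b \<le> 640 * x \<Longrightarrow> 1 \<le> x \<Longrightarrow> a + b + 200 + 20 \<le> 1200 * x" for a b x :: nat
    by linarith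
  from this[OF 2 3 1] show ?thesis unfolding eval_time_def .
qed

text \<open>The product of candidates and steps per candidate contains \<open>r ^ 7\<close> and two
  factors \<open>2 ^ L\<close>, one from the number of sets and one from \<open>W\<close>. With
  \<open>r ^ 7 \<le> 2 ^ (7 * r\<^sup>2)\<close> and \<open>L = 8 * r\<^sup>2\<close> the exponent
  is \<open>7 + 8 + 8 = 23\<close> times \<open>r\<^sup>2\<close>. One factor \<open>n\<close> comes
  from the number of candidates, the other from the evaluation.\<close>

lemma total_time_le:
  assumes "n \<ge> 1" "r \<ge> 1" "L = 8 * r\<^sup>2" "W = 2 * r * L * 2 ^ L" "N = 3 * n * r\<^sup>2 * 2 ^ L"
  shows "(N + 3) * (eval_time n L W + 20) + 20 * (L + 10) + 30 * (n + 1) + 30 \<le> 2000000 * (2 ^ (23 * r\<^sup>2) * n\<^sup>2)"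
proof -
  have pos: "L \<ge> 1" "W \<ge> 1" "N \<ge> 1" using assms by (simp_all add: Suc_le_eq)
  let ?X = "N * (n * W * L)"
  have nL: "L \<le> n * W * L" "n \<le> n * W * L" "1 \<le> n * W * L"
    using assms(1) pos by (simp_all add: Suc_le_eq)
  have X: "n * W * L \<le> ?X" using pos by simp
  have "(N + 3) * (eval_time n L W + 20) \<le> (4 * N) * (1200 * (n * W * L))"
    using eval_time_le[OF assms(1) pos(1,2)] pos(3) by (intro mult_le_mono) auto
  then have A: "(N + 3) * (eval_time n L W + 20) \<le> 4800 * ?X" by simp
  have "L \<le> x \<Longrightarrow> n \<le> x \<Longrightarrow> 1 \<le> x \<Longrightarrow> 20 * (L + 10) + 30 * (n + 1) + 30 \<le> 310 * x" for x
    by simp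
  note B = this[OF nL]
  have "a \<le> 4800 * x \<Longrightarrow> b + c + d \<le> 310 * y \<Longrightarrow> y \<le> x \<Longrightarrow> a + b + c + d \<le> 5200 * x" for a b c d x y :: nat
    by simp
  from this[OF A B X]
  have "(N + 3) * (eval_time n L W + 20) + 20 * (L + 10) + 30 * (n + 1) + 30 \<le> 5200 * ?X" .
  also have "?X = 384 * (r ^ 7 * (2 ^ L * 2 ^ L) * n\<^sup>2)"
  proof -
    have r7: "r ^ 7 = r\<^sup>2 * r\<^sup>2 * r\<^sup>2 * r" by (simp add: numeral_eq_Suc)
    have "3 * n * s * p * (n * (2 * r * l * p) * l) = 384 * (s * s * s * r * (p * p) * n\<^sup>2)"
      if "l = 8 * s" for s p l
      unfolding that by (simp add: power2_eq_square)
    from this[OF assms(3)] show ?thesis unfolding assms(4,5) r7 .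
  qed
  also have "\<dots> \<le> 384 * (2 ^ (7 * r\<^sup>2) * (2 ^ L * 2 ^ L) * n\<^sup>2)"
  proof -
    have "r ^ 7 \<le> (2 ^ r) ^ 7" by (intro power_mono) (auto intro: less_imp_le less_exp)
    also have "\<dots> = 2 ^ (7 * r)" by (simp add: power_mult[symmetric] mult.commute)
    also have "\<dots> \<le> 2 ^ (7 * r\<^sup>2)" using assms(2) by (intro power_increasing) (auto simp: power2_eq_square)
    finally show ?thesis by (intro mult_le_mono) auto
  qed
  also have "(2::nat) ^ (7 * r\<^sup>2) * (2 ^ L * 2 ^ L) = 2 ^ (23 * r\<^sup>2)"
    unfolding assms(3) by (simp flip: power_add)
  finally show ?thesis by simp
qed

lemma power_le_powr:
  assumes "\<epsilon> > 0" "r = nat \<lfloor>11 / \<epsilon>\<rfloor> + 7"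
  shows "(2::real) ^ (23 * r\<^sup>2) \<le> 2 powr 2254 * 2 powr (5566 / \<epsilon>\<^sup>2)"
proof -
  have r: "real r \<le> 11 / \<epsilon> + 7" using assms by simp
  have "(real r)\<^sup>2 \<le> (11 / \<epsilon> + 7)\<^sup>2" using r by (intro power_mono) auto
  \<comment> \<open>\<open>(a + b)\<^sup>2 \<le> 2 * a\<^sup>2 + 2 * b\<^sup>2\<close> absorbs the
    cross term; multiplied by 23 it gives 5566 and 2254.\<close>
  also have "\<dots> \<le> 2 * (11 / \<epsilon>)\<^sup>2 + 98"
    using zero_le_power2[of "11 / \<epsilon> - 7"] by (simp add: power2_sum power2_diff)
  finally have "23 * (real r)\<^sup>2 \<le> 2254 + 5566 / \<epsilon>\<^sup>2" by (simp add: power_divide)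
  then have "2 powr (real (23 * r\<^sup>2)) \<le> (2::real) powr (2254 + 5566 / \<epsilon>\<^sup>2)" by (intro powr_mono) auto
  then show ?thesis by (simp only: powr_realpow powr_add zero_less_numeral)
qed

theorem theorem1p4:
  shows "\<exists>(p :: com) (a :: real) (b :: real) (d :: nat).
    \<forall>(\<epsilon> :: real) (n :: nat) (K :: nat \<Rightarrow> real) (H :: nat \<Rightarrow> real) (\<Delta> :: real).
      \<epsilon> > 0 \<longrightarrow> jrp_instance n K H \<longrightarrow> \<Delta> > 0 \<longrightarrow>
      (\<exists>t s. exec p (input_state \<epsilon> n K H \<Delta>) t s \<and>
        real t \<le> a * 2 powr (b / \<epsilon>\<^sup>2) * real n ^ d \<and>
        feasible n \<Delta> (output_policy s) \<and>
        avg_cost n K H (output_policy s) \<le> (1 / (sqrt 2 * ln 2) + \<epsilon>) * opt_cost n K H \<Delta>)"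
proof (rule exI[of _ jrp_prog], rule exI[of _ "2000000 * 2 powr 2254"], rule exI[of _ 5566],
    rule exI[of _ 2], intro allI impI)
  fix \<epsilon> :: real and n :: nat and K H :: "nat \<Rightarrow> real" and \<Delta> :: real
  assume eps: "\<epsilon> > 0" and inst: "jrp_instance n K H" and \<Delta>: "\<Delta> > 0"
  \<comment> \<open>The relative error is \<open>10 / r\<close> and the constant at most
    \<open>11 / 10\<close>, hence \<open>11 / \<epsilon>\<close>; the 7 makes
    \<open>ratio_bounds\<close> applicable. The program computes \<open>r\<close> itself, so one
    program serves every \<open>\<epsilon>\<close>.\<close>
  define r where "r = nat \<lfloor>11 / \<epsilon>\<rfloor> + 7"
  define L where "L = 8 * r\<^sup>2"
  define W where "W = 2 * r * L * 2 ^ L"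
  define N where "N = 3 * n * r\<^sup>2 * 2 ^ L"
  have n: "n \<ge> 1" using inst by (simp add: jrp_instance_def)
  have r7: "r \<ge> 7" unfolding r_def by simp
  obtain t s b where ex: "exec jrp_prog (input_state \<epsilon> n K H \<Delta>) t s"
    "t \<le> (N + 3) * (eval_time n L W + 20) + 20 * (L + 10) + 30 * (n + 1) + 30"
    and b: "b < N" "\<And>c. c < N \<Longrightarrow> candidate_estimate n K H \<Delta> r L W b \<le> candidate_estimate n K H \<Delta> r L W c"
    and s: "\<forall>i\<in>{1..n}. \<exists>q\<in>menu K H \<Delta> (candidate_set n r L b) (candidate_mult n K H \<Delta> r b) i. snd s i = real q * \<Delta>
        \<and> marginal_cost K H i (real q * \<Delta>) = menu_cost K H \<Delta> (candidate_set n r L b) (candidate_mult n K H \<Delta> r b) i"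
    using runs_jrp[OF inst eps r_def L_def W_def N_def, of \<Delta>] unfolding runs_def by blast
  have "t \<le> 2000000 * (2 ^ (23 * r\<^sup>2) * n\<^sup>2)"
    using ex(2) total_time_le[OF n _ L_def W_def N_def] r7 by linarith
  then have "real t \<le> real (2000000 * (2 ^ (23 * r\<^sup>2) * n\<^sup>2))" by (simp only: of_nat_le_iff)
  also have "\<dots> = 2000000 * (2 ^ (23 * r\<^sup>2) * (real n)\<^sup>2)" by simp
  also have "\<dots> \<le> 2000000 * ((2 powr 2254 * 2 powr (5566 / \<epsilon>\<^sup>2)) * (real n)\<^sup>2)"
    using power_le_powr[OF eps r_def] by (intro mult_left_mono mult_right_mono) auto
  finally have time: "real t \<le> 2000000 * 2 powr 2254 * 2 powr (5566 / \<epsilon>\<^sup>2) * real n ^ 2"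
    by (simp only: mult.assoc)
  obtain q where q: "\<And>i. i \<in> {1..n} \<Longrightarrow> q i \<in> menu K H \<Delta> (candidate_set n r L b) (candidate_mult n K H \<Delta> r b) i
      \<and> output_policy s i = real (q i) * \<Delta>
      \<and> marginal_cost K H i (output_policy s i) = menu_cost K H \<Delta> (candidate_set n r L b) (candidate_mult n K H \<Delta> r b) i"
    using s unfolding output_policy_def by metis
  have S: "candidate_set n r L b \<subseteq> {1..L}" "candidate_mult n K H \<Delta> r b \<ge> 1" "r \<ge> 1"
    using mask_set_subset base_mult_ge_1 r7 unfolding candidate_set_def candidate_mult_def by (blast, blast, linarith)
  note pol = policy_cost_le_estimate[OF inst \<Delta> S(1,3) W_def S(2) q]
  define c where "c = 1 / (sqrt 2 * ln (2::real))"
  have c: "0 < c" "c \<le> 11 / 10" using sqrt2_ln2_bounds(2) unfolding c_def by auto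
  have bound: "avg_cost n K H (output_policy s) \<le> (c * (1 + 10 / real r)) * avg_cost n K H T"
    if T: "feasible n \<Delta> T" for T
  proof -
    obtain S x l where *: "S \<subseteq> {1..L}" "base_candidate n K H \<Delta> r x" "1 \<le> l" "l \<le> r\<^sup>2"
      and e: "(1 + 1 / real r) * estimate n K H \<Delta> W S (base_mult r \<Delta> x l) \<le> c * (1 + 10 / real r) * avg_cost n K H T"
      using good_candidate[OF inst \<Delta> T r7 L_def W_def] unfolding c_def by blast
    obtain i where i: "i < N" "candidate_set n r L i = S" "candidate_mult n K H \<Delta> r i = base_mult r \<Delta> x l"
      using candidate_exists[OF * n] unfolding N_def by blast
    have "avg_cost n K H (output_policy s) \<le> (1 + 1 / real r) * candidate_estimate n K H \<Delta> r L W b"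
      using pol(2) unfolding candidate_estimate_def .
    also have "\<dots> \<le> (1 + 1 / real r) * candidate_estimate n K H \<Delta> r L W i"
      using b(2)[OF i(1)] by (intro mult_left_mono) auto
    also have "\<dots> = (1 + 1 / real r) * estimate n K H \<Delta> W S (base_mult r \<Delta> x l)"
      unfolding candidate_estimate_def i(2,3) ..
    finally show ?thesis using e by linarith
  qed
  have ne: "{T. feasible n \<Delta> T} \<noteq> {}" using pol(1) by blast
  define \<gamma> where "\<gamma> = c * (1 + 10 / real r)"
  have \<gamma>: "\<gamma> > 0" unfolding \<gamma>_def using c(1) by (intro mult_pos_pos add_pos_nonneg) auto
  \<comment> \<open>Comparing with every feasible policy bounds the infimum from below, whether or
    not it is attained.\<close>
  have "avg_cost n K H (output_policy s) / \<gamma> \<le> opt_cost n K H \<Delta>"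
    unfolding opt_cost_def using bound ne \<gamma>
    by (intro cINF_greatest) (auto simp: pos_divide_le_eq mult.commute simp flip: \<gamma>_def)
  then have opt: "avg_cost n K H (output_policy s) \<le> \<gamma> * opt_cost n K H \<Delta>"
    using \<gamma> by (simp add: pos_divide_le_eq mult.commute)
  \<comment> \<open>Replacing \<open>\<gamma>\<close> by the larger \<open>c + \<epsilon>\<close>
    requires a nonnegative optimum.\<close>
  have "0 \<le> opt_cost n K H \<Delta>" unfolding opt_cost_def
    using ne avg_cost_nonneg[OF inst \<Delta>] by (intro cINF_greatest) auto
  moreover have "\<gamma> \<le> c + \<epsilon>"
  proof -
    have r: "11 / \<epsilon> \<le> real r" "0 < real r" using r7 unfolding r_def by linarith+
    then have "11 / real r \<le> \<epsilon>" using eps by (simp add: pos_divide_le_eq mult.commute)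
    moreover have "c * (10 / real r) \<le> 11 / 10 * (10 / real r)" using c(2) r by (intro mult_right_mono) auto
    ultimately show ?thesis unfolding \<gamma>_def by (simp add: distrib_left)
  qed
  ultimately have "\<gamma> * opt_cost n K H \<Delta> \<le> (c + \<epsilon>) * opt_cost n K H \<Delta>" by (intro mult_right_mono)
  then show "\<exists>t s. exec jrp_prog (input_state \<epsilon> n K H \<Delta>) t s \<and>
      real t \<le> 2000000 * 2 powr 2254 * 2 powr (5566 / \<epsilon>\<^sup>2) * real n ^ 2 \<and>
      feasible n \<Delta> (output_policy s) \<and>
      avg_cost n K H (output_policy s) \<le> (1 / (sqrt 2 * ln 2) + \<epsilon>) * opt_cost n K H \<Delta>"
    using ex(1) time pol(1) opt unfolding c_def by (intro exI[of _ t] exI[of _ s]) auto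
qed

end
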